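(* The orbifold stratification is an invariant of the orbifold differential structure: if $X$ and $Y$ are orbifolds and $\varphi:X\to Y$ is a bijection such that $\varphi$ and $\varphi^{-1}$ are functionally smooth with respect to the orbifold differential structures $C^\infty(X)$ and $C^\infty(Y)$ (i.e. $\varphi^*C^\infty(Y)=C^\infty(X)$), then $\varphi$ maps each stratum of the orbifold stratification of $X$ onto a stratum of the orbifold stratification of $Y$.
   Context: Orbifolds (all effective). Let $X$ be a Hausdorff, paracompact, second-countable space, $n\ge 0$. An $n$-dimensional orbifold chart is a triple $(U,\Gamma,\phi)$ with $U\subseteq\mathbb{R}^n$ open, $\Gamma$ a finite group of diffeomorphisms of $U$, and $\phi:U\to X$ a $\Gamma$-invariant map inducing a homeomorphism $U/\Gamma\to\phi(U)$ onto an open subset of $X$. An embedding $\lambda:(U,\Gamma,\phi)\to(V,\Delta,\psi)$ is a smooth embedding $\lambda:U\to V$ with $\psi\circ\lambda=\phi$. An orbifold atlas is a family of $n$-dimensional charts covering $X$ such that for any two of its charts $(U,\Gamma,\phi),(V,\Delta,\psi)$ there are charts $(W_\alpha,\Gamma_\alpha,\chi_\alpha)$ embedding into both, with $\{\chi_\alpha(W_\alpha)\}$ an open cover of $\phi(U)\cap\psi(V)$. Atlases are equivalent if they have a common refinement ($\mathcal{U}$ refines $\mathcal{V}$ if each chart of $\mathcal{U}$ embeds into one of $\mathcal{V}$); an orbifold is $X$ with a maximal atlas. Orbifold differential structure. $C^\infty(X)$ is the set of $f:X\to\mathbb{R}$ such that $f\circ\phi$ is smooth for every chart $(U,\Gamma,\phi)$.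 Orbifold stratification. For a chart $(U,\Gamma,\phi)$ and a subgroup $H\le\Gamma$ let $U_{(H)}$ be the set of points of $U$ whose stabiliser is conjugate to $H$ in $\Gamma$. The strata of $\phi(U)$ are the connected components of the sets $\phi(U_{(H)})$. These local partitions are compatible and glue: the orbifold stratification of $X$ is the unique partition of $X$ into connected subsets $M$ (strata) such that for every chart the strata of $\phi(U)$ are the connected components of the sets $M\cap\phi(U)$. *)

theory Defs
  imports
    "HOL-Analysis.Analysis"
    "HOL-Algebra.Bij"
    "HOL-Algebra.Group_Action"
    "HOL-Library.Disjoint_Sets"
begin

section \<open>Smooth maps between open subsets of Euclidean spaces\<close>

text \<open>
  The space of dimension \<open>n \<ge> 0\<close> is \<^const>\<open>Euclidean_space\<close> \<open>n\<close>: the real sequences that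
  vanish from index \<open>n\<close> on.  Unlike the types of class \<^class>\<open>euclidean_space\<close> this includes
  the zero-dimensional space.  In the definitions below \<open>U\<close> is meant to be open; a partial
  derivative at a point of \<open>U\<close> then depends only on the values of the function on \<open>U\<close>.
\<close>

definition partial_deriv :: "nat \<Rightarrow> ((nat \<Rightarrow> real) \<Rightarrow> real) \<Rightarrow> (nat \<Rightarrow> real) \<Rightarrow> real" where
  "partial_deriv i f x = deriv (\<lambda>t. f (x(i := t))) (x i)"

primrec Ck_on :: "nat \<Rightarrow> (nat \<Rightarrow> real) set \<Rightarrow> nat \<Rightarrow> ((nat \<Rightarrow> real) \<Rightarrow> real) \<Rightarrow> bool" where
  "Ck_on n U 0 f \<longleftrightarrow> continuous_map (subtopology (Euclidean_space n) U) euclideanreal f"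
| "Ck_on n U (Suc k) f \<longleftrightarrow>
     continuous_map (subtopology (Euclidean_space n) U) euclideanreal f \<and>
     (\<forall>i<n. (\<forall>x\<in>U. (\<lambda>t. f (x(i := t))) field_differentiable (at (x i))) \<and>
            Ck_on n U k (partial_deriv i f))"

definition smooth_on :: "nat \<Rightarrow> (nat \<Rightarrow> real) set \<Rightarrow> ((nat \<Rightarrow> real) \<Rightarrow> real) \<Rightarrow> bool" where
  "smooth_on n U f \<longleftrightarrow> (\<forall>k. Ck_on n U k f)"

definition smooth_map :: "nat \<Rightarrow> (nat \<Rightarrow> real) set \<Rightarrow> (nat \<Rightarrow> real) set \<Rightarrow>
    ((nat \<Rightarrow> real) \<Rightarrow> (nat \<Rightarrow> real)) \<Rightarrow> bool" where
  "smooth_map n U V F \<longleftrightarrow> F \<in> U \<rightarrow> V \<and> (\<forall>j<n. smooth_on n U (\<lambda>x. F x j))"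

text \<open>A smooth embedding is an immersion (injective Jacobian matrix at each point) that is a
  homeomorphism onto its image.\<close>

definition smooth_embedding :: "nat \<Rightarrow> (nat \<Rightarrow> real) set \<Rightarrow> (nat \<Rightarrow> real) set \<Rightarrow>
    ((nat \<Rightarrow> real) \<Rightarrow> (nat \<Rightarrow> real)) \<Rightarrow> bool" where
  "smooth_embedding n U V F \<longleftrightarrow>
     smooth_map n U V F \<and>
     embedding_map (subtopology (Euclidean_space n) U) (subtopology (Euclidean_space n) V) F \<and>
     (\<forall>x\<in>U. \<forall>v\<in>topspace (Euclidean_space n).
        (\<forall>j<n. (\<Sum>i<n. partial_deriv i (\<lambda>y. F y j) x * v i) = 0) \<longrightarrow> v = (\<lambda>_. 0))"

section \<open>Orbifold charts\<close>

text \<open>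
  A chart on a space with points in \<open>'a\<close> is a triple \<open>(U, \<Gamma>, \<phi>)\<close>.  The maps in \<open>\<Gamma>\<close>, and \<open>\<phi>\<close>,
  are extensional on \<open>U\<close>, so that they are determined by their values on \<open>U\<close>.
\<close>

type_synonym 'a orbi_chart =
  "(nat \<Rightarrow> real) set \<times> ((nat \<Rightarrow> real) \<Rightarrow> (nat \<Rightarrow> real)) set \<times> ((nat \<Rightarrow> real) \<Rightarrow> 'a)"

definition chart_group :: "'u set \<Rightarrow> ('u \<Rightarrow> 'u) set \<Rightarrow> ('u \<Rightarrow> 'u) monoid" where
  "chart_group U \<Gamma> = (BijGroup U)\<lparr>carrier := \<Gamma>\<rparr>"

abbreviation chart_orbit :: "'u set \<Rightarrow> ('u \<Rightarrow> 'u) set \<Rightarrow> 'u \<Rightarrow> 'u set" where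
  "chart_orbit U \<Gamma> u \<equiv> orbit (chart_group U \<Gamma>) (\<lambda>g. g) u"

abbreviation chart_stabilizer :: "'u set \<Rightarrow> ('u \<Rightarrow> 'u) set \<Rightarrow> 'u \<Rightarrow> ('u \<Rightarrow> 'u) set" where
  "chart_stabilizer U \<Gamma> u \<equiv> stabilizer (chart_group U \<Gamma>) (\<lambda>g. g) u"

text \<open>The quotient \<open>U/\<Gamma>\<close> with the quotient topology, for \<open>U\<close> a subspace of \<open>T\<close>.\<close>

definition orbit_space :: "'u topology \<Rightarrow> 'u set \<Rightarrow> ('u \<Rightarrow> 'u) set \<Rightarrow> 'u set topology" where
  "orbit_space T U \<Gamma> = topology (\<lambda>W. W \<subseteq> chart_orbit U \<Gamma> ` U \<and>
     openin (subtopology T U) {u \<in> U. chart_orbit U \<Gamma> u \<in> W})"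

lemma openin_orbit_space:
  "openin (orbit_space T U \<Gamma>) W \<longleftrightarrow> W \<subseteq> chart_orbit U \<Gamma> ` U \<and>
     openin (subtopology T U) {u \<in> U. chart_orbit U \<Gamma> u \<in> W}"
proof -
  let ?q = "chart_orbit U \<Gamma>"
  let ?P = "\<lambda>W. W \<subseteq> ?q ` U \<and> openin (subtopology T U) {u \<in> U. ?q u \<in> W}"
  have "istopology ?P"
    unfolding istopology_def
  proof (intro conjI allI impI)
    fix S V assume S: "?P S" and V: "?P V"
    have "{u \<in> U. ?q u \<in> S \<inter> V} = {u \<in> U. ?q u \<in> S} \<inter> {u \<in> U. ?q u \<in> V}" by auto
    moreover have "openin (subtopology T U) ({u \<in> U. ?q u \<in> S} \<inter> {u \<in> U. ?q u \<in> V})"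
      using S V by (intro openin_Int) blast+
    ultimately show "openin (subtopology T U) {u \<in> U. ?q u \<in> S \<inter> V}"
      by simp
    show "S \<inter> V \<subseteq> ?q ` U" using S by auto
  next
    fix K assume K: "\<forall>S\<in>K. ?P S"
    have "{u \<in> U. ?q u \<in> \<Union>K} = (\<Union>S\<in>K. {u \<in> U. ?q u \<in> S})" by auto
    moreover have "openin (subtopology T U) (\<Union>S\<in>K. {u \<in> U. ?q u \<in> S})"
      using K by (intro openin_Union) blast
    ultimately show "openin (subtopology T U) {u \<in> U. ?q u \<in> \<Union>K}"
      by simp
    show "\<Union>K \<subseteq> ?q ` U" using K by auto
  qed
  then show ?thesis
    by (simp add: orbit_space_def topology_inverse')
qed

text \<open>Since \<open>\<Gamma>\<close> is closed under inverses, smoothness of its elements makes them diffeomorphisms.\<close>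

definition orbifold_chart :: "nat \<Rightarrow> 'a topology \<Rightarrow> 'a orbi_chart \<Rightarrow> bool" where
  "orbifold_chart n X = (\<lambda>(U, \<Gamma>, \<phi>).
     openin (Euclidean_space n) U \<and>
     subgroup \<Gamma> (BijGroup U) \<and> finite \<Gamma> \<and> (\<forall>g\<in>\<Gamma>. smooth_map n U U g) \<and>
     \<phi> \<in> U \<rightarrow>\<^sub>E topspace X \<and>
     (\<forall>g\<in>\<Gamma>. \<forall>u\<in>U. \<phi> (g u) = \<phi> u) \<and>
     openin X (\<phi> ` U) \<and>
     (\<exists>h. homeomorphic_map (orbit_space (Euclidean_space n) U \<Gamma>) (subtopology X (\<phi> ` U)) h \<and>
          (\<forall>u\<in>U. h (chart_orbit U \<Gamma> u) = \<phi> u)))"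

definition chart_image :: "'a orbi_chart \<Rightarrow> 'a set" where
  "chart_image = (\<lambda>(U, \<Gamma>, \<phi>). \<phi> ` U)"

definition chart_embeds :: "nat \<Rightarrow> 'a orbi_chart \<Rightarrow> 'a orbi_chart \<Rightarrow> bool" where
  "chart_embeds n = (\<lambda>(U, \<Gamma>, \<phi>) (V, \<Delta>, \<psi>).
     \<exists>l. smooth_embedding n U V l \<and> (\<forall>u\<in>U. \<psi> (l u) = \<phi> u))"

section \<open>Atlases and orbifolds\<close>

definition orbifold_atlas :: "nat \<Rightarrow> 'a topology \<Rightarrow> 'a orbi_chart set \<Rightarrow> bool" where
  "orbifold_atlas n X A \<longleftrightarrow>
     (\<forall>c\<in>A. orbifold_chart n X c) \<and>
     (\<Union>c\<in>A. chart_image c) = topspace X \<and>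
     (\<forall>c\<in>A. \<forall>d\<in>A. \<exists>W.
        (\<forall>w\<in>W. orbifold_chart n X w \<and> chart_embeds n w c \<and> chart_embeds n w d) \<and>
        (\<Union>w\<in>W. chart_image w) = chart_image c \<inter> chart_image d)"

definition atlas_refines :: "nat \<Rightarrow> 'a orbi_chart set \<Rightarrow> 'a orbi_chart set \<Rightarrow> bool" where
  "atlas_refines n A B \<longleftrightarrow> (\<forall>c\<in>A. \<exists>d\<in>B. chart_embeds n c d)"

definition atlas_equivalent ::
    "nat \<Rightarrow> 'a topology \<Rightarrow> 'a orbi_chart set \<Rightarrow> 'a orbi_chart set \<Rightarrow> bool" where
  "atlas_equivalent n X A B \<longleftrightarrow>
     (\<exists>C. orbifold_atlas n X C \<and> atlas_refines n C A \<and> atlas_refines n C B)"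

definition maximal_atlas :: "nat \<Rightarrow> 'a topology \<Rightarrow> 'a orbi_chart set \<Rightarrow> bool" where
  "maximal_atlas n X A \<longleftrightarrow>
     orbifold_atlas n X A \<and>
     (\<forall>B. orbifold_atlas n X B \<and> atlas_equivalent n X A B \<longrightarrow> B \<subseteq> A)"

text \<open>The Hausdorff condition is imposed separately.\<close>

definition paracompact_space :: "'a topology \<Rightarrow> bool" where
  "paracompact_space X \<longleftrightarrow>
     (\<forall>\<C>. (\<forall>C\<in>\<C>. openin X C) \<and> \<Union>\<C> = topspace X \<longrightarrow>
        (\<exists>\<D>. (\<forall>D\<in>\<D>. openin X D \<and> (\<exists>C\<in>\<C>. D \<subseteq> C)) \<and> \<Union>\<D> = topspace X \<and>
             (\<forall>x\<in>topspace X. \<exists>N. openin X N \<and> x \<in> N \<and> finite {D \<in> \<D>. D \<inter> N \<noteq> {}})))"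

definition orbifold :: "nat \<Rightarrow> 'a topology \<Rightarrow> 'a orbi_chart set \<Rightarrow> bool" where
  "orbifold n X A \<longleftrightarrow>
     Hausdorff_space X \<and> paracompact_space X \<and> second_countable X \<and> maximal_atlas n X A"

section \<open>The orbifold differential structure\<close>

text \<open>Real functions on the orbifold are total functions here; membership depends only on their
  values on the underlying space, since that space contains the images of all charts.\<close>

definition orbifold_smooth_functions :: "nat \<Rightarrow> 'a orbi_chart set \<Rightarrow> ('a \<Rightarrow> real) set" where
  "orbifold_smooth_functions n A = {f. \<forall>(U, \<Gamma>, \<phi>)\<in>A. smooth_on n U (f \<circ> \<phi>)}"

definition functionally_smooth :: "('a \<Rightarrow> real) set \<Rightarrow> ('b \<Rightarrow> real) set \<Rightarrow> ('a \<Rightarrow> 'b) \<Rightarrow> bool" where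
  "functionally_smooth \<F> \<G> f \<longleftrightarrow> (\<forall>g\<in>\<G>. g \<circ> f \<in> \<F>)"

section \<open>The orbifold stratification\<close>

definition orbit_type_set :: "'u set \<Rightarrow> ('u \<Rightarrow> 'u) set \<Rightarrow> ('u \<Rightarrow> 'u) set \<Rightarrow> 'u set" where
  "orbit_type_set U \<Gamma> H =
     {u \<in> U. \<exists>g\<in>\<Gamma>. chart_stabilizer U \<Gamma> u =
        g <#\<^bsub>chart_group U \<Gamma>\<^esub> H #>\<^bsub>chart_group U \<Gamma>\<^esub> (inv\<^bsub>chart_group U \<Gamma>\<^esub> g)}"

definition chart_strata :: "'a topology \<Rightarrow> 'a orbi_chart \<Rightarrow> 'a set set" where
  "chart_strata X = (\<lambda>(U, \<Gamma>, \<phi>).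
     \<Union>H\<in>{H. subgroup H (chart_group U \<Gamma>)}.
       connected_components_of (subtopology X (\<phi> ` orbit_type_set U \<Gamma> H)))"

definition orbifold_stratification :: "'a topology \<Rightarrow> 'a orbi_chart set \<Rightarrow> 'a set set" where
  "orbifold_stratification X A = (THE S.
     partition_on (topspace X) S \<and>
     (\<forall>M\<in>S. connectedin X M) \<and>
     (\<forall>c\<in>A. chart_strata X c =
        (\<Union>M\<in>S. connected_components_of (subtopology X (M \<inter> chart_image c)))))"

end

theory Submission
  imports
    Defs
    "HOL-Homology.Invariance_of_Domain"
    "Jordan_Normal_Form.Determinant"
begin

text \<open>
  The stratification is recovered from the differential structure alone.  Call \<open>f\<close> critical at
  \<open>x\<close> if \<open>\<bar>f - f x\<bar> \<le> g\<close> near \<open>x\<close> for some smooth \<open>g\<close> with \<open>g x = 0\<close>; in a chart this says that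
  the differential of \<open>f\<close> vanishes.  Let \<open>d x\<close> be the dimension of the smooth functions modulo
  those critical at \<open>x\<close>.  In a chart \<open>d\<close> is the dimension of the space of covectors invariant
  under the stabiliser.  Averaging linearises the stabiliser \<open>\<Gamma>\<^sub>u\<close> near \<open>u\<close>, which shows that \<open>d\<close>
  is larger at nearby points with smaller stabiliser, and that the points with stabiliser \<open>\<Gamma>\<^sub>u\<close>
  form a linear subspace.  Hence the strata of a chart, and then also the global strata, are the
  connected components of the level sets of \<open>d\<close>.
\<close>

text \<open>The usual cotangent space I/I^2, where I is the ideal of smooth functions vanishing at
  x, cannot define d: on the quotient of the line by x \<mapsto> -x the function x^2 lies in I but
  not in I^2 at the origin, and the dimension is 1 everywhere. Domination by a smooth function that
  vanishes at x discards x^2 and is still free of charts; the dominating function has a minimum at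
  x, which forces the differential to vanish. Two points need care. Neither does d determine the
  orbit type, nor the orbit type d, so the two kinds of sets are compared only through their
  components, by means of neighbourhoods in which all stabilisers lie in that of the centre. And the
  stratification is defined by a uniqueness property among all partitions into connected sets, so
  partitions that join strata of different dimension must be excluded; this uses segments along
  which the stabiliser can change only at an end point. The topology is recovered by bump functions,
  whose compact supports are closed because the orbifold is Hausdorff.\<close>

section \<open>Calculus on open subsets of Euclidean space\<close>

abbreviation Rn :: "nat \<Rightarrow> (nat \<Rightarrow> real) set" where
  "Rn n \<equiv> topspace (Euclidean_space n)"

abbreviation eopen :: "nat \<Rightarrow> (nat \<Rightarrow> real) set \<Rightarrow> bool" where
  "eopen n \<equiv> openin (Euclidean_space n)"

abbreviation esub :: "nat \<Rightarrow> (nat \<Rightarrow> real) set \<Rightarrow> (nat \<Rightarrow> real) topology" where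
  "esub n \<equiv> subtopology (Euclidean_space n)"

text \<open>Balls of the sup norm. A point that takes each coordinate from one of two points of a
  cube is again in the cube, which suits arguments that move one coordinate at a time.\<close>

definition cube :: "nat \<Rightarrow> (nat \<Rightarrow> real) \<Rightarrow> real \<Rightarrow> (nat \<Rightarrow> real) set" where
  "cube n x d = {y \<in> Rn n. \<forall>i<n. \<bar>y i - x i\<bar> < d}"

lemma Rn_eqI: "x \<in> Rn n \<Longrightarrow> y \<in> Rn n \<Longrightarrow> (\<And>i. i < n \<Longrightarrow> x i = y i) \<Longrightarrow> x = y"
  by (rule ext) (metis (mono_tags, lifting) mem_Collect_eq not_le_imp_less topspace_Euclidean_space)

lemma Rn_upd [simp]: "x \<in> Rn n \<Longrightarrow> i < n \<Longrightarrow> x(i := t) \<in> Rn n"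
  by (auto simp: topspace_Euclidean_space)

lemma continuous_map_coord: "continuous_map (Euclidean_space n) euclideanreal (\<lambda>x. x i)"
  unfolding Euclidean_space_def
  by (intro continuous_map_from_subtopology continuous_map_product_projection) simp

lemma cube_self: "x \<in> Rn n \<Longrightarrow> 0 < d \<Longrightarrow> x \<in> cube n x d"
  by (simp add: cube_def)

lemma openin_cube: "eopen n (cube n x d)"
proof -
  have 1: "eopen n {y \<in> Rn n. y i - x i \<in> {-d<..<d}}" for i
    by (intro openin_continuous_map_preimage[where Y = euclideanreal])
       (auto intro!: continuous_intros continuous_map_coord)
  have "eopen n ((\<Inter>i<n. {y \<in> Rn n. y i - x i \<in> {-d<..<d}}) \<inter> Rn n)"
    using 1 by (induction n) (auto intro!: openin_Int openin_INT)
  also have "(\<Inter>i<n. {y \<in> Rn n. y i - x i \<in> {-d<..<d}}) \<inter> Rn n = cube n x d"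
    by (force simp: cube_def abs_less_iff)
  finally show ?thesis .
qed

text \<open>A basic open set of the product topology is a box. Coordinates from n on are 0
  throughout, so only the first n sides matter, and the smallest of them gives a cube.\<close>

lemma openin_Rn_iff:
  "eopen n U \<longleftrightarrow> U \<subseteq> Rn n \<and> (\<forall>x\<in>U. \<exists>d>0. cube n x d \<subseteq> U)"
proof (intro iffI conjI ballI)
  assume U: "eopen n U"
  show Us: "U \<subseteq> Rn n" using U by (rule openin_subset)
  fix x assume x: "x \<in> U"
  obtain T where T: "openin (powertop_real UNIV) T" "U = T \<inter> Rn n"
    using U unfolding Euclidean_space_def by (auto simp: openin_subtopology topspace_Euclidean_space)
  then obtain X where X: "x \<in> Pi\<^sub>E UNIV X" "\<And>i. open (X i)" "Pi\<^sub>E UNIV X \<subseteq> T"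
    using product_topology_open_contains_basis[OF T(1), of x] x by auto
  have "\<exists>d>0. \<forall>t. \<bar>t - x i\<bar> < d \<longrightarrow> t \<in> X i" for i
    using X(1) X(2)[of i] by (auto simp: open_dist dist_real_def PiE_iff)
  then obtain d where d: "\<And>i. d i > 0" "\<And>i t. \<bar>t - x i\<bar> < d i \<Longrightarrow> t \<in> X i" by metis
  \<comment> \<open>The inserted 1 keeps the minimum over a nonempty set when n = 0. The same device
    recurs below.\<close>
  define e where "e = Min (insert 1 (d ` {..<n}))"
  have e: "e > 0" "\<And>i. i < n \<Longrightarrow> e \<le> d i" using d(1) by (auto simp: e_def)
  have "cube n x e \<subseteq> U"
  proof
    fix y assume y: "y \<in> cube n x e"
    have "y i \<in> X i" for i
    proof (cases "i < n")
      case True then show ?thesis using y d(2) e(2)[of i] by (force simp: cube_def)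
    next
      case False
      then have "y i = x i" using y x Us by (auto simp: cube_def topspace_Euclidean_space)
      then show ?thesis using X(1) by auto
    qed
    then show "y \<in> U" using X(3) T(2) y by (auto simp: cube_def PiE_iff)
  qed
  then show "\<exists>d>0. cube n x d \<subseteq> U" using e(1) by blast
next
  assume U: "U \<subseteq> Rn n \<and> (\<forall>x\<in>U. \<exists>d>0. cube n x d \<subseteq> U)"
  show "eopen n U"
  proof (subst openin_subopen, intro ballI)
    fix x assume "x \<in> U"
    then show "\<exists>T. eopen n T \<and> x \<in> T \<and> T \<subseteq> U"
      using U openin_cube cube_self by (meson subsetD)
  qed
qed

lemma cube_mono: "d \<le> e \<Longrightarrow> cube n x d \<subseteq> cube n x e"
  by (auto simp: cube_def)

lemma cube_upd:
  assumes "x \<in> Rn n" "\<bar>t - x i\<bar> < d" "i < n" "0 < d"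
  shows "x(i := t) \<in> cube n x d"
  using assms by (auto simp: cube_def)

lemma continuous_map_cube_iff:
  assumes U: "eopen n U"
  shows "continuous_map (esub n U) euclideanreal f \<longleftrightarrow>
    (\<forall>x\<in>U. \<forall>e>0. \<exists>d>0. \<forall>y\<in>cube n x d. y \<in> U \<and> \<bar>f y - f x\<bar> < e)"
proof (intro iffI ballI allI impI)
  fix x and e :: real
  assume f: "continuous_map (esub n U) euclideanreal f" and x: "x \<in> U" "0 < e"
  have "openin (esub n U)
      {y \<in> topspace (esub n U). f y \<in> {f x - e<..<f x + e}}"
    by (rule openin_continuous_map_preimage[OF f]) auto
  then have "eopen n {y \<in> U. f y \<in> {f x - e<..<f x + e}}"
    unfolding topspace_subtopology_subset[OF openin_subset[OF U]] openin_open_subtopology[OF U] by blast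
  then obtain d where "d > 0" "cube n x d \<subseteq> {y \<in> U. f y \<in> {f x - e<..<f x + e}}"
    using x unfolding openin_Rn_iff by force
  then show "\<exists>d>0. \<forall>y\<in>cube n x d. y \<in> U \<and> \<bar>f y - f x\<bar> < e"
    by (intro exI[of _ d]) (auto simp: abs_less_iff subset_iff)
next
  assume f: "\<forall>x\<in>U. \<forall>e>0. \<exists>d>0. \<forall>y\<in>cube n x d. y \<in> U \<and> \<bar>f y - f x\<bar> < e"
  show "continuous_map (esub n U) euclideanreal f"
  proof (simp add: continuous_map_def, intro allI impI)
    fix T :: "real set" assume T: "open T"
    have "eopen n {x \<in> U. f x \<in> T}"
      unfolding openin_Rn_iff
    proof (intro conjI ballI)
      show "{x \<in> U. f x \<in> T} \<subseteq> Rn n" using U openin_subset by fastforce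
      fix x assume x: "x \<in> {x \<in> U. f x \<in> T}"
      then obtain e where "e > 0" "\<And>s. \<bar>s - f x\<bar> < e \<Longrightarrow> s \<in> T"
        using T by (auto simp: open_dist dist_real_def)
      moreover obtain d where "d > 0" "\<forall>y\<in>cube n x d. y \<in> U \<and> \<bar>f y - f x\<bar> < e"
        using f x calculation(1) by force
      ultimately show "\<exists>d>0. cube n x d \<subseteq> {x \<in> U. f x \<in> T}" by blast
    qed
    moreover have "{x. x \<in> Rn n \<and> x \<in> U \<and> f x \<in> T} = {x \<in> U. f x \<in> T}"
      using U openin_subset by fastforce
    ultimately show "openin (esub n U) {x. x \<in> Rn n \<and> x \<in> U \<and> f x \<in> T}"
      using U by (auto simp: openin_open_subtopology)
  qed
qed

lemma continuous_map_cubeE: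
  assumes "eopen n U" "continuous_map (esub n U) euclideanreal f"
    "x \<in> U" "0 < (e::real)"
  obtains d where "d > 0" "cube n x d \<subseteq> U" "\<And>y. y \<in> cube n x d \<Longrightarrow> \<bar>f y - f x\<bar> < e"
  using assms(2-) unfolding continuous_map_cube_iff[OF assms(1)] by (meson subsetI)

section \<open>Locality of partial derivatives and of the classes \<open>Ck_on\<close>\<close>

lemma partial_deriv_cong:
  assumes U: "eopen n U" and x: "x \<in> U" and i: "i < n"
    and fg: "\<And>y. y \<in> U \<Longrightarrow> f y = g y"
  shows "partial_deriv i f x = partial_deriv i g x"
    and "(\<lambda>t. f (x(i := t))) field_differentiable at (x i) \<longleftrightarrow>
         (\<lambda>t. g (x(i := t))) field_differentiable at (x i)"
proof -
  obtain d where d: "d > 0" "cube n x d \<subseteq> U" using U x unfolding openin_Rn_iff by blast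
  have xn: "x \<in> Rn n" using U x openin_subset by blast
  have ev: "\<forall>\<^sub>F t in nhds (x i). f (x(i := t)) = g (x(i := t))"
    unfolding eventually_nhds_metric
  proof (intro exI conjI allI impI)
    show "0 < d" by fact
    fix t assume "dist t (x i) < d"
    then have "x(i := t) \<in> cube n x d" using cube_upd[OF xn] i d by (simp add: dist_real_def)
    then show "f (x(i := t)) = g (x(i := t))" using d fg by blast
  qed
  show "partial_deriv i f x = partial_deriv i g x"
    unfolding partial_deriv_def by (rule deriv_cong_ev[OF ev refl])
  show "(\<lambda>t. f (x(i := t))) field_differentiable at (x i) \<longleftrightarrow>
         (\<lambda>t. g (x(i := t))) field_differentiable at (x i)"
    unfolding field_differentiable_def using DERIV_cong_ev[OF refl ev refl] by blast
qed

lemma Ck_on_cong: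
  assumes U: "eopen n U" and fg: "\<And>y. y \<in> U \<Longrightarrow> f y = g y"
  shows "Ck_on n U k f \<longleftrightarrow> Ck_on n U k g"
proof -
  have cm: "continuous_map (esub n U) euclideanreal f \<longleftrightarrow>
      continuous_map (esub n U) euclideanreal g"
    if "\<And>y. y \<in> U \<Longrightarrow> f y = g y" for f g
    using that by (intro iffI; elim continuous_map_eq; simp)
  show ?thesis
    using fg
  proof (induction k arbitrary: f g)
    case 0
    then show ?case unfolding Ck_on.simps by (rule cm)
  next
    case (Suc k)
    have "Ck_on n U k (partial_deriv i f) \<longleftrightarrow> Ck_on n U k (partial_deriv i g)" if "i < n" for i
      by (rule Suc.IH, rule partial_deriv_cong(1)[OF U _ that Suc.prems])
    moreover have "continuous_map (esub n U) euclideanreal f \<longleftrightarrow>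
        continuous_map (esub n U) euclideanreal g"
      using Suc.prems by (rule cm)
    moreover have "\<forall>x\<in>U. (\<lambda>t. f (x(i := t))) field_differentiable at (x i) \<longleftrightarrow>
           (\<lambda>t. g (x(i := t))) field_differentiable at (x i)" if "i < n" for i
      by (intro ballI partial_deriv_cong(2)[OF U _ that]) (simp_all add: Suc.prems)
    ultimately show ?case by auto
  qed
qed

lemma Ck_on_continuous: "Ck_on n U k f \<Longrightarrow> continuous_map (esub n U) euclideanreal f"
  by (cases k) auto

lemma Ck_on_SucD: "Ck_on n U (Suc k) f \<Longrightarrow> Ck_on n U k f"
  by (induction k arbitrary: f) (auto)

lemma Ck_on_subset: "Ck_on n U k f \<Longrightarrow> V \<subseteq> U \<Longrightarrow> Ck_on n V k f"
  by (induction k arbitrary: f) (auto intro: continuous_map_from_subtopology_mono)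

lemma Ck_on_local:
  assumes U: "eopen n U"
    and "\<And>x. x \<in> U \<Longrightarrow> \<exists>V. eopen n V \<and> x \<in> V \<and> V \<subseteq> U \<and> Ck_on n V k f"
  shows "Ck_on n U k f"
  using assms(2)
proof (induction k arbitrary: f)
  case 0
  show ?case
    unfolding Ck_on.simps continuous_map_cube_iff[OF U]
  proof (intro ballI allI impI)
    fix x and e :: real assume "x \<in> U" "0 < e"
    then obtain V where V: "eopen n V" "x \<in> V" "V \<subseteq> U" "Ck_on n V 0 f"
      using 0 by blast
    then show "\<exists>d>0. \<forall>y\<in>cube n x d. y \<in> U \<and> \<bar>f y - f x\<bar> < e"
      using \<open>0 < e\<close> unfolding Ck_on.simps continuous_map_cube_iff[OF V(1)] by blast
  qed
next
  case (Suc k)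
  have "Ck_on n U k f"
  proof (rule Suc.IH)
    fix x assume "x \<in> U"
    from Suc.prems[OF this] show "\<exists>V. eopen n V \<and> x \<in> V \<and> V \<subseteq> U \<and> Ck_on n V k f"
      using Ck_on_SucD by blast
  qed
  moreover have "(\<lambda>t. f (x(i := t))) field_differentiable at (x i)" if "x \<in> U" "i < n" for i x
    using Suc.prems[OF that(1)] that by auto
  moreover have "Ck_on n U k (partial_deriv i f)" if "i < n" for i
  proof (rule Suc.IH)
    fix x assume "x \<in> U"
    from Suc.prems[OF this]
    show "\<exists>V. eopen n V \<and> x \<in> V \<and> V \<subseteq> U \<and> Ck_on n V k (partial_deriv i f)"
      using that unfolding Ck_on.simps by blast
  qed
  ultimately show ?case using Ck_on_continuous by simp
qed

section \<open>Strict differentiability and the chain rule along curves\<close>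

lemma partial_deriv_has:
  assumes "Ck_on n U (Suc k) f" "x(i := t) \<in> U" "i < n"
  shows "((\<lambda>s. f (x(i := s))) has_field_derivative partial_deriv i f (x(i := t))) (at t)"
proof -
  have "\<forall>x\<in>U. (\<lambda>t. f (x(i := t))) field_differentiable at (x i)"
    using assms(1,3) by simp
  from bspec[OF this assms(2)]
  have "(\<lambda>s. f ((x(i := t))(i := s))) field_differentiable at ((x(i := t)) i)" .
  then have "(\<lambda>s. f (x(i := s))) field_differentiable at t" by simp
  then show ?thesis unfolding partial_deriv_def by (simp add: field_differentiable_derivI)
qed

lemma partial_deriv_has':
  assumes "Ck_on n U (Suc k) f" "x \<in> U" "i < n"
  shows "((\<lambda>s. f (x(i := s))) has_field_derivative partial_deriv i f x) (at (x i))"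
  using partial_deriv_has[of n U k f x i "x i"] assms by simp

text \<open>Lets the closure lemmas below propose a formula f' for the derivatives; uniqueness of
  derivatives identifies it with \<open>partial_deriv\<close> on U.\<close>

lemma Ck_on_SucI:
  assumes U: "eopen n U"
    and c: "continuous_map (esub n U) euclideanreal f"
    and d: "\<And>i x. i < n \<Longrightarrow> x \<in> U \<Longrightarrow> ((\<lambda>s. f (x(i := s))) has_field_derivative f' i x) (at (x i))"
    and "\<And>i. i < n \<Longrightarrow> Ck_on n U k (f' i)"
  shows "Ck_on n U (Suc k) f"
proof -
  have "partial_deriv i f x = f' i x" if "i < n" "x \<in> U" for i x
    using d[OF that] unfolding partial_deriv_def by (rule DERIV_imp_deriv)
  then have "Ck_on n U k (partial_deriv i f)" if "i < n" for i
    using Ck_on_cong[OF U] assms(4) that by blast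
  then show ?thesis using c d by (auto simp: field_differentiable_def)
qed

text \<open>Strict differentiability: both a and b vary near x, with the derivative frozen at x.
  This stronger form follows from continuity of the partial derivatives, and local injectivity will
  be deduced from it.\<close>

lemma strict_diff:
  assumes U: "eopen n U" and f: "Ck_on n U (Suc k) f" and x: "x \<in> U" and e: "0 < e"
  shows "\<exists>d>0. cube n x d \<subseteq> U \<and> (\<forall>a\<in>cube n x d. \<forall>b\<in>cube n x d.
      \<bar>f a - f b - (\<Sum>i<n. partial_deriv i f x * (a i - b i))\<bar> \<le> e * (\<Sum>i<n. \<bar>a i - b i\<bar>))"
proof -
  have "\<exists>d>0. cube n x d \<subseteq> U \<and> (\<forall>y\<in>cube n x d. \<bar>partial_deriv i f y - partial_deriv i f x\<bar> < e)"
    if "i < n" for i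
  proof -
    have "continuous_map (esub n U) euclideanreal (partial_deriv i f)"
      using f that Ck_on_continuous by auto
    from continuous_map_cubeE[OF U this x e] show ?thesis by metis
  qed
  then obtain D where D: "\<And>i. i < n \<Longrightarrow> D i > 0"
    "\<And>i. i < n \<Longrightarrow> (\<forall>y\<in>cube n x (D i). \<bar>partial_deriv i f y - partial_deriv i f x\<bar> < e)" by metis
  obtain d0 where d0: "d0 > 0" "cube n x d0 \<subseteq> U" using U x unfolding openin_Rn_iff by blast
  define d where "d = Min (insert d0 (D ` {..<n}))"
  have d: "d > 0" "d \<le> d0" "\<And>i. i < n \<Longrightarrow> d \<le> D i" using D(1) d0 by (auto simp: d_def)
  have dU: "cube n x d \<subseteq> U" using d0 cube_mono[OF d(2)] by blast
  have pd: "\<bar>partial_deriv i f y - partial_deriv i f x\<bar> < e" if "i < n" "y \<in> cube n x d" for i y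
    using D(2)[OF that(1)] cube_mono[OF d(3)[OF that(1)]] that(2) by blast
  have "\<bar>f a - f b - (\<Sum>i<n. partial_deriv i f x * (a i - b i))\<bar> \<le> e * (\<Sum>i<n. \<bar>a i - b i\<bar>)"
    if ab: "a \<in> cube n x d" "b \<in> cube n x d" for a b
  proof -
    \<comment> \<open>The path from b to a that changes one coordinate at a time. On each step the
      mean value theorem applies, at points that remain in the cube.\<close>
    define p where "p k = (\<lambda>i. if i < k then a i else b i)" for k
    have p0: "p 0 = b" by (simp add: p_def)
    have pn: "p n = a"
      using ab by (intro Rn_eqI[of _ n]) (auto simp: p_def cube_def topspace_Euclidean_space)
    have step: "\<bar>f (p (Suc k)) - f (p k) - partial_deriv k f x * (a k - b k)\<bar> \<le> e * \<bar>a k - b k\<bar>"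
      if k: "k < n" for k
    proof -
      let ?g = "\<lambda>t. f ((p k)(k := t))"
      have c: "(p k)(k := t) \<in> cube n x d" if "t \<in> closed_segment (b k) (a k)" for t
      proof -
        have "\<bar>t - x k\<bar> < d"
        proof -
          have "\<bar>a k - x k\<bar> < d" "\<bar>b k - x k\<bar> < d" using ab k by (auto simp: cube_def)
          then show ?thesis using that by (auto simp: closed_segment_eq_real_ivl split: if_splits)
        qed
        then show ?thesis using ab k by (auto simp: cube_def p_def topspace_Euclidean_space)
      qed
      have "\<exists>\<xi>\<in>closed_segment (b k) (a k). ?g (a k) - ?g (b k) = (a k - b k) * partial_deriv k f ((p k)(k := \<xi>))"
      proof -
        have D: "DERIV ?g t :> partial_deriv k f ((p k)(k := t))" if "t \<in> closed_segment (b k) (a k)" for t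
          using partial_deriv_has[OF f _ k] c[OF that] dU by blast
        consider "a k = b k" | "b k < a k" | "a k < b k" by linarith
        then show ?thesis
        proof cases
          case 2
          then obtain z where "z > b k" "z < a k" "?g (a k) - ?g (b k) = (a k - b k) * partial_deriv k f ((p k)(k := z))"
            using MVT2[of "b k" "a k" ?g "\<lambda>t. partial_deriv k f ((p k)(k := t))"] D
            by (auto simp: closed_segment_eq_real_ivl)
          with 2 show ?thesis by (intro bexI[of _ z]) (auto simp: closed_segment_eq_real_ivl)
        next
          case 3
          then obtain z where "z > a k" "z < b k" "?g (b k) - ?g (a k) = (b k - a k) * partial_deriv k f ((p k)(k := z))"
            using MVT2[of "a k" "b k" ?g "\<lambda>t. partial_deriv k f ((p k)(k := t))"] D
            by (auto simp: closed_segment_eq_real_ivl)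
          with 3 show ?thesis by (intro bexI[of _ z]) (auto simp: closed_segment_eq_real_ivl algebra_simps)
        qed auto
      qed
      moreover have "(p k)(k := a k) = p (Suc k)" "(p k)(k := b k) = p k"
        by (auto simp: p_def fun_eq_iff less_Suc_eq)
      ultimately obtain \<xi> where xi: "\<xi> \<in> closed_segment (b k) (a k)"
        "f (p (Suc k)) - f (p k) = (a k - b k) * partial_deriv k f ((p k)(k := \<xi>))" by auto
      have "\<bar>f (p (Suc k)) - f (p k) - partial_deriv k f x * (a k - b k)\<bar>
          = \<bar>partial_deriv k f ((p k)(k := \<xi>)) - partial_deriv k f x\<bar> * \<bar>a k - b k\<bar>"
        unfolding xi(2) by (simp add: algebra_simps flip: abs_mult)
      also have "\<dots> \<le> e * \<bar>a k - b k\<bar>"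
        using pd[OF k c[OF xi(1)]] by (intro mult_right_mono) auto
      finally show ?thesis .
    qed
    have "f a - f b = (\<Sum>k<n. f (p (Suc k)) - f (p k))"
      by (subst sum_lessThan_telescope) (simp add: p0 pn)
    then have "\<bar>f a - f b - (\<Sum>i<n. partial_deriv i f x * (a i - b i))\<bar>
        = \<bar>\<Sum>k<n. (f (p (Suc k)) - f (p k) - partial_deriv k f x * (a k - b k))\<bar>"
      by (simp only: sum_subtractf)
    also have "\<dots> \<le> (\<Sum>k<n. e * \<bar>a k - b k\<bar>)"
      by (rule order_trans[OF sum_abs sum_mono]) (use step in auto)
    finally show ?thesis by (simp add: sum_distrib_left)
  qed
  then show ?thesis using d(1) dU by blast
qed

text \<open>The derivatives control only the first n coordinates of \<gamma>; the eventual
  membership in \<open>Rn n\<close> is what puts \<gamma> t into a cube where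
  \<open>strict_diff\<close> applies.\<close>

lemma chain_curve:
  assumes U: "eopen n U" and f: "Ck_on n U (Suc k) f" and x: "\<gamma> t0 \<in> U"
    and ev: "\<forall>\<^sub>F t in at t0. \<gamma> t \<in> Rn n"
    and d: "\<And>i. i < n \<Longrightarrow> ((\<lambda>t. \<gamma> t i) has_field_derivative \<gamma>' i) (at t0)"
  shows "((\<lambda>t. f (\<gamma> t)) has_field_derivative (\<Sum>i<n. partial_deriv i f (\<gamma> t0) * \<gamma>' i)) (at t0)"
proof -
  let ?x = "\<gamma> t0"
  define q where "q i t = (\<gamma> t i - \<gamma> t0 i) / (t - t0)" for i t
  have q: "(q i \<longlongrightarrow> \<gamma>' i) (at t0)" if "i < n" for i
    using d[OF that] unfolding q_def has_field_derivative_iff .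
  define R where "R t = (f (\<gamma> t) - f ?x) / (t - t0) - (\<Sum>i<n. partial_deriv i f ?x * q i t)" for t
  have R: "(R \<longlongrightarrow> 0) (at t0)"
  proof (rule tendstoI)
    fix e :: real assume e: "0 < e"
    \<comment> \<open>C exceeds the limit of the sum of the |q i t|, so this sum is eventually below
      C, and an error rate of e / 2 / C leaves at most e / 2.\<close>
    define C where "C = (\<Sum>i<n. \<bar>\<gamma>' i\<bar>) + 1"
    have C: "C > 0" unfolding C_def by (simp add: add_nonneg_pos sum_nonneg)
    have "0 < e / 2 / C" using e C by simp
    from strict_diff[OF U f x this]
    obtain \<delta> where \<delta>: "0 < \<delta>" "\<forall>a\<in>cube n ?x \<delta>. \<forall>b\<in>cube n ?x \<delta>.
      \<bar>f a - f b - (\<Sum>i<n. partial_deriv i f ?x * (a i - b i))\<bar> \<le> (e / 2 / C) * (\<Sum>i<n. \<bar>a i - b i\<bar>)"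
      by blast
    have "\<forall>\<^sub>F t in at t0. \<forall>i\<in>{..<n}. \<bar>\<gamma> t i - ?x i\<bar> < \<delta>"
    proof (rule eventually_ball_finite)
      show "\<forall>i\<in>{..<n}. \<forall>\<^sub>F t in at t0. \<bar>\<gamma> t i - ?x i\<bar> < \<delta>"
        using tendstoD[OF DERIV_isCont[OF d, unfolded isCont_def] \<delta>(1)] by (simp add: dist_real_def)
    qed simp
    moreover have "\<forall>\<^sub>F t in at t0. (\<Sum>i<n. \<bar>q i t\<bar>) < C"
    proof (rule order_tendstoD(2))
      show "((\<lambda>t. \<Sum>i<n. \<bar>q i t\<bar>) \<longlongrightarrow> (\<Sum>i<n. \<bar>\<gamma>' i\<bar>)) (at t0)"
        by (intro tendsto_intros q) auto
    qed (simp add: C_def)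
    moreover have "\<forall>\<^sub>F t in at t0. t \<noteq> t0" by (simp add: eventually_at_filter)
    ultimately show "\<forall>\<^sub>F t in at t0. dist (R t) 0 < e" using ev
    proof eventually_elim
      case (elim t)
      have "\<gamma> t \<in> cube n ?x \<delta>" using elim by (simp add: cube_def)
      moreover have "?x \<in> cube n ?x \<delta>" using U x \<delta>(1) openin_subset cube_self by blast
      ultimately have le: "\<bar>f (\<gamma> t) - f ?x - (\<Sum>i<n. partial_deriv i f ?x * (\<gamma> t i - ?x i))\<bar>
          \<le> (e / 2 / C) * (\<Sum>i<n. \<bar>\<gamma> t i - ?x i\<bar>)" using \<delta>(2) by blast
      have "R t = (f (\<gamma> t) - f ?x - (\<Sum>i<n. partial_deriv i f ?x * (\<gamma> t i - ?x i))) / (t - t0)"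
      proof -
        have "(\<Sum>i<n. partial_deriv i f ?x * q i t) = (\<Sum>i<n. partial_deriv i f ?x * (\<gamma> t i - ?x i)) / (t - t0)"
          by (simp add: q_def sum_divide_distrib)
        then show ?thesis by (simp add: R_def diff_divide_distrib)
      qed
      then have "\<bar>R t\<bar> = \<bar>f (\<gamma> t) - f ?x - (\<Sum>i<n. partial_deriv i f ?x * (\<gamma> t i - ?x i))\<bar> / \<bar>t - t0\<bar>"
        by simp
      also have "\<dots> \<le> (e / 2 / C) * (\<Sum>i<n. \<bar>\<gamma> t i - ?x i\<bar>) / \<bar>t - t0\<bar>"
        by (intro divide_right_mono le) auto
      also have "\<dots> = (e / 2 / C) * (\<Sum>i<n. \<bar>q i t\<bar>)"
      proof -
        have "(\<Sum>i<n. \<bar>q i t\<bar>) = (\<Sum>i<n. \<bar>\<gamma> t i - ?x i\<bar>) / \<bar>t - t0\<bar>"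
          by (simp add: q_def sum_divide_distrib)
        then show ?thesis by simp
      qed
      also have "\<dots> \<le> (e / 2 / C) * C"
        using elim e C by (intro mult_left_mono) auto
      also have "\<dots> < e" using e C by simp
      finally show ?case by simp
    qed
  qed
  have "((\<lambda>t. R t + (\<Sum>i<n. partial_deriv i f ?x * q i t)) \<longlongrightarrow> 0 + (\<Sum>i<n. partial_deriv i f ?x * \<gamma>' i)) (at t0)"
    by (intro tendsto_intros R q) auto
  then show ?thesis unfolding has_field_derivative_iff R_def by simp
qed

section \<open>Closure of \<open>Ck_on\<close> under algebraic operations\<close>

lemma Ck_on_partial_deriv: "Ck_on n U (Suc k) f \<Longrightarrow> i < n \<Longrightarrow> Ck_on n U k (partial_deriv i f)"
  by simp

lemma Ck_on_const [simp]:
  assumes U: "eopen n U"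
  shows "Ck_on n U k (\<lambda>_. c)"
proof (induction k arbitrary: c)
  case (Suc k)
  show ?case by (rule Ck_on_SucI[OF U, where f' = "\<lambda>_ _. 0"]) (auto intro: Suc)
qed auto

lemma Ck_on_coord [simp]:
  assumes U: "eopen n U"
  shows "Ck_on n U k (\<lambda>x. x j)"
proof (cases k)
  case 0
  then show ?thesis by (auto intro: continuous_map_from_subtopology continuous_map_coord)
next
  case (Suc k)
  have "((\<lambda>s. (x(i := s)) j) has_field_derivative (if i = j then 1 else 0)) (at (x i))" for x :: "nat \<Rightarrow> real" and i
    by (cases "i = j") auto
  then show ?thesis unfolding Suc
    by (intro Ck_on_SucI[OF U, where f' = "\<lambda>i _. if i = j then 1 else 0"] Ck_on_const[OF U])
       (auto intro: continuous_map_from_subtopology continuous_map_coord)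
qed

lemma Ck_on_add:
  assumes U: "eopen n U"
  shows "Ck_on n U k f \<Longrightarrow> Ck_on n U k g \<Longrightarrow> Ck_on n U k (\<lambda>x. f x + g x)"
proof (induction k arbitrary: f g)
  case (Suc k)
  show ?case
  proof (rule Ck_on_SucI[OF U, where f' = "\<lambda>i x. partial_deriv i f x + partial_deriv i g x"])
    show "((\<lambda>s. f (x(i := s)) + g (x(i := s))) has_field_derivative
        partial_deriv i f x + partial_deriv i g x) (at (x i))" if "i < n" "x \<in> U" for i x
      by (intro DERIV_add partial_deriv_has'[OF Suc.prems(1)] partial_deriv_has'[OF Suc.prems(2)] that)
  qed (use Suc in \<open>auto intro: continuous_map_add\<close>)
qed (auto intro: continuous_map_add)

lemma Ck_on_mult:
  assumes U: "eopen n U"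
  shows "Ck_on n U k f \<Longrightarrow> Ck_on n U k g \<Longrightarrow> Ck_on n U k (\<lambda>x. f x * g x)"
proof (induction k arbitrary: f g)
  case (Suc k)
  show ?case
  proof (rule Ck_on_SucI[OF U, where f' = "\<lambda>i x. partial_deriv i f x * g x + partial_deriv i g x * f x"])
    show "((\<lambda>s. f (x(i := s)) * g (x(i := s))) has_field_derivative
        partial_deriv i f x * g x + partial_deriv i g x * f x) (at (x i))" if "i < n" "x \<in> U" for i x
      using DERIV_mult[OF partial_deriv_has'[OF Suc.prems(1) that(2,1)] partial_deriv_has'[OF Suc.prems(2) that(2,1)]]
      unfolding fun_upd_triv .
    show "Ck_on n U k (\<lambda>x. partial_deriv i f x * g x + partial_deriv i g x * f x)" if "i < n" for i
      by (intro Ck_on_add[OF U] Suc.IH Ck_on_SucD[OF Suc.prems(1)] Ck_on_SucD[OF Suc.prems(2)]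
          Ck_on_partial_deriv[OF Suc.prems(1)] Ck_on_partial_deriv[OF Suc.prems(2)] that)
  qed (use Suc in \<open>auto intro: continuous_map_real_mult\<close>)
qed (auto intro: continuous_map_real_mult)

lemma Ck_on_cmult: "eopen n U \<Longrightarrow> Ck_on n U k f \<Longrightarrow> Ck_on n U k (\<lambda>x. c * f x)"
  by (intro Ck_on_mult Ck_on_const)

lemma Ck_on_diff: "eopen n U \<Longrightarrow> Ck_on n U k f \<Longrightarrow> Ck_on n U k g \<Longrightarrow> Ck_on n U k (\<lambda>x. f x - g x)"
  using Ck_on_add[of n U k f "\<lambda>x. - 1 * g x"] Ck_on_cmult[of n U k g "-1"] by simp

lemma Ck_on_sum:
  assumes U: "eopen n U"
  shows "(\<And>i. i \<in> I \<Longrightarrow> Ck_on n U k (f i)) \<Longrightarrow> Ck_on n U k (\<lambda>x. \<Sum>i\<in>I. f i x)"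
  by (induction I rule: infinite_finite_induct) (auto intro!: Ck_on_add Ck_on_const U)

lemma Ck_on_prod:
  assumes U: "eopen n U"
  shows "(\<And>i. i \<in> I \<Longrightarrow> Ck_on n U k (f i)) \<Longrightarrow> Ck_on n U k (\<lambda>x. \<Prod>i\<in>I. f i x)"
  by (induction I rule: infinite_finite_induct) (auto intro!: Ck_on_mult Ck_on_const U)

lemma Ck_on_inverse:
  assumes U: "eopen n U" and nz: "\<And>x. x \<in> U \<Longrightarrow> f x \<noteq> 0"
  shows "Ck_on n U k f \<Longrightarrow> Ck_on n U k (\<lambda>x. inverse (f x))"
proof (induction k)
  case (Suc k)
  show ?case
  proof (rule Ck_on_SucI[OF U, where f' = "\<lambda>i x. - 1 * (partial_deriv i f x * (inverse (f x) * inverse (f x)))"])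
    show "((\<lambda>s. inverse (f (x(i := s)))) has_field_derivative
        - 1 * (partial_deriv i f x * (inverse (f x) * inverse (f x)))) (at (x i))" if "i < n" "x \<in> U" for i x
      using nz[OF that(2)]
      by (intro DERIV_cong[OF DERIV_inverse_fun[OF partial_deriv_has'[OF Suc.prems that(2,1)]]])
         (simp_all add: power2_eq_square)
    show "Ck_on n U k (\<lambda>x. - 1 * (partial_deriv i f x * (inverse (f x) * inverse (f x))))" if "i < n" for i
      by (rule Ck_on_cmult[OF U]) (intro Ck_on_mult[OF U] Suc.IH Ck_on_SucD[OF Suc.prems] Ck_on_partial_deriv[OF Suc.prems] that)
  qed (use Suc nz U in \<open>auto intro!: continuous_map_real_inverse simp: topspace_subtopology\<close>)
qed (use nz in \<open>auto intro!: continuous_map_real_inverse\<close>)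

section \<open>Composition of maps of class C^k\<close>

lemma continuous_map_intoI:
  assumes V: "V \<subseteq> Rn n" and "\<And>x. x \<in> topspace T \<Longrightarrow> F x \<in> V"
    and c: "\<And>j. j < n \<Longrightarrow> continuous_map T euclideanreal (\<lambda>x. F x j)"
  shows "continuous_map T (esub n V) F"
proof -
  have "continuous_map T (Euclidean_space n) (\<lambda>x i. if i < n then F x i else 0)"
    unfolding continuous_map_componentwise_Euclidean_space using c by blast
  then have "continuous_map T (Euclidean_space n) F"
  proof (rule continuous_map_eq)
    fix x assume "x \<in> topspace T"
    then have "F x \<in> Rn n" using assms by blast
    then show "(\<lambda>i. if i < n then F x i else 0) = F x" by (auto simp: topspace_Euclidean_space)
  qed
  then show ?thesis using assms by (auto simp: continuous_map_in_subtopology)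
qed

lemma eventually_upd_in:
  assumes "eopen n U" "x \<in> U" "i < n"
  shows "\<forall>\<^sub>F t in nhds (x i). x(i := t) \<in> U"
proof -
  obtain d where d: "d > 0" "cube n x d \<subseteq> U" using assms unfolding openin_Rn_iff by blast
  have "x \<in> Rn n" using assms openin_subset by blast
  then have "\<forall>t. dist t (x i) < d \<longrightarrow> x(i := t) \<in> U"
    using cube_upd[of x n _ i d] d assms(3) by (simp add: dist_real_def subset_iff)
  then show ?thesis unfolding eventually_nhds_metric using d(1) by blast
qed

lemma has_partial_deriv_compose:
  assumes U: "eopen n U" and V: "eopen n V"
    and F: "\<And>y. y \<in> U \<Longrightarrow> F y \<in> V" "\<And>j. j < n \<Longrightarrow> Ck_on n U (Suc k) (\<lambda>x. F x j)"
    and f: "Ck_on n V (Suc l) f" and x: "x \<in> U" "i < n"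
  shows "((\<lambda>s. f (F (x(i := s)))) has_field_derivative
      (\<Sum>j<n. partial_deriv j f (F x) * partial_deriv i (\<lambda>y. F y j) x)) (at (x i))"
proof -
  have "\<forall>\<^sub>F t in at (x i). F (x(i := t)) \<in> Rn n"
    using eventually_upd_in[OF U x, THEN eventually_nhds_conv_at[THEN iffD1, THEN conjunct1]]
    by eventually_elim (use F V openin_subset in blast)
  from chain_curve[OF V f _ this, of "\<lambda>j. partial_deriv i (\<lambda>y. F y j) x"]
  show ?thesis using partial_deriv_has'[OF F(2) x] F(1) x by simp
qed

lemma partial_deriv_compose:
  assumes U: "eopen n U" and V: "eopen n V"
    and F: "\<And>y. y \<in> U \<Longrightarrow> F y \<in> V" "\<And>j. j < n \<Longrightarrow> Ck_on n U (Suc k) (\<lambda>x. F x j)"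
    and f: "Ck_on n V (Suc l) f" and x: "x \<in> U" "i < n"
  shows "partial_deriv i (\<lambda>y. f (F y)) x = (\<Sum>j<n. partial_deriv j f (F x) * partial_deriv i (\<lambda>y. F y j) x)"
  using has_partial_deriv_compose[OF assms] unfolding partial_deriv_def[of i "\<lambda>y. f (F y)"] by (rule DERIV_imp_deriv)

lemma Ck_on_compose:
  assumes U: "eopen n U" and V: "eopen n V"
    and F: "\<And>y. y \<in> U \<Longrightarrow> F y \<in> V"
  shows "(\<And>j. j < n \<Longrightarrow> Ck_on n U k (\<lambda>x. F x j)) \<Longrightarrow> Ck_on n V k f \<Longrightarrow> Ck_on n U k (\<lambda>x. f (F x))"
proof (induction k arbitrary: f)
  case 0
  have "continuous_map (esub n U) (esub n V) F"
    using 0 F by (intro continuous_map_intoI openin_subset[OF V]) auto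
  from continuous_map_compose[OF this] 0 show ?case by (simp add: o_def)
next
  case (Suc k)
  have FC: "continuous_map (esub n U) (esub n V) F"
    using F by (intro continuous_map_intoI openin_subset[OF V] Ck_on_continuous[OF Suc.prems(1)]) auto
  show ?case
  proof (rule Ck_on_SucI[OF U])
    show "continuous_map (esub n U) euclideanreal (\<lambda>x. f (F x))"
      using continuous_map_compose[OF FC Ck_on_continuous[OF Suc.prems(2)]] by (simp add: o_def)
    show "((\<lambda>s. f (F (x(i := s)))) has_field_derivative
      (\<Sum>j<n. partial_deriv j f (F x) * partial_deriv i (\<lambda>y. F y j) x)) (at (x i))" if "i < n" "x \<in> U" for i x
      by (rule has_partial_deriv_compose[OF U V F Suc.prems(1) Suc.prems(2) that(2,1)])
    show "Ck_on n U k (\<lambda>x. \<Sum>j<n. partial_deriv j f (F x) * partial_deriv i (\<lambda>y. F y j) x)" if i: "i < n" for i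
    proof (intro Ck_on_sum[OF U] Ck_on_mult[OF U])
      fix j assume j: "j \<in> {..<n}"
      show "Ck_on n U k (\<lambda>x. partial_deriv j f (F x))"
      proof (rule Suc.IH)
        show "Ck_on n U k (\<lambda>x. F x j')" if "j' < n" for j' by (rule Ck_on_SucD[OF Suc.prems(1)[OF that]])
        show "Ck_on n V k (partial_deriv j f)" using j by (intro Ck_on_partial_deriv[OF Suc.prems(2)]) simp
      qed
      show "Ck_on n U k (\<lambda>x. partial_deriv i (\<lambda>y. F y j) x)"
        using j by (intro Ck_on_partial_deriv[OF Suc.prems(1) i]) simp
    qed
  qed
qed

text \<open>These functions, which are flat at \<open>0\<close>, are closed under differentiation.\<close>

definition flat_poly :: "real poly \<Rightarrow> real \<Rightarrow> real" where
  "flat_poly p t = (if t > 0 then poly p (inverse t) * exp (- inverse t) else 0)"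

lemma poly_times_exp_minus_tendsto_0: "((\<lambda>s. poly p s * exp (- s)) \<longlongrightarrow> (0::real)) at_top"
proof -
  have "((\<lambda>s. \<Sum>i\<le>degree p. Polynomial.coeff p i * (s ^ i / exp s)) \<longlongrightarrow> (\<Sum>i\<le>degree p. Polynomial.coeff p i * 0)) at_top"
    by (intro tendsto_intros tendsto_power_div_exp_0)
  then show ?thesis
    by (simp add: poly_altdef sum_distrib_right exp_minus divide_inverse mult.assoc)
qed

text \<open>For t > 0 and s = 1/t the derivative of p(s) exp(-s) is s^2 (p - p')(s) exp(-s), whence
  the factor \<open>[:0, 0, 1:]\<close>. At 0 the difference quotient from the right is s p(s)
  exp(-s), which tends to 0 as s tends to infinity.\<close>

lemma has_derivative_flat_poly:
  "(flat_poly p has_field_derivative flat_poly ([:0, 0, 1:] * (p - pderiv p)) t) (at t)"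
proof -
  consider "t > 0" | "t < 0" | "t = 0" by linarith
  then show ?thesis
  proof cases
    case 1
    have "((\<lambda>t. poly p (inverse t) * exp (- inverse t)) has_field_derivative
       poly p (inverse t) * (exp (- inverse t) * (inverse t * inverse t))
       + poly (pderiv p) (inverse t) * (- (inverse t * inverse t)) * exp (- inverse t)) (at t)"
      using 1 by (auto intro!: derivative_eq_intros DERIV_chain2[OF poly_DERIV] simp: power2_eq_square)
    also have "poly p (inverse t) * (exp (- inverse t) * (inverse t * inverse t))
       + poly (pderiv p) (inverse t) * (- (inverse t * inverse t)) * exp (- inverse t)
       = flat_poly ([:0, 0, 1:] * (p - pderiv p)) t"
      using 1 by (simp add: flat_poly_def algebra_simps)
    finally show ?thesis
    proof (rule has_field_derivative_transform_within_open)
      show "open {0::real<..}" "t \<in> {0<..}" using 1 by (auto simp: open_greaterThan)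
    qed (auto simp: flat_poly_def)
  next
    case 2
    have "((\<lambda>_. 0) has_field_derivative 0) (at t)" by simp
    then have "(flat_poly p has_field_derivative 0) (at t)"
    proof (rule has_field_derivative_transform_within_open)
      show "open {..<0::real}" "t \<in> {..<0}" using 2 by (auto simp: open_lessThan)
    qed (auto simp: flat_poly_def)
    then show ?thesis using 2 by (simp add: flat_poly_def)
  next
    case 3
    have "((\<lambda>t. flat_poly p t / t) \<longlongrightarrow> 0) (at 0)"
    proof -
      \<comment> \<open>Dividing by t multiplies by s = 1/t, which turns p into
        \<open>pCons 0 p\<close>.\<close>
      have "((\<lambda>t. poly (pCons 0 p) (inverse t) * exp (- inverse t)) \<longlongrightarrow> (0::real)) (at_right 0)"
        by (rule filterlim_compose[OF poly_times_exp_minus_tendsto_0 filterlim_inverse_at_top_right])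
      then have "((\<lambda>t. flat_poly p t / t) \<longlongrightarrow> 0) (at_right 0)"
        by (rule Lim_transform_eventually)
           (auto simp: eventually_at_filter flat_poly_def field_simps)
      moreover have "((\<lambda>t. flat_poly p t / t) \<longlongrightarrow> 0) (at_left 0)"
        by (rule Lim_transform_eventually[OF tendsto_const]) (auto simp: eventually_at_filter flat_poly_def)
      ultimately show ?thesis by (simp add: filterlim_at_split)
    qed
    then show ?thesis unfolding 3 has_field_derivative_iff by (simp add: flat_poly_def)
  qed
qed

text \<open>Differentiation changes the polynomial, so p must vary in the induction on k.\<close>

lemma Ck_on_flat_poly:
  assumes U: "eopen n U"
  shows "Ck_on n U k f \<Longrightarrow> Ck_on n U k (\<lambda>x. flat_poly p (f x))"
proof (induction k arbitrary: p)
  case 0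
  have "continuous_on UNIV (flat_poly p)"
    by (intro continuous_at_imp_continuous_on ballI DERIV_isCont[OF has_derivative_flat_poly])
  then have "continuous_map euclideanreal euclideanreal (flat_poly p)" by simp
  from continuous_map_compose[OF _ this] 0 show ?case by (simp add: o_def)
next
  case (Suc k)
  have "continuous_on UNIV (flat_poly p)"
    by (intro continuous_at_imp_continuous_on ballI DERIV_isCont[OF has_derivative_flat_poly])
  then have C: "continuous_map euclideanreal euclideanreal (flat_poly p)" by simp
  let ?q = "[:0, 0, 1:] * (p - pderiv p)"
  show ?case
  proof (rule Ck_on_SucI[OF U])
    show "continuous_map (esub n U) euclideanreal (\<lambda>x. flat_poly p (f x))"
      using continuous_map_compose[OF Ck_on_continuous[OF Suc.prems] C] by (simp add: o_def)
    show "((\<lambda>s. flat_poly p (f (x(i := s)))) has_field_derivative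
        flat_poly ?q (f x) * partial_deriv i f x) (at (x i))" if "i < n" "x \<in> U" for i x
      using DERIV_chain2[OF has_derivative_flat_poly[of p "f (x(i := x i))"] partial_deriv_has'[OF Suc.prems that(2,1)]]
      unfolding fun_upd_triv .
    show "Ck_on n U k (\<lambda>x. flat_poly ?q (f x) * partial_deriv i f x)" if "i < n" for i
      by (intro Ck_on_mult[OF U] Suc.IH Ck_on_SucD[OF Suc.prems] Ck_on_partial_deriv[OF Suc.prems] that)
  qed
qed

text \<open>The adjugate divided by the determinant. Both are polynomial in the entries, so smooth
  dependence on a parameter can be read off.\<close>

definition matinv :: "nat \<Rightarrow> (nat \<Rightarrow> nat \<Rightarrow> real) \<Rightarrow> nat \<Rightarrow> nat \<Rightarrow> real" where
  "matinv n a i j = cofactor (mat n n (\<lambda>(i, j). a i j)) j i * inverse (Determinant.det (mat n n (\<lambda>(i, j). a i j)))"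

text \<open>Links the injectivity of the Jacobian demanded by \<open>smooth_embedding\<close> to a
  determinant, which depends continuously on the point.\<close>

lemma det_nz_iff:
  "Determinant.det (mat n n (\<lambda>(i, j). a i j)) \<noteq> (0::real) \<longleftrightarrow>
    (\<forall>v\<in>Rn n. (\<forall>j<n. (\<Sum>i<n. a j i * v i) = 0) \<longrightarrow> v = (\<lambda>_. 0))"
proof -
  let ?A = "mat n n (\<lambda>(i, j). a i j)"
  have mv: "?A *\<^sub>v v = 0\<^sub>v n \<longleftrightarrow> (\<forall>j<n. (\<Sum>i<n. a j i * v $ i) = 0)" if "v \<in> carrier_vec n" for v
    using that by (auto simp: vec_eq_iff scalar_prod_def lessThan_atLeast0)
  have "Determinant.det ?A = 0 \<longleftrightarrow> (\<exists>v. v \<in> carrier_vec n \<and> v \<noteq> 0\<^sub>v n \<and> ?A *\<^sub>v v = 0\<^sub>v n)"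
    by (rule det_0_iff_vec_prod_zero_field) simp
  also have "\<dots> \<longleftrightarrow> (\<exists>v\<in>Rn n. (\<forall>j<n. (\<Sum>i<n. a j i * v i) = 0) \<and> v \<noteq> (\<lambda>_. 0))"
  proof
    assume "\<exists>v. v \<in> carrier_vec n \<and> v \<noteq> 0\<^sub>v n \<and> ?A *\<^sub>v v = 0\<^sub>v n"
    then obtain v where v: "v \<in> carrier_vec n" "v \<noteq> 0\<^sub>v n" "?A *\<^sub>v v = 0\<^sub>v n" by blast
    define w where "w i = (if i < n then v $ i else 0)" for i
    have "w \<in> Rn n" by (simp add: w_def topspace_Euclidean_space)
    moreover have "\<forall>j<n. (\<Sum>i<n. a j i * w i) = 0" using v mv by (simp add: w_def)
    moreover have "w \<noteq> (\<lambda>_. 0)"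
    proof
      assume "w = (\<lambda>_. 0)"
      then have "v $ i = 0" if "i < n" for i using that unfolding w_def by meson
      then have "v = 0\<^sub>v n" using v(1) by (intro eq_vecI) auto
      then show False using v by blast
    qed
    ultimately show "\<exists>v\<in>Rn n. (\<forall>j<n. (\<Sum>i<n. a j i * v i) = 0) \<and> v \<noteq> (\<lambda>_. 0)" by blast
  next
    assume "\<exists>v\<in>Rn n. (\<forall>j<n. (\<Sum>i<n. a j i * v i) = 0) \<and> v \<noteq> (\<lambda>_. 0)"
    then obtain w where w: "w \<in> Rn n" "\<forall>j<n. (\<Sum>i<n. a j i * w i) = 0" "w \<noteq> (\<lambda>_. 0)" by blast
    have "vec n w \<in> carrier_vec n" by simp
    moreover have "?A *\<^sub>v vec n w = 0\<^sub>v n" using w mv[of "vec n w"] by simp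
    moreover have "vec n w \<noteq> 0\<^sub>v n"
    proof
      assume "vec n w = 0\<^sub>v n"
      then have "w i = 0" if "i < n" for i using that by (metis index_vec index_zero_vec(1))
      then have "w = (\<lambda>_. 0)" using w(1) by (intro Rn_eqI[of _ n]) (auto simp: topspace_Euclidean_space)
      then show False using w by blast
    qed
    ultimately show "\<exists>v. v \<in> carrier_vec n \<and> v \<noteq> 0\<^sub>v n \<and> ?A *\<^sub>v v = 0\<^sub>v n" by blast
  qed
  finally show ?thesis by blast
qed

lemma matinv:
  assumes nz: "Determinant.det (mat n n (\<lambda>(i, j). a i j)) \<noteq> (0::real)" and ij: "i < n" "j < n"
  shows "(\<Sum>k<n. matinv n a i k * a k j) = (if i = j then 1 else 0)"
    and "(\<Sum>k<n. a i k * matinv n a k j) = (if i = j then 1 else 0)"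
proof -
  let ?A = "mat n n (\<lambda>(i, j). a i j)"
  have A: "?A \<in> carrier_mat n n" by simp
  have "(adj_mat ?A * ?A) $$ (i, j) = (\<Sum>k<n. cofactor ?A k i * a k j)"
    using ij adj_mat(1)[OF A] by (simp add: scalar_prod_def adj_mat_def lessThan_atLeast0)
  then have "(\<Sum>k<n. cofactor ?A k i * a k j) = Determinant.det ?A * (if i = j then 1 else 0)"
    unfolding adj_mat(3)[OF A] using ij by simp
  moreover have "(\<Sum>k<n. matinv n a i k * a k j) = (\<Sum>k<n. cofactor ?A k i * a k j) * inverse (Determinant.det ?A)"
    unfolding matinv_def sum_distrib_right by (intro sum.cong refl) simp
  ultimately show "(\<Sum>k<n. matinv n a i k * a k j) = (if i = j then 1 else 0)"
    using nz by simp
  have "(?A * adj_mat ?A) $$ (i, j) = (\<Sum>k<n. a i k * cofactor ?A j k)"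
    using ij adj_mat(1)[OF A] by (simp add: scalar_prod_def adj_mat_def lessThan_atLeast0)
  then have "(\<Sum>k<n. a i k * cofactor ?A j k) = Determinant.det ?A * (if i = j then 1 else 0)"
    unfolding adj_mat(2)[OF A] using ij by simp
  moreover have "(\<Sum>k<n. a i k * matinv n a k j) = (\<Sum>k<n. a i k * cofactor ?A j k) * inverse (Determinant.det ?A)"
    unfolding matinv_def sum_distrib_right by (intro sum.cong refl) simp
  ultimately show "(\<Sum>k<n. a i k * matinv n a k j) = (if i = j then 1 else 0)"
    using nz by simp
qed

text \<open>By the Leibniz formula. The size m of the matrix is separate from the dimension n of the
  domain because minors of size n - 1 are needed for cofactors.\<close>

lemma Ck_on_det:
  assumes U: "eopen n U"
    and a: "\<And>i j. i < m \<Longrightarrow> j < m \<Longrightarrow> Ck_on n U k (a i j)"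
  shows "Ck_on n U k (\<lambda>x. Determinant.det (mat m m (\<lambda>(i, j). a i j x)))"
proof -
  have "Determinant.det (mat m m (\<lambda>(i, j). a i j x)) =
      (\<Sum>p | p permutes {0..<m}. signof p * (\<Prod>i=0..<m. a i (p i) x))" for x
  proof -
    have "(\<Prod>i=0..<m. mat m m (\<lambda>(i, j). a i j x) $$ (i, p i)) = (\<Prod>i=0..<m. a i (p i) x)"
      if "p \<in> {p. p permutes {0..<m}}" for p
    proof (rule prod.cong[OF refl])
      fix i assume i: "i \<in> {0..<m}"
      then have "p i \<in> {0..<m}" using permutes_in_image[of p "{0..<m}" i] that by simp
      then show "mat m m (\<lambda>(i, j). a i j x) $$ (i, p i) = a i (p i) x" using i by simp
    qed
    then have "(\<Sum>p | p permutes {0..<m}. signof p * (\<Prod>i=0..<m. mat m m (\<lambda>(i, j). a i j x) $$ (i, p i)))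
        = (\<Sum>p | p permutes {0..<m}. signof p * (\<Prod>i=0..<m. a i (p i) x))"
      by (intro sum.cong refl) (simp only:)
    then show ?thesis by (simp only: det_def'[OF mat_carrier])
  qed
  moreover have "Ck_on n U k (\<lambda>x. \<Sum>p | p permutes {0..<m}. signof p * (\<Prod>i=0..<m. a i (p i) x))"
  proof (rule Ck_on_sum[OF U], rule Ck_on_cmult[OF U], rule Ck_on_prod[OF U])
    fix p i assume p: "p \<in> {p. p permutes {0..<m}}" and i: "i \<in> {0..<m}"
    then have "p i \<in> {0..<m}" using permutes_in_image[of p "{0..<m}" i] by simp
    then show "Ck_on n U k (a i (p i))" using i a by simp
  qed
  ultimately show ?thesis by (simp only:)
qed

lemma Ck_on_matinv:
  assumes U: "eopen n U"
    and a: "\<And>i j. i < n \<Longrightarrow> j < n \<Longrightarrow> Ck_on n U k (a i j)"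
    and nz: "\<And>x. x \<in> U \<Longrightarrow> Determinant.det (mat n n (\<lambda>(i, j). a i j x)) \<noteq> 0" and ij: "i < n" "j < n"
  shows "Ck_on n U k (\<lambda>x. matinv n (\<lambda>i j. a i j x) i j)"
proof -
  have "mat_delete (mat n n (\<lambda>(i, j). a i j x)) j i =
      mat (n - 1) (n - 1) (\<lambda>(i', j'). a (if i' < j then i' else Suc i') (if j' < i then j' else Suc j') x)" for x
    unfolding mat_delete_def using ij by (intro eq_matI) auto
  then have *: "cofactor (mat n n (\<lambda>(i, j). a i j x)) j i = (- 1) ^ (j + i) *
     Determinant.det (mat (n - 1) (n - 1) (\<lambda>(i', j'). a (if i' < j then i' else Suc i') (if j' < i then j' else Suc j') x))" for x
    unfolding cofactor_def by simp
  let ?b = "\<lambda>i' j'. a (if i' < j then i' else Suc i') (if j' < i then j' else Suc j')"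
  have b: "Ck_on n U k (?b i' j')" if "i' < n - 1" "j' < n - 1" for i' j'
    by (rule a) (use that in auto)
  show ?thesis
    unfolding matinv_def *
  proof (rule Ck_on_mult[OF U], rule Ck_on_cmult[OF U])
    show "Ck_on n U k (\<lambda>x. Determinant.det (mat (n - 1) (n - 1) (\<lambda>(i', j'). ?b i' j' x)))"
      by (rule Ck_on_det[OF U b])
    show "Ck_on n U k (\<lambda>x. inverse (Determinant.det (mat n n (\<lambda>(i, j). a i j x))))"
      by (rule Ck_on_inverse[OF U nz Ck_on_det[OF U a]])
  qed
qed

section \<open>Differentials and smooth inverses\<close>

lemma smooth_onD: "smooth_on n U f \<Longrightarrow> Ck_on n U k f"
  by (simp add: smooth_on_def)

lemma smooth_on_partial_deriv: "smooth_on n U f \<Longrightarrow> i < n \<Longrightarrow> smooth_on n U (partial_deriv i f)"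
  unfolding smooth_on_def using Ck_on_partial_deriv by blast

lemma smooth_on_continuous:
  "smooth_on n U f \<Longrightarrow> continuous_map (esub n U) euclideanreal f"
  by (rule Ck_on_continuous[OF smooth_onD])

lemma smooth_on_cong:
  "eopen n U \<Longrightarrow> (\<And>y. y \<in> U \<Longrightarrow> f y = g y) \<Longrightarrow> smooth_on n U f \<longleftrightarrow> smooth_on n U g"
  unfolding smooth_on_def using Ck_on_cong by blast

text \<open>Needed to glue: an extension by zero is smooth near each point for one of two different
  reasons.\<close>

lemma smooth_on_local:
  assumes U: "eopen n U"
    and V: "\<And>x. x \<in> U \<Longrightarrow> \<exists>V. eopen n V \<and> x \<in> V \<and> V \<subseteq> U \<and> smooth_on n V f"
  shows "smooth_on n U f"
  unfolding smooth_on_def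
proof (intro allI Ck_on_local[OF U])
  fix k x assume "x \<in> U"
  from V[OF this] show "\<exists>V. eopen n V \<and> x \<in> V \<and> V \<subseteq> U \<and> Ck_on n V k f"
    using smooth_onD by blast
qed

lemma smooth_mapD: "smooth_map n U V F \<Longrightarrow> x \<in> U \<Longrightarrow> F x \<in> V"
  "smooth_map n U V F \<Longrightarrow> j < n \<Longrightarrow> Ck_on n U k (\<lambda>x. F x j)"
  by (auto simp: smooth_map_def smooth_on_def Pi_iff)

lemma smooth_map_continuous:
  assumes "smooth_map n U V F" "eopen n U" "eopen n V"
  shows "continuous_map (esub n U) (esub n V) F"
  by (rule continuous_map_intoI[OF openin_subset[OF assms(3)]])
     (use smooth_mapD[OF assms(1)] Ck_on_continuous in auto)

lemma smooth_on_compose: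
  assumes "eopen n U" "eopen n V"
    "smooth_map n U V F" "smooth_on n V f"
  shows "smooth_on n U (\<lambda>x. f (F x))"
  unfolding smooth_on_def
  by (intro allI Ck_on_compose[OF assms(1,2) smooth_mapD[OF assms(3)] smooth_onD[OF assms(4)]])

definition jac :: "nat \<Rightarrow> ((nat \<Rightarrow> real) \<Rightarrow> (nat \<Rightarrow> real)) \<Rightarrow> (nat \<Rightarrow> real) \<Rightarrow> (nat \<Rightarrow> real) \<Rightarrow> (nat \<Rightarrow> real)" where
  "jac n F x v = (\<lambda>j. \<Sum>i<n. partial_deriv i (\<lambda>y. F y j) x * v i)"

lemma partial_deriv_const: "partial_deriv i (\<lambda>_. c) x = 0"
  by (simp add: partial_deriv_def)

lemma jac_in_Rn:
  assumes U: "eopen n U" and F: "\<And>y. y \<in> U \<Longrightarrow> F y \<in> Rn n" and x: "x \<in> U"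
  shows "jac n F x v \<in> Rn n"
proof -
  have "partial_deriv i (\<lambda>y. F y j) x = 0" if "j \<ge> n" "i < n" for i j
    using partial_deriv_cong(1)[OF U x that(2), of "\<lambda>y. F y j" "\<lambda>_. 0"] F that
    by (simp add: topspace_Euclidean_space partial_deriv_const)
  then show ?thesis by (simp add: jac_def topspace_Euclidean_space)
qed

lemma jac_compose:
  assumes U: "eopen n U" and V: "eopen n V"
    and F: "smooth_map n U V F" and G: "smooth_map n V W G" and W: "W \<subseteq> Rn n" and x: "x \<in> U"
  shows "jac n (\<lambda>y. G (F y)) x v = jac n G (F x) (jac n F x v)"
proof (rule Rn_eqI[of _ n])
  show "jac n (\<lambda>y. G (F y)) x v \<in> Rn n"
    by (rule jac_in_Rn[OF U _ x]) (use smooth_mapD(1)[OF F] smooth_mapD(1)[OF G] W in blast)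
  show "jac n G (F x) (jac n F x v) \<in> Rn n"
    by (rule jac_in_Rn[OF V]) (use smooth_mapD(1)[OF F] smooth_mapD(1)[OF G] W x in blast)+
  fix j assume j: "j < n"
  have "jac n (\<lambda>y. G (F y)) x v j
      = (\<Sum>i<n. (\<Sum>k<n. partial_deriv k (\<lambda>y. G y j) (F x) * partial_deriv i (\<lambda>y. F y k) x) * v i)"
    unfolding jac_def
    by (intro sum.cong refl arg_cong2[where f = "(*)"]
        partial_deriv_compose[OF U V smooth_mapD[OF F] smooth_mapD(2)[OF G j] x]) simp_all
  also have "\<dots> = (\<Sum>k<n. partial_deriv k (\<lambda>y. G y j) (F x) * (\<Sum>i<n. partial_deriv i (\<lambda>y. F y k) x * v i))"
    unfolding sum_distrib_right sum_distrib_left by (subst sum.swap) (simp add: mult.assoc)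
  finally show "jac n (\<lambda>y. G (F y)) x v j = jac n G (F x) (jac n F x v) j"
    by (simp add: jac_def)
qed

lemma partial_deriv_jac:
  assumes U: "eopen n U" and V: "eopen n V"
    and F: "smooth_map n U V F" and f: "Ck_on n V (Suc k) f" and x: "x \<in> U"
  shows "(\<Sum>i<n. partial_deriv i (\<lambda>y. f (F y)) x * v i) = (\<Sum>i<n. partial_deriv i f (F x) * jac n F x v i)"
proof -
  have "(\<Sum>i<n. partial_deriv i (\<lambda>y. f (F y)) x * v i)
      = (\<Sum>i<n. (\<Sum>k<n. partial_deriv k f (F x) * partial_deriv i (\<lambda>y. F y k) x) * v i)"
    by (intro sum.cong refl arg_cong2[where f = "(*)"]
        partial_deriv_compose[OF U V smooth_mapD[OF F] f x]) simp_all
  also have "\<dots> = (\<Sum>k<n. partial_deriv k f (F x) * (\<Sum>i<n. partial_deriv i (\<lambda>y. F y k) x * v i))"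
    unfolding sum_distrib_right sum_distrib_left by (subst sum.swap) (simp add: mult.assoc)
  finally show ?thesis by (simp add: jac_def)
qed

definition jac_inv :: "nat \<Rightarrow> ((nat \<Rightarrow> real) \<Rightarrow> (nat \<Rightarrow> real)) \<Rightarrow> (nat \<Rightarrow> real) \<Rightarrow> nat \<Rightarrow> nat \<Rightarrow> real" where
  "jac_inv n F x = matinv n (\<lambda>i j. partial_deriv j (\<lambda>y. F y i) x)"

lemma jac_inv:
  assumes inj: "\<And>v. v \<in> Rn n \<Longrightarrow> (\<And>j. j < n \<Longrightarrow> jac n F x v j = 0) \<Longrightarrow> v = (\<lambda>_. 0)" and ij: "i < n" "j < n"
  shows "(\<Sum>k<n. jac_inv n F x i k * partial_deriv j (\<lambda>y. F y k) x) = (if i = j then 1 else 0)"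
    and "(\<Sum>k<n. partial_deriv k (\<lambda>y. F y i) x * jac_inv n F x k j) = (if i = j then 1 else 0)"
proof -
  have "Determinant.det (mat n n (\<lambda>(i, j). partial_deriv j (\<lambda>y. F y i) x)) \<noteq> 0"
    unfolding det_nz_iff using inj by (simp add: jac_def)
  from matinv[OF this ij]
  show "(\<Sum>k<n. jac_inv n F x i k * partial_deriv j (\<lambda>y. F y k) x) = (if i = j then 1 else 0)"
    "(\<Sum>k<n. partial_deriv k (\<lambda>y. F y i) x * jac_inv n F x k j) = (if i = j then 1 else 0)"
    by (simp_all add: jac_inv_def)
qed

lemma Ck_on_jac_inv:
  assumes U: "eopen n U" and F: "smooth_map n U V F"
    and inj: "\<And>x v. x \<in> U \<Longrightarrow> v \<in> Rn n \<Longrightarrow> (\<And>j. j < n \<Longrightarrow> jac n F x v j = 0) \<Longrightarrow> v = (\<lambda>_. 0)"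
    and ij: "i < n" "j < n"
  shows "Ck_on n U k (\<lambda>x. jac_inv n F x i j)"
  unfolding jac_inv_def
proof (rule Ck_on_matinv[OF U _ _ ij])
  show "Ck_on n U k (partial_deriv j' (\<lambda>y. F y i'))" if "i' < n" "j' < n" for i' j'
    by (rule Ck_on_partial_deriv[OF smooth_mapD(2)[OF F that(1)] that(2)])
  show "Determinant.det (mat n n (\<lambda>(i, j). partial_deriv j (\<lambda>y. F y i) x)) \<noteq> 0" if "x \<in> U" for x
    unfolding det_nz_iff using inj[OF that] by (simp add: jac_def)
qed

text \<open>Apply the inverse Jacobian K to the linear approximation of F at \<open>G y\<close>. The
  error is small relative to the l1 norm S of the increment of G, and S in turn is at most a
  constant times |t - y i|, by absorbing its own error term.\<close>

lemma has_derivative_inverse_coord: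
  assumes U: "eopen n U" and O: "eopen n O'"
    and F: "smooth_map n U O' F"
    and inj: "\<And>x v. x \<in> U \<Longrightarrow> v \<in> Rn n \<Longrightarrow> (\<And>j. j < n \<Longrightarrow> jac n F x v j = 0) \<Longrightarrow> v = (\<lambda>_. 0)"
    and G: "\<And>y. y \<in> O' \<Longrightarrow> G y \<in> U" "\<And>y. y \<in> O' \<Longrightarrow> F (G y) = y"
    and Gc: "\<And>j. j < n \<Longrightarrow> continuous_map (esub n O') euclideanreal (\<lambda>y. G y j)"
    and y: "y \<in> O'" and i: "i < n" and j: "j < n"
  shows "((\<lambda>t. G (y(i := t)) j) has_field_derivative jac_inv n F (G y) j i) (at (y i))"
proof -
  let ?x = "G y"
  define K where "K = jac_inv n F ?x"
  define D where "D p q = partial_deriv q (\<lambda>y. F y p) ?x" for p q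
  have x: "?x \<in> U" using G y by blast
  have KD: "(\<Sum>p<n. K j p * D p q) = (if j = q then 1 else 0)" if "j < n" "q < n" for j q
    unfolding K_def D_def using jac_inv(1)[OF inj[OF x] that] .
  define M where "M = (\<Sum>j<n. \<Sum>p<n. \<bar>K j p\<bar>)"
  have M0: "0 \<le> M" unfolding M_def by (intro sum_nonneg) auto
  have KM: "\<bar>K j p\<bar> \<le> (\<Sum>p<n. \<bar>K j p\<bar>)" if "p < n" for j p
    using that by (intro member_le_sum) auto
  have Mj: "(\<Sum>p<n. \<bar>K j p\<bar>) \<le> M" if "j < n" for j
    unfolding M_def using that by (intro member_le_sum[of j "{..<n}" "\<lambda>j. \<Sum>p<n. \<bar>K j p\<bar>"]) (auto intro: sum_nonneg)
  have "((\<lambda>t. (G (y(i := t)) j - G (y(i := y i)) j) / (t - y i)) \<longlongrightarrow> K j i) (at (y i))"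
  proof (rule tendstoI)
    fix e :: real assume e: "0 < e"
    \<comment> \<open>The first bound makes the error term in the estimate of S absorbable
      (\<epsilon> (M + 1) \<le> 1/2); the second leaves a final error of e / 2. Here M + 1 replaces
      M so as to be visibly positive.\<close>
    define \<epsilon> where "\<epsilon> = min (1 / (2 * (M + 1))) (e / (4 * (M + 1) * (M + 1)))"
    have \<epsilon>: "0 < \<epsilon>" "\<epsilon> * (M + 1) \<le> 1 / 2" "\<epsilon> * (4 * (M + 1) * (M + 1)) \<le> e"
    proof -
      have p: "0 < 4 * (M + 1) * (M + 1)" using M0 by simp
      show "0 < \<epsilon>" using e M0 p by (simp add: \<epsilon>_def del: mult_pos_pos)
      have "\<epsilon> \<le> 1 / (2 * (M + 1))" by (simp add: \<epsilon>_def)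
      then show "\<epsilon> * (M + 1) \<le> 1 / 2" using M0 by (simp add: field_simps)
      have "\<epsilon> \<le> e / (4 * (M + 1) * (M + 1))" by (simp add: \<epsilon>_def)
      then show "\<epsilon> * (4 * (M + 1) * (M + 1)) \<le> e" using p by (simp only: pos_le_divide_eq)
    qed
    have "\<exists>d>0. \<forall>a\<in>cube n ?x d. \<bar>F a p - F ?x p - (\<Sum>q<n. D p q * (a q - ?x q))\<bar> \<le> \<epsilon> * (\<Sum>q<n. \<bar>a q - ?x q\<bar>)"
      if p: "p < n" for p
    proof -
      obtain d where d: "d > 0" "\<forall>a\<in>cube n ?x d. \<forall>b\<in>cube n ?x d. \<bar>F a p - F b p - (\<Sum>q<n. D p q * (a q - b q))\<bar> \<le> \<epsilon> * (\<Sum>q<n. \<bar>a q - b q\<bar>)"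
        using strict_diff[OF U smooth_mapD(2)[OF F p] x \<epsilon>(1)] unfolding D_def by blast
      have "?x \<in> cube n ?x d" using d(1) x U openin_subset cube_self by blast
      then show ?thesis using d by blast
    qed
    then obtain d where d: "\<And>p. p < n \<Longrightarrow> d p > 0"
      "\<And>p a. p < n \<Longrightarrow> a \<in> cube n ?x (d p) \<Longrightarrow> \<bar>F a p - F ?x p - (\<Sum>q<n. D p q * (a q - ?x q))\<bar> \<le> \<epsilon> * (\<Sum>q<n. \<bar>a q - ?x q\<bar>)"
      by metis
    define d' where "d' = Min (insert 1 (d ` {..<n}))"
    have d': "d' > 0" "\<And>p. p < n \<Longrightarrow> d' \<le> d p" using d(1) by (auto simp: d'_def)
    have "\<exists>r>0. \<forall>z\<in>cube n y r. z \<in> O' \<and> \<bar>G z q - ?x q\<bar> < d'" if "q < n" for q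
      using Gc[OF that, unfolded continuous_map_cube_iff[OF O]] y d'(1) by blast
    then obtain r where r: "\<And>q. q < n \<Longrightarrow> r q > 0" "\<And>q z. q < n \<Longrightarrow> z \<in> cube n y (r q) \<Longrightarrow> z \<in> O' \<and> \<bar>G z q - ?x q\<bar> < d'"
      by metis
    define r' where "r' = Min (insert 1 (r ` {..<n}))"
    have r': "r' > 0" "\<And>p. p < n \<Longrightarrow> r' \<le> r p" using r(1) by (auto simp: r'_def)
    have yR: "y \<in> Rn n" using y O openin_subset by blast
    have main: "\<bar>(G (y(i := t)) j - ?x j) / (t - y i) - K j i\<bar> < e" if t: "t \<noteq> y i" "\<bar>t - y i\<bar> < r'" for t
    proof -
      define a where "a = G (y(i := t))"
      have c: "y(i := t) \<in> cube n y r'" by (rule cube_upd[OF yR t(2) i r'(1)])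
      have cq: "y(i := t) \<in> cube n y (r q)" if "q < n" for q
        using c cube_mono[OF r'(2)[OF that]] by blast
      have O1: "y(i := t) \<in> O'" using r(2)[OF i cq[OF i]] by blast
      have aU: "a \<in> U" using G(1)[OF O1] by (simp add: a_def)
      have Fa: "F a = y(i := t)" using G(2)[OF O1] by (simp add: a_def)
      have Fx: "F ?x = y" using G(2)[OF y] .
      have "a \<in> cube n ?x d'"
        using r(2)[OF _ cq] aU openin_subset[OF U] by (auto simp: cube_def a_def)
      then have ac: "a \<in> cube n ?x (d p)" if "p < n" for p
        using cube_mono[OF d'(2)[OF that]] by blast
      define \<tau> where "\<tau> = t - y i"
      define w where "w p = F a p - F ?x p - (\<Sum>q<n. D p q * (a q - ?x q))" for p
      define S where "S = (\<Sum>q<n. \<bar>a q - ?x q\<bar>)"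
      have w: "\<bar>w p\<bar> \<le> \<epsilon> * S" if "p < n" for p
        using d(2)[OF that ac[OF that]] by (simp add: w_def S_def)
      have eq: "a j - ?x j - K j i * \<tau> = - (\<Sum>p<n. K j p * w p)" if j: "j < n" for j
      proof -
        have "(\<Sum>p<n. K j p * (\<Sum>q<n. D p q * (a q - ?x q))) = (\<Sum>q<n. (\<Sum>p<n. K j p * D p q) * (a q - ?x q))"
          unfolding sum_distrib_right sum_distrib_left by (subst sum.swap) (simp add: mult.assoc)
        also have "\<dots> = (\<Sum>q<n. (if j = q then 1 else 0) * (a q - ?x q))"
          using KD[OF j] by (intro sum.cong) auto
        also have "\<dots> = a j - ?x j" using j by (simp add: if_distrib[of "\<lambda>z. z * _"] cong: if_cong)
        finally have 1: "(\<Sum>p<n. K j p * (\<Sum>q<n. D p q * (a q - ?x q))) = a j - ?x j" .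
        have "(\<Sum>p<n. K j p * (F a p - F ?x p)) = (\<Sum>p<n. if p = i then K j i * \<tau> else 0)"
          unfolding Fa Fx by (intro sum.cong) (auto simp: \<tau>_def)
        also have "\<dots> = K j i * \<tau>" using i by simp
        finally have 2: "(\<Sum>p<n. K j p * (F a p - F ?x p)) = K j i * \<tau>" .
        have "(\<Sum>p<n. K j p * w p) = (\<Sum>p<n. K j p * (F a p - F ?x p)) - (\<Sum>p<n. K j p * (\<Sum>q<n. D p q * (a q - ?x q)))"
          unfolding w_def by (simp add: right_diff_distrib sum_subtractf)
        then show ?thesis using 1 2 by simp
      qed
      have S0: "0 \<le> S" unfolding S_def by (intro sum_nonneg) auto
      have bd: "\<bar>a j - ?x j - K j i * \<tau>\<bar> \<le> (\<Sum>p<n. \<bar>K j p\<bar>) * (\<epsilon> * S)" if j: "j < n" for j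
      proof -
        have "\<bar>\<Sum>p<n. K j p * w p\<bar> \<le> (\<Sum>p<n. \<bar>K j p\<bar> * (\<epsilon> * S))"
          by (rule order_trans[OF sum_abs sum_mono]) (auto simp: abs_mult intro!: mult_left_mono w)
        then show ?thesis unfolding eq[OF j] by (simp add: sum_distrib_right)
      qed
      \<comment> \<open>S reappears on the right with a factor that will be at most 1/2, hence S
        \<le> 2 (M + 1) |\<tau>|.\<close>
      have "S \<le> (\<Sum>j<n. (\<Sum>p<n. \<bar>K j p\<bar>) * (\<bar>\<tau>\<bar> + \<epsilon> * S))"
        unfolding S_def
      proof (intro sum_mono)
        fix j assume "j \<in> {..<n}"
        then have j: "j < n" by simp
        have "\<bar>a j - ?x j\<bar> \<le> \<bar>K j i * \<tau>\<bar> + \<bar>a j - ?x j - K j i * \<tau>\<bar>" by linarith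
        also have "\<dots> \<le> (\<Sum>p<n. \<bar>K j p\<bar>) * \<bar>\<tau>\<bar> + (\<Sum>p<n. \<bar>K j p\<bar>) * (\<epsilon> * S)"
          unfolding abs_mult by (intro add_mono bd[OF j] mult_right_mono KM i) auto
        finally show "\<bar>a j - ?x j\<bar> \<le> (\<Sum>p<n. \<bar>K j p\<bar>) * (\<bar>\<tau>\<bar> + \<epsilon> * (\<Sum>q<n. \<bar>a q - ?x q\<bar>))"
          by (simp add: distrib_left S_def)
      qed
      then have "S \<le> M * (\<bar>\<tau>\<bar> + \<epsilon> * S)" by (simp add: M_def sum_distrib_right)
      also have "\<dots> \<le> (M + 1) * \<bar>\<tau>\<bar> + \<epsilon> * (M + 1) * S"
        using S0 \<epsilon>(1) M0 by (simp add: algebra_simps)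
      also have "\<dots> \<le> (M + 1) * \<bar>\<tau>\<bar> + 1 / 2 * S"
        using \<epsilon>(2) S0 by (intro add_left_mono mult_right_mono)
      finally have "S \<le> (M + 1) * \<bar>\<tau>\<bar> + 1 / 2 * S" .
      then have S: "S \<le> 2 * ((M + 1) * \<bar>\<tau>\<bar>)" by linarith
      have "\<bar>a j - ?x j - K j i * \<tau>\<bar> \<le> (\<Sum>p<n. \<bar>K j p\<bar>) * (\<epsilon> * S)" by (rule bd[OF j])
      also have "\<dots> \<le> (M + 1) * (\<epsilon> * (2 * ((M + 1) * \<bar>\<tau>\<bar>)))"
        using Mj[OF j] \<epsilon>(1) M0 S0 by (intro mult_mono mult_left_mono S) auto
      also have "\<dots> = (\<epsilon> * (4 * (M + 1) * (M + 1))) / 2 * \<bar>\<tau>\<bar>" by simp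
      also have "\<dots> \<le> e / 2 * \<bar>\<tau>\<bar>"
        using \<epsilon>(3) by (intro mult_right_mono divide_right_mono) auto
      finally have fin: "\<bar>a j - ?x j - K j i * \<tau>\<bar> \<le> e / 2 * \<bar>\<tau>\<bar>" .
      have \<tau>: "\<tau> \<noteq> 0" using t by (simp add: \<tau>_def)
      have "(a j - ?x j) / \<tau> - K j i = (a j - ?x j - K j i * \<tau>) / \<tau>"
        using \<tau> by (simp add: diff_divide_distrib)
      then have "\<bar>(a j - ?x j) / \<tau> - K j i\<bar> = \<bar>a j - ?x j - K j i * \<tau>\<bar> / \<bar>\<tau>\<bar>" by simp
      also have "\<dots> \<le> e / 2" using fin \<tau> by (simp add: pos_divide_le_eq)
      also have "\<dots> < e" using e by simp
      finally show ?thesis by (simp add: a_def \<tau>_def)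
    qed
    show "\<forall>\<^sub>F t in at (y i). dist ((G (y(i := t)) j - G (y(i := y i)) j) / (t - y i)) (K j i) < e"
      unfolding eventually_at using r'(1) main by (auto simp: dist_real_def intro!: exI[of _ r'])
  qed
  then show ?thesis unfolding has_field_derivative_iff K_def .
qed

text \<open>Stated for h composed with G rather than for G alone: each partial derivative of this
  composite is again a function composed with G, namely a sum of products of derivatives of h with
  entries of \<open>jac_inv\<close>, so the induction hypothesis applies to it.\<close>

lemma Ck_on_inverse_map:
  assumes U: "eopen n U" and O: "eopen n O'"
    and F: "smooth_map n U O' F"
    and inj: "\<And>x v. x \<in> U \<Longrightarrow> v \<in> Rn n \<Longrightarrow> (\<And>j. j < n \<Longrightarrow> jac n F x v j = 0) \<Longrightarrow> v = (\<lambda>_. 0)"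
    and G: "\<And>y. y \<in> O' \<Longrightarrow> G y \<in> U" "\<And>y. y \<in> O' \<Longrightarrow> F (G y) = y"
    and Gc: "continuous_map (esub n O') (esub n U) G"
  shows "Ck_on n U k h \<Longrightarrow> Ck_on n O' k (\<lambda>y. h (G y))"
proof (induction k arbitrary: h)
  case 0
  from continuous_map_compose[OF Gc] 0 show ?case by (simp add: o_def)
next
  case (Suc k)
  have Gc': "continuous_map (esub n O') euclideanreal (\<lambda>y. G y j)" for j
    using continuous_map_compose[OF Gc continuous_map_from_subtopology[OF continuous_map_coord[of n j]]]
    by (simp add: o_def)
  show ?case
  proof (rule Ck_on_SucI[OF O])
    show "continuous_map (esub n O') euclideanreal (\<lambda>y. h (G y))"
      using continuous_map_compose[OF Gc Ck_on_continuous[OF Suc.prems]] by (simp add: o_def)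
    fix i assume i: "i < n"
    show "((\<lambda>s. h (G (y(i := s)))) has_field_derivative
        (\<Sum>j<n. partial_deriv j h (G y) * jac_inv n F (G y) j i)) (at (y i))" if y: "y \<in> O'" for y
    proof -
      have "\<forall>\<^sub>F t in at (y i). G (y(i := t)) \<in> Rn n"
        using eventually_upd_in[OF O y i, THEN eventually_nhds_conv_at[THEN iffD1, THEN conjunct1]]
        by eventually_elim (use G(1) openin_subset[OF U] in blast)
      moreover have "((\<lambda>t. G (y(i := t)) j) has_field_derivative jac_inv n F (G y) j i) (at (y i))" if "j < n" for j
        by (rule has_derivative_inverse_coord[OF U O F inj G Gc' y i that])
      ultimately show ?thesis
        using chain_curve[OF U Suc.prems, of "\<lambda>t. G (y(i := t))" "y i" "\<lambda>j. jac_inv n F (G y) j i"] G(1)[OF y]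
        by (simp only: fun_upd_triv)
    qed
    have "Ck_on n U k (\<lambda>x. \<Sum>j<n. partial_deriv j h x * jac_inv n F x j i)"
    proof (rule Ck_on_sum[OF U], rule Ck_on_mult[OF U])
      fix j assume j: "j \<in> {..<n}"
      show "Ck_on n U k (partial_deriv j h)" using j Ck_on_partial_deriv[OF Suc.prems] by simp
      show "Ck_on n U k (\<lambda>x. jac_inv n F x j i)" using j by (intro Ck_on_jac_inv[OF U F inj _ i]) simp_all
    qed
    from Suc.IH[OF this]
    show "Ck_on n O' k (\<lambda>y. \<Sum>j<n. partial_deriv j h (G y) * jac_inv n F (G y) j i)" .
  qed
qed

text \<open>The first derivatives vanish at x and are differentiable there, so they are bounded by a
  multiple of the distance to x. The mean value theorem on the segment from x to y supplies the
  second factor.\<close>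

lemma quadratic_bound_at_critical_point:
  assumes U: "eopen n U" and f: "smooth_on n U f" and x: "x \<in> U"
    and crit: "\<And>i. i < n \<Longrightarrow> partial_deriv i f x = 0"
  shows "\<exists>C d. 0 < d \<and> cube n x d \<subseteq> U \<and> (\<forall>y\<in>cube n x d. \<bar>f y - f x\<bar> \<le> C * (\<Sum>i<n. \<bar>y i - x i\<bar>)\<^sup>2)"
proof -
  have xR: "x \<in> Rn n" using x openin_subset[OF U] by blast
  \<comment> \<open>The summand 1 is the error rate used when \<open>strict_diff\<close> is applied
    to the partial derivative; the rest bounds its linear part.\<close>
  define B where "B i = 1 + (\<Sum>j<n. \<bar>partial_deriv j (partial_deriv i f) x\<bar>)" for i
  have "\<exists>d>0. cube n x d \<subseteq> U \<and> (\<forall>y\<in>cube n x d. \<bar>partial_deriv i f y\<bar> \<le> B i * (\<Sum>j<n. \<bar>y j - x j\<bar>))"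
    if i: "i < n" for i
  proof -
    let ?g = "partial_deriv i f"
    obtain d where d: "d > 0" "cube n x d \<subseteq> U" "\<forall>a\<in>cube n x d. \<forall>b\<in>cube n x d.
      \<bar>?g a - ?g b - (\<Sum>j<n. partial_deriv j ?g x * (a j - b j))\<bar> \<le> 1 * (\<Sum>j<n. \<bar>a j - b j\<bar>)"
      using strict_diff[OF U smooth_onD[OF smooth_on_partial_deriv[OF f i]] x, of 1] by auto
    have "\<bar>?g y\<bar> \<le> B i * (\<Sum>j<n. \<bar>y j - x j\<bar>)" if y: "y \<in> cube n x d" for y
    proof -
      have 1: "\<bar>?g y - ?g x - (\<Sum>j<n. partial_deriv j ?g x * (y j - x j))\<bar> \<le> 1 * (\<Sum>j<n. \<bar>y j - x j\<bar>)"
        using d(3) y cube_self[OF xR d(1)] by blast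
      have "\<bar>\<Sum>j<n. partial_deriv j ?g x * (y j - x j)\<bar> \<le> (\<Sum>j<n. \<bar>partial_deriv j ?g x\<bar> * (\<Sum>j<n. \<bar>y j - x j\<bar>))"
      proof (rule order_trans[OF sum_abs sum_mono])
        fix j assume "j \<in> {..<n}"
        then have "\<bar>y j - x j\<bar> \<le> (\<Sum>j<n. \<bar>y j - x j\<bar>)" by (intro member_le_sum) auto
        then show "\<bar>partial_deriv j ?g x * (y j - x j)\<bar> \<le> \<bar>partial_deriv j ?g x\<bar> * (\<Sum>j<n. \<bar>y j - x j\<bar>)"
          unfolding abs_mult by (intro mult_left_mono) auto
      qed
      then have 2: "\<bar>\<Sum>j<n. partial_deriv j ?g x * (y j - x j)\<bar> \<le> (\<Sum>j<n. \<bar>partial_deriv j ?g x\<bar>) * (\<Sum>j<n. \<bar>y j - x j\<bar>)"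
        by (simp add: sum_distrib_right)
      have "?g x = 0" using crit i by simp
      then have "\<bar>?g y\<bar> \<le> 1 * (\<Sum>j<n. \<bar>y j - x j\<bar>) + (\<Sum>j<n. \<bar>partial_deriv j ?g x\<bar>) * (\<Sum>j<n. \<bar>y j - x j\<bar>)"
        using 1 2 by linarith
      then show ?thesis unfolding B_def by (simp only: distrib_right)
    qed
    then show ?thesis using d by blast
  qed
  then obtain D where D: "\<And>i. i < n \<Longrightarrow> D i > 0" "\<And>i y. i < n \<Longrightarrow> y \<in> cube n x (D i) \<Longrightarrow> \<bar>partial_deriv i f y\<bar> \<le> B i * (\<Sum>j<n. \<bar>y j - x j\<bar>)"
    by metis
  obtain d0 where d0: "d0 > 0" "cube n x d0 \<subseteq> U" using U x unfolding openin_Rn_iff by blast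
  define d where "d = Min (insert d0 (D ` {..<n}))"
  have d: "d > 0" "d \<le> d0" "\<And>i. i < n \<Longrightarrow> d \<le> D i" using D(1) d0 by (auto simp: d_def)
  have dU: "cube n x d \<subseteq> U" using d0 cube_mono[OF d(2)] by blast
  define C where "C = (\<Sum>i<n. B i)"
  have B1: "B i \<ge> 0" for i unfolding B_def by (simp add: add_nonneg_nonneg sum_nonneg)
  have pd: "\<bar>partial_deriv i f y\<bar> \<le> C * (\<Sum>j<n. \<bar>y j - x j\<bar>)" if "i < n" "y \<in> cube n x d" for i y
  proof -
    have "\<bar>partial_deriv i f y\<bar> \<le> B i * (\<Sum>j<n. \<bar>y j - x j\<bar>)"
      using D(2)[OF that(1)] cube_mono[OF d(3)[OF that(1)]] that(2) by blast
    also have "\<dots> \<le> C * (\<Sum>j<n. \<bar>y j - x j\<bar>)"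
      using that(1) B1 unfolding C_def by (intro mult_right_mono member_le_sum sum_nonneg) auto
    finally show ?thesis .
  qed
  have "\<bar>f y - f x\<bar> \<le> C * (\<Sum>i<n. \<bar>y i - x i\<bar>)\<^sup>2" if y: "y \<in> cube n x d" for y
  proof -
    define \<gamma> where "\<gamma> s = (\<lambda>i. x i + s * (y i - x i))" for s :: real
    have yR: "y \<in> Rn n" using y by (simp add: cube_def)
    have \<gamma>R: "\<gamma> s \<in> Rn n" for s using xR yR by (simp add: \<gamma>_def topspace_Euclidean_space)
    define S where "S = (\<Sum>i<n. \<bar>y i - x i\<bar>)"
    have S0: "0 \<le> S" unfolding S_def by (intro sum_nonneg) auto
    have \<gamma>c: "\<gamma> s \<in> cube n x d" if "0 \<le> s" "s \<le> 1" for s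
    proof -
      have "\<bar>s * (y i - x i)\<bar> < d" if "i < n" for i
      proof -
        have "\<bar>s * (y i - x i)\<bar> \<le> 1 * \<bar>y i - x i\<bar>"
          unfolding abs_mult using \<open>0 \<le> s\<close> \<open>s \<le> 1\<close> by (intro mult_right_mono) auto
        then show ?thesis using y that by (auto simp: cube_def)
      qed
      then show ?thesis using \<gamma>R[of s] by (simp add: cube_def \<gamma>_def)
    qed
    have der: "DERIV (\<lambda>s. f (\<gamma> s)) s :> (\<Sum>i<n. partial_deriv i f (\<gamma> s) * (y i - x i))" if "0 \<le> s" "s \<le> 1" for s
    proof (rule chain_curve[OF U smooth_onD[OF f]])
      show "\<gamma> s \<in> U" using \<gamma>c[OF that] dU by blast
      show "((\<lambda>t. \<gamma> t i) has_real_derivative y i - x i) (at s)" for i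
        unfolding \<gamma>_def by (auto intro!: derivative_eq_intros)
    qed (simp add: \<gamma>R)
    have "\<exists>z>0. z < 1 \<and> f (\<gamma> 1) - f (\<gamma> 0) = (1 - 0) * (\<Sum>i<n. partial_deriv i f (\<gamma> z) * (y i - x i))"
    proof (rule MVT2[of 0 1 "\<lambda>s. f (\<gamma> s)" "\<lambda>s. \<Sum>i<n. partial_deriv i f (\<gamma> s) * (y i - x i)"])
      show "(0::real) < 1" by simp
    qed (rule der)
    then obtain z where z: "0 < z" "z < 1" "f (\<gamma> 1) - f (\<gamma> 0) = (1 - 0) * (\<Sum>i<n. partial_deriv i f (\<gamma> z) * (y i - x i))"
      by blast
    have "\<gamma> 1 = y" "\<gamma> 0 = x" by (simp_all add: \<gamma>_def)
    then have "\<bar>f y - f x\<bar> = \<bar>\<Sum>i<n. partial_deriv i f (\<gamma> z) * (y i - x i)\<bar>" using z(3) by simp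
    also have "\<dots> \<le> (\<Sum>i<n. C * S * \<bar>y i - x i\<bar>)"
    proof (rule order_trans[OF sum_abs sum_mono])
      fix i assume "i \<in> {..<n}"
      then have "\<bar>partial_deriv i f (\<gamma> z)\<bar> \<le> C * (\<Sum>j<n. \<bar>\<gamma> z j - x j\<bar>)"
        using z by (intro pd \<gamma>c) auto
      also have "(\<Sum>j<n. \<bar>\<gamma> z j - x j\<bar>) = z * S"
        using z by (simp add: \<gamma>_def S_def abs_mult sum_distrib_left)
      also have "C * (z * S) \<le> C * (1 * S)"
        using z S0 B1 by (intro mult_left_mono mult_right_mono) (auto simp: C_def sum_nonneg)
      finally show "\<bar>partial_deriv i f (\<gamma> z) * (y i - x i)\<bar> \<le> C * S * \<bar>y i - x i\<bar>"
        unfolding abs_mult by (intro mult_right_mono) auto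
    qed
    also have "\<dots> = C * S * S" unfolding S_def sum_distrib_left[symmetric] ..
    finally show ?thesis unfolding S_def by (simp add: power2_eq_square)
  qed
  then show ?thesis using d(1) dU by blast
qed

section \<open>Finite transformation groups and orbifold charts\<close>

locale finite_transformation_group =
  fixes U :: "'u set" and \<Gamma> :: "('u \<Rightarrow> 'u) set"
  assumes subgroup: "subgroup \<Gamma> (BijGroup U)" and finite: "finite \<Gamma>"
begin

abbreviation "G \<equiv> chart_group U \<Gamma>"
abbreviation "stab \<equiv> chart_stabilizer U \<Gamma>"
abbreviation mult (infixl "\<cdot>" 70) where "g \<cdot> h \<equiv> g \<otimes>\<^bsub>G\<^esub> h"
abbreviation "ginv \<equiv> m_inv G"
abbreviation "gid \<equiv> \<one>\<^bsub>G\<^esub>"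

lemma carrier_G [simp]: "carrier G = \<Gamma>"
  by (simp add: chart_group_def)

lemma group_G: "group G"
  unfolding chart_group_def by (rule subgroup.subgroup_is_group[OF subgroup group_BijGroup])

sublocale G: group G by (rule group_G)

lemma in_Bij: "g \<in> \<Gamma> \<Longrightarrow> g \<in> Bij U"
  using subgroup.subset[OF subgroup] by (auto simp: BijGroup_def)

lemma mem: "g \<in> \<Gamma> \<Longrightarrow> u \<in> U \<Longrightarrow> g u \<in> U"
  using Bij_imp_funcset[OF in_Bij] by blast

lemma mult_apply: "g \<in> \<Gamma> \<Longrightarrow> h \<in> \<Gamma> \<Longrightarrow> u \<in> U \<Longrightarrow> (g \<cdot> h) u = g (h u)"
  by (simp add: chart_group_def BijGroup_def in_Bij compose_def)

lemma one_apply: "u \<in> U \<Longrightarrow> gid u = u"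
  by (simp add: chart_group_def BijGroup_def)

lemma inv_apply: "g \<in> \<Gamma> \<Longrightarrow> u \<in> U \<Longrightarrow> (ginv g) (g u) = u"
  "g \<in> \<Gamma> \<Longrightarrow> u \<in> U \<Longrightarrow> g ((ginv g) u) = u"
  using mult_apply[of "ginv g" g u] mult_apply[of g "ginv g" u] G.inv_closed[of g]
  by (simp_all add: one_apply)

lemma stab_iff: "g \<in> stab u \<longleftrightarrow> g \<in> \<Gamma> \<and> g u = u"
  by (simp add: stabilizer_def)

lemma orbit_iff: "v \<in> chart_orbit U \<Gamma> u \<longleftrightarrow> (\<exists>g\<in>\<Gamma>. v = g u)"
  by (auto simp: orbit_def)

lemma stab_subgroup:
  assumes "u \<in> U" shows "subgroup (stab u) G"
proof (rule G.subgroupI)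
  show "stab u \<subseteq> carrier G" by (auto simp: stab_iff)
  have "gid \<in> stab u" using assms G.one_closed by (simp add: stab_iff one_apply)
  then show "stab u \<noteq> {}" by blast
  show "ginv g \<in> stab u" if "g \<in> stab u" for g
    using that assms inv_apply(1)[of g u] G.inv_closed[of g] by (simp add: stab_iff)
  show "g \<cdot> h \<in> stab u" if "g \<in> stab u" "h \<in> stab u" for g h
    using that assms G.m_closed[of g h] by (simp add: stab_iff mult_apply)
qed

lemma conj_set_eq: "g <#\<^bsub>G\<^esub> H #>\<^bsub>G\<^esub> (ginv g) = (\<lambda>h. g \<cdot> h \<cdot> ginv g) ` H"
  by (auto simp: l_coset_def r_coset_def)

lemma conj_conj:
  assumes "g \<in> \<Gamma>" "k \<in> \<Gamma>" "H \<subseteq> \<Gamma>"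
  shows "(\<lambda>h. g \<cdot> h \<cdot> ginv g) ` (\<lambda>h. k \<cdot> h \<cdot> ginv k) ` H =
    (\<lambda>h. (g \<cdot> k) \<cdot> h \<cdot> ginv (g \<cdot> k)) ` H"
  unfolding image_image
proof (rule image_cong[OF refl])
  fix h assume "h \<in> H"
  then have "h \<in> carrier G" "g \<in> carrier G" "k \<in> carrier G" using assms by auto
  then show "g \<cdot> (k \<cdot> h \<cdot> ginv k) \<cdot> ginv g
      = (g \<cdot> k) \<cdot> h \<cdot> ginv (g \<cdot> k)"
    by (simp add: G.inv_mult_group G.m_assoc del: carrier_G)
qed

lemma conj_one: "H \<subseteq> \<Gamma> \<Longrightarrow> (\<lambda>h. gid \<cdot> h \<cdot> ginv gid) ` H = H"
  by (force simp: image_iff)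

lemma orbit_type_iff:
  "v \<in> orbit_type_set U \<Gamma> H \<longleftrightarrow> v \<in> U \<and> (\<exists>g\<in>\<Gamma>. stab v = (\<lambda>h. g \<cdot> h \<cdot> ginv g) ` H)"
  by (simp add: orbit_type_set_def conj_set_eq)

lemma stab_subset: "stab u \<subseteq> \<Gamma>"
  by (auto simp: stab_iff)

lemma orbit_type_self:
  assumes "u \<in> U" shows "u \<in> orbit_type_set U \<Gamma> (stab u)"
proof -
  have "gid \<in> \<Gamma>" using G.one_closed by simp
  then show ?thesis unfolding orbit_type_iff using assms conj_one[OF stab_subset, of u] by metis
qed

text \<open>Conjugacy is an equivalence relation, so any point of an orbit type may represent it by
  its stabiliser.\<close>

lemma orbit_type_eq:
  assumes H: "H \<subseteq> \<Gamma>" and u: "u \<in> orbit_type_set U \<Gamma> H"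
  shows "orbit_type_set U \<Gamma> H = orbit_type_set U \<Gamma> (stab u)"
proof -
  obtain g where g: "g \<in> \<Gamma>" "stab u = (\<lambda>h. g \<cdot> h \<cdot> ginv g) ` H"
    using u unfolding orbit_type_iff by blast
  have gi: "ginv g \<in> \<Gamma>" using g G.inv_closed by simp
  have H': "H = (\<lambda>h. ginv g \<cdot> h \<cdot> ginv (ginv g)) ` stab u"
    unfolding g(2) conj_conj[OF gi g(1) H] using g(1) conj_one[OF H] by simp
  show ?thesis
  proof (intro subset_antisym subsetI)
    fix v assume "v \<in> orbit_type_set U \<Gamma> H"
    then obtain k where k: "v \<in> U" "k \<in> \<Gamma>" "stab v = (\<lambda>h. k \<cdot> h \<cdot> ginv k) ` H"
      unfolding orbit_type_iff by blast
    have "stab v = (\<lambda>h. (k \<cdot> ginv g) \<cdot> h \<cdot> ginv (k \<cdot> ginv g)) ` stab u"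
      using conj_conj[OF k(2) gi stab_subset, of u] H' k(3) by simp
    moreover have "k \<cdot> ginv g \<in> \<Gamma>" using G.m_closed[of k "ginv g"] k gi by simp
    ultimately show "v \<in> orbit_type_set U \<Gamma> (stab u)" unfolding orbit_type_iff using k(1) by blast
  next
    fix v assume "v \<in> orbit_type_set U \<Gamma> (stab u)"
    then obtain k where k: "v \<in> U" "k \<in> \<Gamma>" "stab v = (\<lambda>h. k \<cdot> h \<cdot> ginv k) ` stab u"
      unfolding orbit_type_iff by blast
    have "stab v = (\<lambda>h. (k \<cdot> g) \<cdot> h \<cdot> ginv (k \<cdot> g)) ` H"
      using conj_conj[OF k(2) g(1) H] g(2) k(3) by simp
    moreover have "k \<cdot> g \<in> \<Gamma>" using G.m_closed[of k g] k g by simp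
    ultimately show "v \<in> orbit_type_set U \<Gamma> H" unfolding orbit_type_iff using k(1) by blast
  qed
qed

lemma stab_image:
  assumes g: "g \<in> \<Gamma>" and u: "u \<in> U"
  shows "stab (g u) = (\<lambda>h. g \<cdot> h \<cdot> ginv g) ` stab u"
proof (intro subset_antisym subsetI)
  have gi: "ginv g \<in> \<Gamma>" using g G.inv_closed by simp
  fix k assume k: "k \<in> stab (g u)"
  then have k': "k \<in> \<Gamma>" by (simp add: stab_iff)
  let ?h = "ginv g \<cdot> k \<cdot> g"
  have kg: "ginv g \<cdot> k \<in> \<Gamma>" using G.m_closed[of "ginv g" k] k' gi by simp
  have h: "?h \<in> \<Gamma>" using G.m_closed[of "ginv g \<cdot> k" g] kg g by simp
  have "?h u = u"
    using k g gi k' kg u mem[OF g u] inv_apply(1)[OF g u] by (simp add: mult_apply stab_iff)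
  then have "?h \<in> stab u" using h by (simp add: stab_iff)
  moreover have "k = g \<cdot> ?h \<cdot> ginv g"
  proof -
    have c: "g \<in> carrier G" "k \<in> carrier G" using g k' by auto
    then have "g \<cdot> ?h \<cdot> ginv g = (g \<cdot> ginv g) \<cdot> k \<cdot> (g \<cdot> ginv g)"
      by (simp only: G.m_assoc G.m_closed G.inv_closed)
    then show ?thesis using c by (simp del: carrier_G)
  qed
  ultimately show "k \<in> (\<lambda>h. g \<cdot> h \<cdot> ginv g) ` stab u" by blast
next
  have gi: "ginv g \<in> \<Gamma>" using g G.inv_closed by simp
  fix k assume "k \<in> (\<lambda>h. g \<cdot> h \<cdot> ginv g) ` stab u"
  then obtain h where h: "h \<in> \<Gamma>" "h u = u" "k = g \<cdot> h \<cdot> ginv g" by (auto simp: stab_iff)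
  have gh: "g \<cdot> h \<in> \<Gamma>" using G.m_closed[of g h] h g by simp
  have "k \<in> \<Gamma>" using G.m_closed[of "g \<cdot> h" "ginv g"] gh gi h by simp
  then show "k \<in> stab (g u)"
    using h g gi gh u mem[OF g u] mem[OF h(1) u] by (simp add: stab_iff mult_apply inv_apply)
qed

lemma orbit_type_invariant:
  assumes H: "H \<subseteq> \<Gamma>" and u: "u \<in> orbit_type_set U \<Gamma> H" and g: "g \<in> \<Gamma>"
  shows "g u \<in> orbit_type_set U \<Gamma> H"
proof -
  have uU: "u \<in> U" using u by (simp add: orbit_type_iff)
  have "g u \<in> orbit_type_set U \<Gamma> (stab u)"
    unfolding orbit_type_iff using mem[OF g uU] stab_image[OF g uU] g by blast
  then show ?thesis using orbit_type_eq[OF H u] by simp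
qed

text \<open>Conjugate subgroups have the same cardinality, and in a finite group an inclusion
  between them is then an equality. Near u, where stabilisers only shrink, this turns conjugacy into
  equality.\<close>

lemma orbit_type_stab_subset:
  assumes w: "w \<in> orbit_type_set U \<Gamma> (stab u)" and sub: "stab w \<subseteq> stab u"
  shows "stab w = stab u"
proof -
  obtain g where g: "g \<in> \<Gamma>" "stab w = (\<lambda>h. g \<cdot> h \<cdot> ginv g) ` stab u"
    using w unfolding orbit_type_iff by blast
  have "inj_on (\<lambda>h. g \<cdot> h \<cdot> ginv g) (stab u)"
  proof (rule inj_onI)
    fix h k assume hk: "h \<in> stab u" "k \<in> stab u"
      and eq: "g \<cdot> h \<cdot> ginv g = g \<cdot> k \<cdot> ginv g"
    have c: "h \<in> carrier G" "k \<in> carrier G" "g \<in> carrier G" using hk stab_subset g(1) by auto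
    then have "g \<cdot> h = g \<cdot> k"
      using G.right_cancel[of "ginv g" "g \<cdot> h" "g \<cdot> k"] eq by (simp del: carrier_G)
    then have "ginv g \<cdot> (g \<cdot> h) = ginv g \<cdot> (g \<cdot> k)" by simp
    then show "h = k" using c by (simp add: G.m_assoc[symmetric] del: carrier_G)
  qed
  then have "card (stab w) = card (stab u)" unfolding g(2) by (rule card_image)
  then show ?thesis
    using sub finite_subset[OF stab_subset finite] by (intro card_subset_eq) auto
qed

text \<open>Right translation permutes \<Gamma>. This makes x \<mapsto> (sum of f (g x) over g in
  \<Gamma>) an invariant function.\<close>

lemma sum_right_translate:
  assumes k: "k \<in> \<Gamma>"
  shows "(\<Sum>g\<in>\<Gamma>. f (g \<cdot> k)) = (\<Sum>g\<in>\<Gamma>. f g)"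
proof -
  have "bij_betw (\<lambda>g. g \<cdot> k) \<Gamma> \<Gamma>"
  proof (rule bij_betwI[where g = "\<lambda>g. g \<cdot> ginv k"])
    show "(\<lambda>g. g \<cdot> k) \<in> \<Gamma> \<rightarrow> \<Gamma>" "(\<lambda>g. g \<cdot> ginv k) \<in> \<Gamma> \<rightarrow> \<Gamma>"
      using G.m_closed G.inv_closed k by auto
    show "g \<cdot> k \<cdot> ginv k = g" "g \<cdot> ginv k \<cdot> k = g" if "g \<in> \<Gamma>" for g
    proof -
      have "g \<in> carrier G" "k \<in> carrier G" using that k by simp_all
      then show "g \<cdot> k \<cdot> ginv k = g" "g \<cdot> ginv k \<cdot> k = g"
        by (simp_all add: G.m_assoc del: carrier_G)
    qed
  qed
  then show ?thesis by (rule sum.reindex_bij_betw)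
qed

lemma stab_sum_right_translate:
  assumes u: "u \<in> U" and k: "k \<in> stab u"
  shows "(\<Sum>g\<in>stab u. f (g \<cdot> k)) = (\<Sum>g\<in>stab u. f g)"
proof -
  note S = stab_subgroup[OF u]
  have c: "g \<in> carrier G" if "g \<in> stab u" for g using that stab_subset by auto
  have "bij_betw (\<lambda>g. g \<cdot> k) (stab u) (stab u)"
  proof (rule bij_betwI[where g = "\<lambda>g. g \<cdot> ginv k"])
    show "(\<lambda>g. g \<cdot> k) \<in> stab u \<rightarrow> stab u" "(\<lambda>g. g \<cdot> ginv k) \<in> stab u \<rightarrow> stab u"
      using k subgroup.m_closed[OF S] subgroup.m_inv_closed[OF S] by blast+
    show "g \<cdot> k \<cdot> ginv k = g" "g \<cdot> ginv k \<cdot> k = g" if "g \<in> stab u" for g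
      using c[OF that] c[OF k] by (simp_all add: G.m_assoc del: carrier_G)
  qed
  then show ?thesis by (rule sum.reindex_bij_betw)
qed

end

locale orbi_chart = 
  fixes n :: nat and X :: "'a topology" and U :: "(nat \<Rightarrow> real) set"
    and \<Gamma> :: "((nat \<Rightarrow> real) \<Rightarrow> (nat \<Rightarrow> real)) set" and \<phi> :: "(nat \<Rightarrow> real) \<Rightarrow> 'a"
  assumes chart: "orbifold_chart n X (U, \<Gamma>, \<phi>)"

sublocale orbi_chart \<subseteq> finite_transformation_group U \<Gamma>
  by (rule finite_transformation_group.intro) (use chart in \<open>auto simp: orbifold_chart_def\<close>)

context orbi_chart
begin

lemma open_U: "eopen n U"
  and smooth_g: "g \<in> \<Gamma> \<Longrightarrow> smooth_map n U U g"
  and phi_mem: "u \<in> U \<Longrightarrow> \<phi> u \<in> topspace X"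
  and phi_inv: "g \<in> \<Gamma> \<Longrightarrow> u \<in> U \<Longrightarrow> \<phi> (g u) = \<phi> u"
  and open_image: "openin X (\<phi> ` U)"
  using chart by (auto simp: orbifold_chart_def)

lemma U_Rn: "u \<in> U \<Longrightarrow> u \<in> Rn n"
  using openin_subset[OF open_U] by blast

lemma open_preimage_g:
  assumes g: "g \<in> \<Gamma>" and O: "eopen n O'"
  shows "eopen n {u \<in> U. g u \<in> O'}"
proof -
  have c: "continuous_map (esub n U) (esub n U) g"
    by (rule smooth_map_continuous[OF smooth_g[OF g] open_U open_U])
  have "openin (esub n U)
      {u \<in> topspace (esub n U). g u \<in> O' \<inter> U}"
    by (rule openin_continuous_map_preimage[OF c]) (use O in \<open>auto simp: openin_subtopology\<close>)
  also have "{u \<in> topspace (esub n U). g u \<in> O' \<inter> U} = {u \<in> U. g u \<in> O'}"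
    using mem[OF g] U_Rn by auto
  finally show ?thesis using open_U by (simp add: openin_open_subtopology)
qed

text \<open>The homeomorphism from the orbit space is injective, so the fibres of \<phi> are the
  orbits.\<close>

lemma phi_eq_iff:
  assumes "u \<in> U" "v \<in> U" shows "\<phi> u = \<phi> v \<longleftrightarrow> (\<exists>g\<in>\<Gamma>. v = g u)"
proof
  obtain h where h: "homeomorphic_map (orbit_space (Euclidean_space n) U \<Gamma>) (subtopology X (\<phi> ` U)) h"
    "\<And>u. u \<in> U \<Longrightarrow> h (chart_orbit U \<Gamma> u) = \<phi> u"
    using chart by (auto simp: orbifold_chart_def)
  have top: "chart_orbit U \<Gamma> u \<in> topspace (orbit_space (Euclidean_space n) U \<Gamma>)" if "u \<in> U" for u
  proof -
    have "{x \<in> U. chart_orbit U \<Gamma> x \<in> chart_orbit U \<Gamma> ` U} = U" by auto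
    then have "openin (orbit_space (Euclidean_space n) U \<Gamma>) (chart_orbit U \<Gamma> ` U)"
      using open_U by (simp add: openin_orbit_space openin_open_subtopology)
    then show ?thesis using that openin_subset by blast
  qed
  assume "\<phi> u = \<phi> v"
  then have "chart_orbit U \<Gamma> u = chart_orbit U \<Gamma> v"
    using homeomorphic_imp_injective_map[OF h(1)] h(2) top assms by (auto simp: inj_on_def)
  moreover have "v \<in> chart_orbit U \<Gamma> v"
    unfolding orbit_iff using one_apply[OF assms(2), symmetric] G.one_closed carrier_G by blast
  ultimately show "\<exists>g\<in>\<Gamma>. v = g u" unfolding orbit_iff[symmetric] by simp
qed (use phi_inv assms in auto)

lemma preimage_saturation:
  assumes "W \<subseteq> U" shows "{u \<in> U. \<phi> u \<in> \<phi> ` W} = (\<Union>g\<in>\<Gamma>. {u \<in> U. g u \<in> W})"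
proof (intro subset_antisym subsetI)
  fix u assume "u \<in> {u \<in> U. \<phi> u \<in> \<phi> ` W}"
  then obtain w where w: "u \<in> U" "w \<in> W" "\<phi> u = \<phi> w" by blast
  then obtain g where "g \<in> \<Gamma>" "w = g u" using phi_eq_iff[of u w] assms by blast
  then show "u \<in> (\<Union>g\<in>\<Gamma>. {u \<in> U. g u \<in> W})" using w by blast
next
  fix u assume "u \<in> (\<Union>g\<in>\<Gamma>. {u \<in> U. g u \<in> W})"
  then obtain g where g: "g \<in> \<Gamma>" "u \<in> U" "g u \<in> W" by blast
  then have "\<phi> u = \<phi> (g u)" using phi_inv by simp
  then show "u \<in> {u \<in> U. \<phi> u \<in> \<phi> ` W}" using g by blast
qed

text \<open>Since U/\<Gamma> carries the quotient topology, \<phi> is a quotient map onto its image,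
  which is open in X.\<close>

lemma openin_image_iff:
  assumes T: "T \<subseteq> \<phi> ` U"
  shows "openin X T \<longleftrightarrow> eopen n {u \<in> U. \<phi> u \<in> T}"
proof -
  let ?Q = "orbit_space (Euclidean_space n) U \<Gamma>"
  obtain h where h: "homeomorphic_map ?Q (subtopology X (\<phi> ` U)) h"
    "\<And>u. u \<in> U \<Longrightarrow> h (chart_orbit U \<Gamma> u) = \<phi> u"
    using chart by (auto simp: orbifold_chart_def)
  have topQ: "topspace ?Q = chart_orbit U \<Gamma> ` U"
  proof
    show "topspace ?Q \<subseteq> chart_orbit U \<Gamma> ` U"
      using openin_topspace[of ?Q] unfolding openin_orbit_space by blast
    have "{x \<in> U. chart_orbit U \<Gamma> x \<in> chart_orbit U \<Gamma> ` U} = U" by auto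
    then show "chart_orbit U \<Gamma> ` U \<subseteq> topspace ?Q"
      using open_U by (intro openin_subset) (simp add: openin_orbit_space openin_open_subtopology)
  qed
  define S where "S = {q \<in> topspace ?Q. h q \<in> T}"
  have "h ` S = T"
    using T h(2) unfolding S_def topQ by (force simp: image_iff)
  then have "openin (subtopology X (\<phi> ` U)) T \<longleftrightarrow> openin ?Q S"
    using homeomorphic_map_openness[OF h(1), of S] S_def by auto
  also have "\<dots> \<longleftrightarrow> openin (esub n U) {u \<in> U. chart_orbit U \<Gamma> u \<in> S}"
    unfolding openin_orbit_space S_def topQ by auto
  also have "{u \<in> U. chart_orbit U \<Gamma> u \<in> S} = {u \<in> U. \<phi> u \<in> T}"
    unfolding S_def topQ using h(2) by auto
  finally show ?thesis
    using T open_U open_image by (simp add: openin_open_subtopology)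
qed

text \<open>The saturation of W is a union of preimages of W under group elements, hence open, and
  \<phi> is a quotient map.\<close>

lemma open_phi:
  assumes W: "eopen n W" "W \<subseteq> U"
  shows "openin X (\<phi> ` W)"
proof -
  have "eopen n {u \<in> U. \<phi> u \<in> \<phi> ` W}"
    unfolding preimage_saturation[OF W(2)] using open_preimage_g W(1) by blast
  then show ?thesis using openin_image_iff[of "\<phi> ` W"] W(2) by blast
qed

lemma open_preimage_phi:
  assumes "openin X T" shows "eopen n {u \<in> U. \<phi> u \<in> T}"
proof -
  have "openin X (T \<inter> \<phi> ` U)" using assms open_image by blast
  then have "eopen n {u \<in> U. \<phi> u \<in> T \<inter> \<phi> ` U}"
    using openin_image_iff[of "T \<inter> \<phi> ` U"] by blast
  moreover have "{u \<in> U. \<phi> u \<in> T \<inter> \<phi> ` U} = {u \<in> U. \<phi> u \<in> T}" by auto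
  ultimately show ?thesis by simp
qed

lemma continuous_phi: "continuous_map (esub n U) X \<phi>"
  unfolding continuous_map_def
proof (intro conjI allI impI)
  show "\<phi> \<in> topspace (esub n U) \<rightarrow> topspace X" using phi_mem by auto
  fix T assume "openin X T"
  then have "eopen n {u \<in> U. \<phi> u \<in> T}" by (rule open_preimage_phi)
  moreover have "{x \<in> topspace (esub n U). \<phi> x \<in> T} = {u \<in> U. \<phi> u \<in> T}"
    using U_Rn by auto
  ultimately show "openin (esub n U) {x \<in> topspace (esub n U). \<phi> x \<in> T}"
    using open_U by (auto simp: openin_open_subtopology)
qed

lemma jac_mult:
  assumes "g \<in> \<Gamma>" "h \<in> \<Gamma>" "u \<in> U"
  shows "jac n (g \<cdot> h) u v = jac n g (h u) (jac n h u v)"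
proof -
  have "jac n (g \<cdot> h) u v = jac n (\<lambda>y. g (h y)) u v"
    unfolding jac_def using mult_apply[OF assms(1,2)]
    by (intro ext sum.cong arg_cong2[where f = "(*)"] partial_deriv_cong(1)[OF open_U assms(3)]) auto
  also have "\<dots> = jac n g (h u) (jac n h u v)"
    by (rule jac_compose[OF open_U open_U smooth_g[OF assms(2)] smooth_g[OF assms(1)] openin_subset[OF open_U] assms(3)])
  finally show ?thesis .
qed

end

section \<open>Smooth functions on an orbifold\<close>

locale orbifold_space =
  fixes n :: nat and X :: "'a topology" and A :: "'a orbi_chart set"
  assumes orbifold: "orbifold n X A"
begin

abbreviation "F \<equiv> orbifold_smooth_functions n A"

lemma Hausdorff: "Hausdorff_space X" and atlas: "orbifold_atlas n X A"
  using orbifold by (auto simp: orbifold_def maximal_atlas_def)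

lemma orbi_chart: "(U, \<Gamma>, \<phi>) \<in> A \<Longrightarrow> orbi_chart n X U \<Gamma> \<phi>"
  using atlas by (auto simp: orbifold_atlas_def orbi_chart_def)

lemma smooth_phi: "(U, \<Gamma>, \<phi>) \<in> A \<Longrightarrow> f \<in> F \<Longrightarrow> smooth_on n U (\<lambda>u. f (\<phi> u))"
  by (auto simp: orbifold_smooth_functions_def o_def)

lemma smooth_functionsI:
  assumes "\<And>U \<Gamma> \<phi>. (U, \<Gamma>, \<phi>) \<in> A \<Longrightarrow> smooth_on n U (\<lambda>u. f (\<phi> u))"
  shows "f \<in> F"
  unfolding orbifold_smooth_functions_def mem_Collect_eq o_def
proof (rule ballI)
  fix c assume "c \<in> A"
  then show "case c of (U, \<Gamma>, \<phi>) \<Rightarrow> smooth_on n U (\<lambda>u. f (\<phi> u))"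
    using assms by (cases c) simp
qed

lemma obtain_chart:
  assumes "x \<in> topspace X"
  obtains U \<Gamma> \<phi> u where "(U, \<Gamma>, \<phi>) \<in> A" "u \<in> U" "x = \<phi> u"
proof -
  have "(\<Union>c\<in>A. chart_image c) = topspace X" using atlas unfolding orbifold_atlas_def by (elim conjE)
  then have "x \<in> (\<Union>c\<in>A. chart_image c)" using assms by blast
  then obtain c where c: "c \<in> A" "x \<in> chart_image c" by blast
  obtain U \<Gamma> \<phi> where c': "c = (U, \<Gamma>, \<phi>)" by (cases c)
  then obtain u where "u \<in> U" "x = \<phi> u" using c(2) unfolding chart_image_def by auto
  then show ?thesis using that[of U \<Gamma> \<phi> u] c(1) c' by simp
qed

text \<open>
  Chart embeddings are open by invariance of domain, and their inverses are smooth because the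
  inverse Jacobian matrix is, by Cramer's rule.
\<close>

lemma chart_transition:
  assumes c: "(U, \<Gamma>, \<phi>) \<in> A" and d: "(V, \<Delta>, \<psi>) \<in> A" and u: "u \<in> U" and v: "v \<in> V" and eq: "\<phi> u = \<psi> v"
  shows "\<exists>O' \<tau>. eopen n O' \<and> v \<in> O' \<and> O' \<subseteq> V \<and> smooth_map n O' U \<tau> \<and> (\<forall>y\<in>O'. \<phi> (\<tau> y) = \<psi> y)"
proof -
  interpret c: orbi_chart n X U \<Gamma> \<phi> by (rule orbi_chart[OF c])
  interpret d: orbi_chart n X V \<Delta> \<psi> by (rule orbi_chart[OF d])
  have "\<forall>c\<in>A. \<forall>d\<in>A. \<exists>W. (\<forall>w\<in>W. orbifold_chart n X w \<and> chart_embeds n w c \<and> chart_embeds n w d) \<and>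
      (\<Union>w\<in>W. chart_image w) = chart_image c \<inter> chart_image d"
    using atlas unfolding orbifold_atlas_def by (elim conjE)
  from bspec[OF bspec[OF this c] d]
  obtain W where W: "\<forall>w\<in>W. orbifold_chart n X w \<and> chart_embeds n w (U, \<Gamma>, \<phi>) \<and> chart_embeds n w (V, \<Delta>, \<psi>)"
    "(\<Union>w\<in>W. chart_image w) = chart_image (U, \<Gamma>, \<phi>) \<inter> chart_image (V, \<Delta>, \<psi>)"
    by (elim exE conjE)
  have "\<phi> u \<in> (\<Union>w\<in>W. chart_image w)" unfolding W(2)
    using imageI[OF u, of \<phi>] imageI[OF v, of \<psi>] eq by (simp add: chart_image_def)
  then obtain w where w': "w \<in> W" "\<phi> u \<in> chart_image w" by blast
  obtain P Q \<xi> where "w = (P, Q, \<xi>)" by (cases w)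
  then obtain p where w: "(P, Q, \<xi>) \<in> W" "p \<in> P" "\<phi> u = \<xi> p"
    using w' unfolding chart_image_def by auto
  interpret w: orbi_chart n X P Q \<xi> using W(1) w(1) unfolding orbi_chart_def by blast
  obtain l where l: "smooth_embedding n P U l" "\<forall>x\<in>P. \<phi> (l x) = \<xi> x"
    using W(1) w(1) unfolding chart_embeds_def prod.case by blast
  obtain m where m: "smooth_embedding n P V m" "\<forall>x\<in>P. \<psi> (m x) = \<xi> x"
    using W(1) w(1) unfolding chart_embeds_def prod.case by blast
  have ls: "smooth_map n P U l" and ms: "smooth_map n P V m" using l m by (auto simp: smooth_embedding_def)
  have topP: "topspace (esub n P) = P" using w.U_Rn by auto
  have mP: "m ` P \<subseteq> V" using smooth_mapD(1)[OF ms] by blast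
  define O1 where "O1 = m ` P"
  have "homeomorphic_map (esub n P) (subtopology (esub n V) O1) m"
    using m(1) unfolding smooth_embedding_def embedding_map_def topP O1_def by blast
  moreover have "subtopology (esub n V) O1 = esub n O1"
    using mP by (simp add: subtopology_subtopology O1_def Int_absorb1)
  ultimately have hm: "homeomorphic_map (esub n P) (esub n O1) m"
    by simp
  have O1: "eopen n O1"
    unfolding O1_def
  proof (rule invariance_of_domain_Euclidean_space[OF w.open_U])
    show "continuous_map (esub n P) (Euclidean_space n) m"
      using homeomorphic_imp_continuous_map[OF hm] by (simp add: continuous_map_in_subtopology)
    show "inj_on m P" using homeomorphic_imp_injective_map[OF hm] topP by simp
  qed
  have topO1: "topspace (esub n O1) = O1"
    using openin_subset[OF O1] by auto
  obtain G where G: "homeomorphic_maps (esub n P) (esub n O1) m G"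
    using hm unfolding homeomorphic_map_maps by blast
  have Gc: "continuous_map (esub n O1) (esub n P) G"
    and Gm: "\<And>x. x \<in> P \<Longrightarrow> G (m x) = x" and mG: "\<And>y. y \<in> O1 \<Longrightarrow> m (G y) = y"
    using G topP topO1 unfolding homeomorphic_maps_def by auto
  have GP: "G y \<in> P" if "y \<in> O1" for y using that Gm by (auto simp: O1_def)
  have mO: "smooth_map n P O1 m" using ms by (auto simp: smooth_map_def O1_def)
  have inj: "\<And>x v. x \<in> P \<Longrightarrow> v \<in> Rn n \<Longrightarrow> (\<And>j. j < n \<Longrightarrow> jac n m x v j = 0) \<Longrightarrow> v = (\<lambda>_. 0)"
    using m(1) unfolding smooth_embedding_def jac_def by blast
  have lG: "Ck_on n O1 k (\<lambda>y. l (G y) j)" if "j < n" for j k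
  proof (rule Ck_on_inverse_map[OF w.open_U O1 mO _ _ _ Gc, where h = "\<lambda>x. l x j"])
    show "v = (\<lambda>_. 0)" if "x \<in> P" "v \<in> Rn n" "\<And>j. j < n \<Longrightarrow> jac n m x v j = 0" for x v
      by (rule inj[OF that])
  qed (simp_all add: GP mG smooth_mapD(2)[OF ls that])
  \<comment> \<open>The point \<open>m p\<close> is only known to lie in the orbit of v. Some g in
    \<Delta> moves v there, and the transition is g, followed by the inverse G of m, followed by
    l.\<close>
  have "\<psi> v = \<psi> (m p)" using bspec[OF m(2) w(2)] w(3) eq by simp
  moreover have "m p \<in> V" using mP w(2) by blast
  ultimately obtain g where g: "g \<in> \<Delta>" "m p = g v" using d.phi_eq_iff[OF v, of "m p"] by blast
  define O' where "O' = {y \<in> V. g y \<in> O1}"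
  define \<tau> where "\<tau> y = l (G (g y))" for y
  have O': "eopen n O'" unfolding O'_def by (rule d.open_preimage_g[OF g(1) O1])
  have "smooth_map n O' U \<tau>"
    unfolding smooth_map_def smooth_on_def
  proof (intro conjI allI impI)
    show "\<tau> \<in> O' \<rightarrow> U" using GP smooth_mapD(1)[OF ls] by (auto simp: \<tau>_def O'_def)
    fix j k assume j: "j < n"
    show "Ck_on n O' k (\<lambda>x. \<tau> x j)"
      unfolding \<tau>_def
    proof (rule Ck_on_compose[OF O' O1, where f = "\<lambda>y. l (G y) j"])
      show "Ck_on n O' k (\<lambda>x. g x i)" if "i < n" for i
        by (rule Ck_on_subset[OF smooth_mapD(2)[OF d.smooth_g[OF g(1)] that]]) (auto simp: O'_def)
    qed (auto simp: O'_def lG[OF j])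
  qed
  moreover have "\<phi> (\<tau> y) = \<psi> y" if "y \<in> O'" for y
  proof -
    have y: "y \<in> V" "g y \<in> O1" using that by (auto simp: O'_def)
    have "\<phi> (\<tau> y) = \<xi> (G (g y))" using l(2) GP[OF y(2)] by (simp add: \<tau>_def)
    also have "\<dots> = \<psi> (m (G (g y)))" using m(2) GP[OF y(2)] by simp
    also have "\<dots> = \<psi> y" using mG[OF y(2)] d.phi_inv[OF g(1) y(1)] by simp
    finally show ?thesis .
  qed
  moreover have "v \<in> O'" "O' \<subseteq> V" using v g(2) imageI[OF w(2), of m] by (auto simp: O'_def O1_def)
  ultimately show ?thesis using O' by blast
qed

text \<open>Invariance makes f descend to \<phi> \<open>U. A closed C containing the support is
  essential: closedness in \<phi>\<close> U alone would not prevent the support from accumulating at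
  boundary points of the chart image in X.\<close>

lemma extend_by_zero:
  assumes c: "(U, \<Gamma>, \<phi>) \<in> A" and f: "smooth_on n U f"
    and inv: "\<And>g u. g \<in> \<Gamma> \<Longrightarrow> u \<in> U \<Longrightarrow> f (g u) = f u"
    and C: "closedin X C" "C \<subseteq> \<phi> ` U" and zero: "\<And>u. u \<in> U \<Longrightarrow> \<phi> u \<notin> C \<Longrightarrow> f u = 0"
  shows "\<exists>h\<in>F. (\<forall>u\<in>U. h (\<phi> u) = f u) \<and> (\<forall>y. y \<notin> C \<longrightarrow> h y = 0)"
proof -
  interpret c: orbi_chart n X U \<Gamma> \<phi> by (rule orbi_chart[OF c])
  \<comment> \<open>The choice of u in the fibre does not matter, because fibres are orbits and f is
    invariant.\<close>
  define h where "h y = (if y \<in> \<phi> ` U then f (SOME u. u \<in> U \<and> \<phi> u = y) else 0)" for y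
  have h: "h (\<phi> u) = f u" if u: "u \<in> U" for u
  proof -
    define u' where "u' = (SOME u'. u' \<in> U \<and> \<phi> u' = \<phi> u)"
    have "u' \<in> U \<and> \<phi> u' = \<phi> u" unfolding u'_def by (rule someI[of _ u]) (use u in simp)
    then obtain g where "g \<in> \<Gamma>" "u' = g u" using c.phi_eq_iff[OF u, of u'] by auto
    then have "f u' = f u" using inv u by simp
    then show ?thesis using u by (simp add: h_def u'_def)
  qed
  have h0: "h y = 0" if "y \<notin> C" for y
  proof (cases "y \<in> \<phi> ` U")
    case True
    then obtain u where "u \<in> U" "y = \<phi> u" by blast
    then show ?thesis using h zero that by simp
  qed (simp add: h_def)
  have "h \<in> F"
  proof (rule smooth_functionsI)
    fix V \<Delta> \<psi> assume d: "(V, \<Delta>, \<psi>) \<in> A"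
    interpret d: orbi_chart n X V \<Delta> \<psi> by (rule orbi_chart[OF d])
    show "smooth_on n V (\<lambda>v. h (\<psi> v))"
    proof (rule smooth_on_local[OF d.open_U])
      fix v assume v: "v \<in> V"
      show "\<exists>O'. eopen n O' \<and> v \<in> O' \<and> O' \<subseteq> V \<and> smooth_on n O' (\<lambda>v. h (\<psi> v))"
      \<comment> \<open>Over the chart image a transition pulls f back smoothly; a point outside it
        has a neighbourhood that misses C, where h vanishes.\<close>
      proof (cases "\<psi> v \<in> \<phi> ` U")
        case True
        then obtain u where u: "u \<in> U" "\<phi> u = \<psi> v" by auto
        obtain O' \<tau> where O': "eopen n O'" "v \<in> O'" "O' \<subseteq> V" "smooth_map n O' U \<tau>" "\<forall>y\<in>O'. \<phi> (\<tau> y) = \<psi> y"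
          using chart_transition[OF c d u(1) v u(2)] by blast
        have "smooth_on n O' (\<lambda>y. f (\<tau> y))" by (rule smooth_on_compose[OF O'(1) c.open_U O'(4) f])
        moreover have "smooth_on n O' (\<lambda>v. h (\<psi> v)) \<longleftrightarrow> smooth_on n O' (\<lambda>y. f (\<tau> y))"
        proof (rule smooth_on_cong[OF O'(1)])
          fix y assume y: "y \<in> O'"
          show "h (\<psi> y) = f (\<tau> y)"
            using h[OF smooth_mapD(1)[OF O'(4) y]] bspec[OF O'(5) y] by simp
        qed
        ultimately have "smooth_on n O' (\<lambda>v. h (\<psi> v))" by blast
        then show ?thesis using O' by blast
      next
        case False
        define O' where "O' = {y \<in> V. \<psi> y \<in> topspace X - C}"
        have O': "eopen n O'" unfolding O'_def
          by (rule d.open_preimage_phi) (use C in blast)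
        have "smooth_on n O' (\<lambda>_. 0)" using O' by (simp add: smooth_on_def)
        moreover have "smooth_on n O' (\<lambda>v. h (\<psi> v)) \<longleftrightarrow> smooth_on n O' (\<lambda>_. 0)"
          by (rule smooth_on_cong[OF O']) (simp add: O'_def h0)
        ultimately have "smooth_on n O' (\<lambda>v. h (\<psi> v))" by blast
        moreover have "v \<in> O'" using False C v d.phi_mem by (auto simp: O'_def)
        moreover have "O' \<subseteq> V" by (auto simp: O'_def)
        ultimately show ?thesis using O' by blast
      qed
    qed
  qed
  then show ?thesis using h h0 by blast
qed

text \<open>A product of compact intervals, with the factor {0} from index n on.\<close>

lemma compactin_closed_cube:
  assumes "u \<in> Rn n" shows "compactin (Euclidean_space n) {x \<in> Rn n. \<forall>i<n. \<bar>x i - u i\<bar> \<le> r}"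
proof -
  define S where "S i = (if i < n then {u i - r..u i + r} else {0})" for i
  have eq: "{x \<in> Rn n. \<forall>i<n. \<bar>x i - u i\<bar> \<le> r} = Pi\<^sub>E UNIV S"
  proof (intro subset_antisym subsetI)
    fix x assume "x \<in> {x \<in> Rn n. \<forall>i<n. \<bar>x i - u i\<bar> \<le> r}"
    then show "x \<in> Pi\<^sub>E UNIV S" by (auto simp: S_def topspace_Euclidean_space abs_le_iff algebra_simps)
  next
    fix x assume "x \<in> Pi\<^sub>E UNIV S"
    then have x: "x i \<in> S i" for i by auto
    have "x i = 0" if "n \<le> i" for i using x[of i] that by (simp add: S_def)
    moreover have "\<bar>x i - u i\<bar> \<le> r" if "i < n" for i using x[of i] that by (auto simp: S_def)
    ultimately show "x \<in> {x \<in> Rn n. \<forall>i<n. \<bar>x i - u i\<bar> \<le> r}" by (auto simp: topspace_Euclidean_space)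
  qed
  have "compactin (powertop_real UNIV) (Pi\<^sub>E UNIV S)"
    unfolding compactin_PiE by (auto simp: S_def)
  then show ?thesis
    unfolding eq[symmetric] unfolding Euclidean_space_def compactin_subtopology
    by (auto simp: topspace_Euclidean_space)
qed

text \<open>The bump b need not be invariant; summing a b over \<Gamma> produces the invariant
  function. Its support lies in the compact image of K, which is closed in the Hausdorff space X, so
  extension by zero applies. The factor a is left free: a constant, a linear and a quadratic one
  will be used.\<close>

lemma invariant_bump:
  assumes c: "(U, \<Gamma>, \<phi>) \<in> A" and u: "u \<in> U" and O: "eopen n O'" "u \<in> O'" "O' \<subseteq> U"
  shows "\<exists>b. smooth_on n U b \<and> 0 < b u \<and> (\<forall>x\<in>U. 0 \<le> b x) \<and> (\<forall>x\<in>U. x \<notin> O' \<longrightarrow> b x = 0) \<and>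
    (\<forall>a. smooth_on n U a \<longrightarrow> (\<exists>f\<in>F. (\<forall>x\<in>U. f (\<phi> x) = (\<Sum>g\<in>\<Gamma>. a (g x) * b (g x))) \<and> (\<forall>y. y \<notin> \<phi> ` O' \<longrightarrow> f y = 0)))"
proof -
  interpret c: orbi_chart n X U \<Gamma> \<phi> by (rule orbi_chart[OF c])
  have uR: "u \<in> Rn n" using c.U_Rn u by blast
  obtain d where d: "d > 0" "cube n u d \<subseteq> O'" using O unfolding openin_Rn_iff by blast
  \<comment> \<open>Half of d, so that the closed cube K of radius r lies in the open cube of radius
    d.\<close>
  define r where "r = d / 2"
  have r: "0 < r" "r < d" using d by (auto simp: r_def)
  define K where "K = {x \<in> Rn n. \<forall>i<n. \<bar>x i - u i\<bar> \<le> r}"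
  \<comment> \<open>Positive exactly on the round ball of radius r, which lies in K, and smooth
    across its boundary sphere by flatness.\<close>
  define b where "b x = flat_poly 1 (r\<^sup>2 - (\<Sum>i<n. (x i - u i)\<^sup>2))" for x
  have KO: "K \<subseteq> O'"
  proof
    fix x assume "x \<in> K"
    then have "x \<in> cube n u d" using r(2) by (force simp: K_def cube_def)
    then show "x \<in> O'" using d by blast
  qed
  then have KU: "K \<subseteq> U" using O by blast
  have bK: "x \<in> K" if x: "x \<in> U" "b x \<noteq> 0" for x
  proof -
    have *: "(\<Sum>i<n. (x i - u i)\<^sup>2) < r\<^sup>2" using x(2) by (auto simp: b_def flat_poly_def split: if_splits)
    have "\<bar>x i - u i\<bar> \<le> r" if "i < n" for i
    proof -
      have "(x i - u i)\<^sup>2 \<le> (\<Sum>i<n. (x i - u i)\<^sup>2)" using that by (intro member_le_sum) auto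
      then have "\<bar>x i - u i\<bar>\<^sup>2 \<le> r\<^sup>2" using * by simp
      then show ?thesis using r(1) by (intro power2_le_imp_le[of "\<bar>x i - u i\<bar>" r]) auto
    qed
    then show ?thesis using x(1) c.U_Rn by (simp add: K_def)
  qed
  have sq: "Ck_on n U k (\<lambda>x. (x i - u i)\<^sup>2)" for i k
    unfolding power2_eq_square
    by (intro Ck_on_mult[OF c.open_U] Ck_on_diff[OF c.open_U] Ck_on_coord[OF c.open_U] Ck_on_const[OF c.open_U])
  have b: "smooth_on n U b"
    unfolding smooth_on_def b_def
    by (intro allI Ck_on_flat_poly[OF c.open_U] Ck_on_diff[OF c.open_U] Ck_on_const[OF c.open_U] Ck_on_sum[OF c.open_U] sq)
  have bu: "0 < b u" using r by (simp add: b_def flat_poly_def)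
  have b0: "0 \<le> b x" for x by (simp add: b_def flat_poly_def)
  define C where "C = \<phi> ` K"
  have "compactin (esub n U) K"
    using compactin_closed_cube[OF uR, of r] KU by (simp add: compactin_subtopology K_def)
  then have "compactin X C" unfolding C_def by (rule image_compactin[OF _ c.continuous_phi])
  then have C: "closedin X C" by (rule compactin_imp_closedin[OF Hausdorff])
  have "\<exists>f\<in>F. (\<forall>x\<in>U. f (\<phi> x) = (\<Sum>g\<in>\<Gamma>. a (g x) * b (g x))) \<and> (\<forall>y. y \<notin> \<phi> ` O' \<longrightarrow> f y = 0)"
    if a: "smooth_on n U a" for a
  proof -
    let ?f = "\<lambda>x. \<Sum>g\<in>\<Gamma>. a (g x) * b (g x)"
    have s: "smooth_on n U ?f"
      unfolding smooth_on_def
    proof (intro allI, rule Ck_on_sum[OF c.open_U], rule Ck_on_mult[OF c.open_U])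
      fix k g assume g: "g \<in> \<Gamma>"
      show "Ck_on n U k (\<lambda>x. a (g x))" "Ck_on n U k (\<lambda>x. b (g x))"
        using smooth_on_compose[OF c.open_U c.open_U c.smooth_g[OF g]] a b smooth_onD by blast+
    qed
    have inv: "?f (k x) = ?f x" if k: "k \<in> \<Gamma>" and x: "x \<in> U" for k x
    proof -
      have "?f (k x) = (\<Sum>g\<in>\<Gamma>. a ((g \<otimes>\<^bsub>c.G\<^esub> k) x) * b ((g \<otimes>\<^bsub>c.G\<^esub> k) x))"
        using c.mult_apply[OF _ k x] by (intro sum.cong) auto
      also have "\<dots> = ?f x" by (rule c.sum_right_translate[OF k])
      finally show ?thesis .
    qed
    have zero: "?f x = 0" if x: "x \<in> U" "\<phi> x \<notin> C" for x
    proof (rule sum.neutral, intro ballI)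
      fix g assume g: "g \<in> \<Gamma>"
      have "g x \<notin> K" using x c.phi_inv[OF g x(1)] by (metis C_def imageI)
      then show "a (g x) * b (g x) = 0" using bK c.mem[OF g x(1)] by auto
    qed
    have CU: "C \<subseteq> \<phi> ` U" using KU by (auto simp: C_def)
    have "\<exists>h\<in>F. (\<forall>u\<in>U. h (\<phi> u) = ?f u) \<and> (\<forall>y. y \<notin> C \<longrightarrow> h y = 0)"
    proof (rule extend_by_zero[OF c s _ C CU])
      show "?f (k x) = ?f x" if "k \<in> \<Gamma>" "x \<in> U" for k x by (rule inv[OF that])
      show "?f x = 0" if "x \<in> U" "\<phi> x \<notin> C" for x by (rule zero[OF that])
    qed
    then obtain h where "h \<in> F" "\<forall>u\<in>U. h (\<phi> u) = ?f u" "\<forall>y. y \<notin> C \<longrightarrow> h y = 0" by blast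
    moreover have "C \<subseteq> \<phi> ` O'" using KO by (auto simp: C_def)
    ultimately show ?thesis by blast
  qed
  moreover have "b x = 0" if "x \<in> U" "x \<notin> O'" for x using bK[OF that(1)] KO that(2) by blast
  ultimately show ?thesis using b bu b0 by blast
qed

text \<open>Take a = 1 in the averaged bump; no cancellation occurs since b is nonnegative.
  Consequently the smooth functions determine the topology.\<close>

lemma separating_function:
  assumes T: "openin X T" "x \<in> T"
  shows "\<exists>f\<in>F. f x \<noteq> 0 \<and> (\<forall>y. y \<notin> T \<longrightarrow> f y = 0)"
proof -
  obtain U \<Gamma> \<phi> u where c: "(U, \<Gamma>, \<phi>) \<in> A" "u \<in> U" "x = \<phi> u"
  proof (rule obtain_chart)
    show "x \<in> topspace X" using T openin_subset by blast
  qed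
  interpret c: orbi_chart n X U \<Gamma> \<phi> by (rule orbi_chart[OF c(1)])
  define O' where "O' = {u \<in> U. \<phi> u \<in> T}"
  have O': "eopen n O'" "u \<in> O'" "O' \<subseteq> U"
    using c.open_preimage_phi[OF T(1)] c T by (auto simp: O'_def)
  obtain b where b: "0 < b u" "\<forall>x\<in>U. 0 \<le> b x"
    "\<forall>a. smooth_on n U a \<longrightarrow> (\<exists>f\<in>F. (\<forall>x\<in>U. f (\<phi> x) = (\<Sum>g\<in>\<Gamma>. a (g x) * b (g x))) \<and> (\<forall>y. y \<notin> \<phi> ` O' \<longrightarrow> f y = 0))"
    using invariant_bump[OF c(1,2) O'] by blast
  have "smooth_on n U (\<lambda>_. 1)" using c.open_U by (simp add: smooth_on_def)
  then obtain f where f: "f \<in> F" "\<forall>x\<in>U. f (\<phi> x) = (\<Sum>g\<in>\<Gamma>. 1 * b (g x))" "\<forall>y. y \<notin> \<phi> ` O' \<longrightarrow> f y = 0"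
    using b(3) by blast
  have one: "c.gid \<in> \<Gamma>" using c.G.one_closed by simp
  have "b (c.gid u) \<le> (\<Sum>g\<in>\<Gamma>. b (g u))"
    using one b(2) c.mem[OF _ c(2)] by (intro member_le_sum c.finite) auto
  then have "f x > 0" using b(1) f(2) c(2,3) c.one_apply[OF c(2)] by simp
  moreover have "f y = 0" if "y \<notin> T" for y
  proof -
    have "\<phi> ` O' \<subseteq> T" by (auto simp: O'_def)
    then have "y \<notin> \<phi> ` O'" using that by blast
    then show ?thesis using f(3) by blast
  qed
  ultimately show ?thesis using f(1) by (intro bexI[of _ f]) auto
qed

text \<open>As \<phi> is open, it suffices to know that f is continuous in charts.\<close>

lemma smooth_function_continuous:
  assumes f: "f \<in> F" shows "continuous_map X euclideanreal f"
  unfolding continuous_map_def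
proof (intro conjI allI impI)
  fix T :: "real set" assume T: "openin euclideanreal T"
  show "openin X {x \<in> topspace X. f x \<in> T}"
  proof (subst openin_subopen, intro ballI)
    fix x assume x: "x \<in> {x \<in> topspace X. f x \<in> T}"
    then have "x \<in> topspace X" by simp
    then obtain U \<Gamma> \<phi> u where c: "(U, \<Gamma>, \<phi>) \<in> A" "u \<in> U" "x = \<phi> u" by (rule obtain_chart)
    interpret c: orbi_chart n X U \<Gamma> \<phi> by (rule orbi_chart[OF c(1)])
    define O' where "O' = {u \<in> U. f (\<phi> u) \<in> T}"
    have "openin (esub n U) {u \<in> topspace (esub n U). f (\<phi> u) \<in> T}"
      by (rule openin_continuous_map_preimage[OF smooth_on_continuous[OF smooth_phi[OF c(1) f]] T])
    moreover have "{u \<in> topspace (esub n U). f (\<phi> u) \<in> T} = O'"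
      using c.U_Rn by (auto simp: O'_def)
    ultimately have "eopen n O'"
      using c.open_U by (simp add: openin_open_subtopology)
    then have "openin X (\<phi> ` O')" by (rule c.open_phi) (auto simp: O'_def)
    moreover have "x \<in> \<phi> ` O'" using x c by (auto simp: O'_def)
    moreover have "\<phi> ` O' \<subseteq> {x \<in> topspace X. f x \<in> T}" using c.phi_mem by (auto simp: O'_def)
    ultimately show "\<exists>S. openin X S \<and> x \<in> S \<and> S \<subseteq> {x \<in> topspace X. f x \<in> T}" by blast
  qed
qed simp

lemma smooth_functions_lincomb:
  assumes "\<And>i. i < k \<Longrightarrow> fs i \<in> F" shows "(\<lambda>y. \<Sum>i<k. c i * fs i y) \<in> F"
proof (rule smooth_functionsI)
  fix U \<Gamma> \<phi> assume c: "(U, \<Gamma>, \<phi>) \<in> A"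
  interpret c: orbi_chart n X U \<Gamma> \<phi> by (rule orbi_chart[OF c])
  show "smooth_on n U (\<lambda>u. \<Sum>i<k. c i * fs i (\<phi> u))"
    unfolding smooth_on_def
    by (intro allI Ck_on_sum[OF c.open_U] Ck_on_cmult[OF c.open_U] smooth_onD[OF smooth_phi[OF c assms]]) simp
qed

end

section \<open>Critical points and the dimension of strata\<close>

text \<open>
  The notions of this section refer to the topology and the smooth functions only.  In an
  orbifold the cardinalities below are bounded by the dimension, so that the \<open>GREATEST\<close>
  in \<open>stratum_dim\<close> is attained.
\<close>

definition critical_at :: "'a topology \<Rightarrow> ('a \<Rightarrow> real) set \<Rightarrow> ('a \<Rightarrow> real) \<Rightarrow> 'a \<Rightarrow> bool" where
  "critical_at X F f x \<longleftrightarrow>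
     (\<exists>g\<in>F. \<exists>N. openin X N \<and> x \<in> N \<and> g x = 0 \<and> (\<forall>y\<in>N. \<bar>f y - f x\<bar> \<le> g y))"

definition indep_at :: "'a topology \<Rightarrow> ('a \<Rightarrow> real) set \<Rightarrow> 'a \<Rightarrow> nat \<Rightarrow> bool" where
  "indep_at X F x k \<longleftrightarrow> (\<exists>fs :: nat \<Rightarrow> 'a \<Rightarrow> real. (\<forall>i<k. fs i \<in> F) \<and>
     (\<forall>c. critical_at X F (\<lambda>y. \<Sum>i<k. c i * fs i y) x \<longrightarrow> (\<forall>i<k. c i = 0)))"

definition stratum_dim :: "'a topology \<Rightarrow> ('a \<Rightarrow> real) set \<Rightarrow> 'a \<Rightarrow> nat" where
  "stratum_dim X F x = (GREATEST k. indep_at X F x k)"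

text \<open>A covector is the sequence of its coefficients, of which only the first \<open>n\<close> count.\<close>

definition indep_cov :: "nat \<Rightarrow> (nat \<Rightarrow> real) set \<Rightarrow> nat \<Rightarrow> bool" where
  "indep_cov n V k \<longleftrightarrow> (\<exists>\<alpha> :: nat \<Rightarrow> nat \<Rightarrow> real. (\<forall>i<k. \<alpha> i \<in> V) \<and>
     (\<forall>c. (\<forall>j<n. (\<Sum>i<k. c i * \<alpha> i j) = 0) \<longrightarrow> (\<forall>i<k. c i = 0)))"

definition cov_rank :: "nat \<Rightarrow> (nat \<Rightarrow> real) set \<Rightarrow> nat" where
  "cov_rank n V = (GREATEST k. indep_cov n V k)"

text \<open>If n < k, the n equations in k unknowns, padded by zero rows to a square system, have a
  nonzero solution: row n is zero, so the matrix cannot be invertible.\<close>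

lemma indep_cov_le:
  assumes "indep_cov n V k" shows "k \<le> n"
proof (rule ccontr)
  assume kn: "\<not> k \<le> n"
  obtain \<alpha> where \<alpha>: "\<And>c. (\<forall>j<n. (\<Sum>i<k. c i * \<alpha> i j) = 0) \<Longrightarrow> (\<forall>i<k. c i = (0::real))"
    using assms unfolding indep_cov_def by blast
  define a where "a j i = (if j < n then \<alpha> i j else 0)" for j i
  have "Determinant.det (mat k k (\<lambda>(i, j). a i j)) = 0"
  proof (rule ccontr)
    assume "Determinant.det (mat k k (\<lambda>(i, j). a i j)) \<noteq> 0"
    from matinv(2)[OF this, of n n] kn show False by (simp add: a_def)
  qed
  then obtain v where v: "v \<in> Rn k" "\<forall>j<k. (\<Sum>i<k. a j i * v i) = 0" "v \<noteq> (\<lambda>_. 0)"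
    using det_nz_iff[of k a] by blast
  have "(\<Sum>i<k. v i * \<alpha> i j) = 0" if "j < n" for j
    using spec[OF v(2), of j] that kn by (simp add: a_def mult.commute)
  then have "\<forall>i<k. v i = 0" using \<alpha> by blast
  then have "v = (\<lambda>_. 0)" using v(1) by (intro Rn_eqI[of _ k]) (auto simp: topspace_Euclidean_space)
  then show False using v(3) by blast
qed

text \<open>The empty family and the bound n show that the \<open>GREATEST\<close> is
  attained.\<close>

lemma indep_cov_rank: "indep_cov n V (cov_rank n V)"
  unfolding cov_rank_def
  by (rule GreatestI_nat[of _ 0 n]) (auto simp: indep_cov_def[of _ _ 0] intro: indep_cov_le)

lemma cov_rank_ge: "indep_cov n V k \<Longrightarrow> k \<le> cov_rank n V"
  unfolding cov_rank_def by (rule Greatest_le_nat[of _ _ n]) (auto intro: indep_cov_le)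

text \<open>Append \<beta> to a maximal independent family of V. The hypothesis
  \<open>closed\<close> says that V is closed under linear combinations and under changing
  coefficients from index n on; it turns a relation involving \<beta> into \<beta> \<in> V.\<close>

lemma cov_rank_strict_mono:
  assumes sub: "V \<subseteq> V'" and \<beta>: "\<beta> \<in> V'" "\<beta> \<notin> V"
    and closed: "\<And>(k::nat) \<alpha> c w. (\<forall>i<k. \<alpha> i \<in> V) \<Longrightarrow> (\<forall>j<n. w j = (\<Sum>i<k. c i * \<alpha> i j)) \<Longrightarrow> w \<in> V"
  shows "cov_rank n V < cov_rank n V'"
proof -
  let ?k = "cov_rank n V"
  obtain \<alpha> where \<alpha>: "\<forall>i<?k. \<alpha> i \<in> V" "\<forall>c. (\<forall>j<n. (\<Sum>i<?k. c i * \<alpha> i j) = 0) \<longrightarrow> (\<forall>i<?k. c i = (0::real))"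
    using indep_cov_rank[of n V] unfolding indep_cov_def by blast
  define \<alpha>' where "\<alpha>' = \<alpha>(?k := \<beta>)"
  have in': "\<forall>i<Suc ?k. \<alpha>' i \<in> V'" using \<alpha>(1) sub \<beta> by (auto simp: \<alpha>'_def less_Suc_eq)
  have "\<forall>i<Suc ?k. c i = 0" if c: "\<forall>j<n. (\<Sum>i<Suc ?k. c i * \<alpha>' i j) = 0" for c
  proof -
    have sum: "(\<Sum>i<?k. c i * \<alpha> i j) + c ?k * \<beta> j = 0" if "j < n" for j
      using spec[OF c, of j] that by (simp add: \<alpha>'_def)
    have ck: "c ?k = 0"
    proof (rule ccontr)
      assume nz: "c ?k \<noteq> 0"
      have "\<beta> j = (\<Sum>i<?k. (- c i / c ?k) * \<alpha> i j)" if "j < n" for j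
      proof -
        have "(\<Sum>i<?k. (- c i / c ?k) * \<alpha> i j) = - (\<Sum>i<?k. c i * \<alpha> i j) / c ?k"
          by (simp add: sum_divide_distrib sum_negf[symmetric])
        moreover have "(\<Sum>i<?k. c i * \<alpha> i j) = - (c ?k * \<beta> j)" using sum[OF that] by linarith
        ultimately show ?thesis using nz by simp
      qed
      then have "\<forall>j<n. \<beta> j = (\<Sum>i<?k. (- c i / c ?k) * \<alpha> i j)" by (intro allI impI)
      from closed[OF \<alpha>(1) this] have "\<beta> \<in> V" .
      then show False using \<beta> by blast
    qed
    have "\<forall>j<n. (\<Sum>i<?k. c i * \<alpha> i j) = 0" using sum ck by simp
    then have "\<forall>i<?k. c i = 0" using \<alpha>(2) by blast
    then show ?thesis using ck by (auto simp: less_Suc_eq)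
  qed
  then have "indep_cov n V' (Suc ?k)" using in' unfolding indep_cov_def by blast
  then have "Suc ?k \<le> cov_rank n V'" by (rule cov_rank_ge)
  then show ?thesis by simp
qed

text \<open>K acts on covectors from the right, as a row times a matrix; an injective linear map
  preserves independence.\<close>

lemma cov_rank_le_linear:
  assumes K: "\<And>\<alpha>. \<alpha> \<in> V \<Longrightarrow> (\<lambda>j. \<Sum>i<n. \<alpha> i * K i j) \<in> V'"
    and inj: "\<And>\<beta>. (\<forall>j<n. (\<Sum>i<n. \<beta> i * K i j) = 0) \<Longrightarrow> (\<forall>i<n. \<beta> i = (0::real))"
  shows "cov_rank n V \<le> cov_rank n V'"
proof -
  let ?k = "cov_rank n V"
  obtain \<alpha> where \<alpha>: "\<forall>i<?k. \<alpha> i \<in> V" "\<forall>c. (\<forall>j<n. (\<Sum>i<?k. c i * \<alpha> i j) = 0) \<longrightarrow> (\<forall>i<?k. c i = (0::real))"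
    using indep_cov_rank[of n V] unfolding indep_cov_def by blast
  define \<alpha>' where "\<alpha>' l = (\<lambda>j. \<Sum>i<n. \<alpha> l i * K i j)" for l
  have in': "\<forall>i<?k. \<alpha>' i \<in> V'" using \<alpha>(1) K by (simp add: \<alpha>'_def)
  have "\<forall>i<?k. c i = 0" if c: "\<forall>j<n. (\<Sum>l<?k. c l * \<alpha>' l j) = 0" for c
  proof -
    have "(\<Sum>i<n. (\<Sum>l<?k. c l * \<alpha> l i) * K i j) = (\<Sum>l<?k. c l * \<alpha>' l j)" for j
      unfolding \<alpha>'_def sum_distrib_left sum_distrib_right by (subst sum.swap) (simp add: mult.assoc)
    then have "\<forall>j<n. (\<Sum>i<n. (\<Sum>l<?k. c l * \<alpha> l i) * K i j) = 0" using c by simp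
    from inj[OF this] show ?thesis using \<alpha>(2) by blast
  qed
  then have "indep_cov n V' ?k" using in' unfolding indep_cov_def by blast
  then show ?thesis by (rule cov_rank_ge)
qed

section \<open>Invariant covectors at a point of a chart\<close>

context orbi_chart
begin

text \<open>The fixed vectors of the dual of the isotropy representation at u.\<close>

definition inv_cov :: "(nat \<Rightarrow> real) \<Rightarrow> (nat \<Rightarrow> real) set" where
  "inv_cov u = {\<alpha>. \<forall>g\<in>stab u. \<forall>v\<in>Rn n. (\<Sum>i<n. \<alpha> i * jac n g u v i) = (\<Sum>i<n. \<alpha> i * v i)}"

text \<open>For a bump supported in O', only group elements that fix u contribute at u. A whole
  neighbourhood P of \<open>g u\<close> misses O', so that the other terms have vanishing
  derivatives at u too.\<close>

lemma isolating_neighbourhood: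
  assumes u: "u \<in> U"
  shows "\<exists>O'. eopen n O' \<and> u \<in> O' \<and> O' \<subseteq> U \<and>
    (\<forall>g\<in>\<Gamma>. g \<notin> stab u \<longrightarrow> (\<exists>P. eopen n P \<and> g u \<in> P \<and> P \<inter> O' = {}))"
proof -
  have "\<exists>r>0. cube n (g u) r \<inter> cube n u r = {}" if g: "g \<in> \<Gamma>" "g \<notin> stab u" for g
  proof -
    have "g u \<noteq> u" using g by (simp add: stab_iff)
    then obtain i where i: "i < n" "g u i \<noteq> u i"
      using Rn_eqI[of "g u" n u] U_Rn mem[OF g(1) u] u by blast
    \<comment> \<open>Half the gap in a coordinate i that distinguishes \<open>g u\<close> from u
      separates the two cubes.\<close>
    have "cube n (g u) (\<bar>g u i - u i\<bar> / 2) \<inter> cube n u (\<bar>g u i - u i\<bar> / 2) = {}"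
    proof (rule ccontr)
      assume "\<not> ?thesis"
      then obtain x where "\<bar>x i - g u i\<bar> < \<bar>g u i - u i\<bar> / 2" "\<bar>x i - u i\<bar> < \<bar>g u i - u i\<bar> / 2"
        using i(1) by (auto simp: cube_def)
      then show False by (auto simp: abs_real_def split: if_splits)
    qed
    moreover have "\<bar>g u i - u i\<bar> / 2 > 0" using i by simp
    ultimately show ?thesis by blast
  qed
  then obtain r where r: "\<And>g. g \<in> \<Gamma> - stab u \<Longrightarrow> r g > 0"
    "\<And>g. g \<in> \<Gamma> - stab u \<Longrightarrow> cube n (g u) (r g) \<inter> cube n u (r g) = {}"
    by (metis DiffE)
  define r' where "r' = Min (insert 1 (r ` (\<Gamma> - stab u)))"
  have r': "r' > 0" "\<And>g. g \<in> \<Gamma> - stab u \<Longrightarrow> r' \<le> r g" using r(1) finite by (auto simp: r'_def)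
  define O' where "O' = cube n u r' \<inter> U"
  have "eopen n O'" unfolding O'_def using openin_cube open_U by blast
  moreover have "u \<in> O'" using u U_Rn r'(1) cube_self by (auto simp: O'_def)
  moreover have "eopen n (cube n (g u) r') \<and> g u \<in> cube n (g u) r' \<and> cube n (g u) r' \<inter> O' = {}"
    if g: "g \<in> \<Gamma>" "g \<notin> stab u" for g
  proof -
    have g': "g \<in> \<Gamma> - stab u" using g by simp
    have "cube n (g u) r' \<subseteq> cube n (g u) (r g)" "O' \<subseteq> cube n u (r g)"
      using cube_mono[OF r'(2)[OF g']] by (auto simp: O'_def)
    then show ?thesis using r(2)[OF g'] openin_cube cube_self[OF U_Rn[OF mem[OF g(1) u]] r'(1)] by blast
  qed
  moreover have "O' \<subseteq> U" by (auto simp: O'_def)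
  ultimately show ?thesis by blast
qed

text \<open>Differentiate the identity f (g x) = f x at the fixed point u of g.\<close>

lemma invariant_function_differential:
  assumes u: "u \<in> U" and f: "smooth_on n U f" and inv: "\<And>g x. g \<in> \<Gamma> \<Longrightarrow> x \<in> U \<Longrightarrow> f (g x) = f x"
  shows "(\<lambda>i. partial_deriv i f u) \<in> inv_cov u"
  unfolding inv_cov_def
proof (intro CollectI ballI)
  fix g v assume g: "g \<in> stab u" and "v \<in> Rn n"
  then have g': "g \<in> \<Gamma>" "g u = u" by (simp_all add: stab_iff)
  have "(\<Sum>i<n. partial_deriv i (\<lambda>y. f (g y)) u * v i) = (\<Sum>i<n. partial_deriv i f (g u) * jac n g u v i)"
    by (rule partial_deriv_jac[OF open_U open_U smooth_g[OF g'(1)] smooth_onD[OF f] u])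
  moreover have "partial_deriv i (\<lambda>y. f (g y)) u = partial_deriv i f u" if "i < n" for i
    by (rule partial_deriv_cong(1)[OF open_U u that inv[OF g'(1)]])
  ultimately show "(\<Sum>i<n. partial_deriv i f u * jac n g u v i) = (\<Sum>i<n. partial_deriv i f u * v i)"
    using g'(2) by simp
qed

end

section \<open>Differentials of smooth functions on the orbifold\<close>

context orbifold_space
begin

text \<open>If g dominates, then in the chart both g and g - f have a local minimum at u, so both
  differentials vanish there. Conversely the quadratic bound is dominated by an averaged, cut off
  and rescaled squared distance to u.\<close>

lemma critical_at_iff:
  assumes c: "(U, \<Gamma>, \<phi>) \<in> A" and u: "u \<in> U" and f: "f \<in> F"
  shows "critical_at X F f (\<phi> u) \<longleftrightarrow> (\<forall>i<n. partial_deriv i (\<lambda>x. f (\<phi> x)) u = 0)"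
proof -
  interpret c: orbi_chart n X U \<Gamma> \<phi> by (rule orbi_chart[OF c])
  have uR: "u \<in> Rn n" using c.U_Rn u by blast
  let ?k = "\<lambda>x. f (\<phi> x)"
  have k: "smooth_on n U ?k" by (rule smooth_phi[OF c f])
  show ?thesis
  proof
    assume "critical_at X F f (\<phi> u)"
    then obtain g N where g: "g \<in> F" "openin X N" "\<phi> u \<in> N" "g (\<phi> u) = 0" "\<forall>y\<in>N. \<bar>f y - f (\<phi> u)\<bar> \<le> g y"
      unfolding critical_at_def by blast
    let ?h = "\<lambda>x. g (\<phi> x)"
    have h: "smooth_on n U ?h" by (rule smooth_phi[OF c g(1)])
    have "eopen n {x \<in> U. \<phi> x \<in> N}" by (rule c.open_preimage_phi[OF g(2)])
    then obtain d where d: "d > 0" "cube n u d \<subseteq> {x \<in> U. \<phi> x \<in> N}"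
      unfolding openin_Rn_iff using u g(3) by blast
    show "\<forall>i<n. partial_deriv i ?k u = 0"
    proof (intro allI impI)
      fix i assume i: "i < n"
      have bd: "\<bar>?k (u(i := t)) - ?k u\<bar> \<le> ?h (u(i := t))" if "\<bar>u i - t\<bar> < d" for t
      proof -
        have "u(i := t) \<in> cube n u d" by (rule cube_upd[OF uR _ i d(1)]) (use that in linarith)
        then show ?thesis using d(2) g(5) by blast
      qed
      have Dh: "DERIV (\<lambda>t. ?h (u(i := t))) (u i) :> partial_deriv i ?h u"
        by (rule partial_deriv_has'[OF smooth_onD[OF h] u i])
      have Dk: "DERIV (\<lambda>t. ?k (u(i := t))) (u i) :> partial_deriv i ?k u"
        by (rule partial_deriv_has'[OF smooth_onD[OF k] u i])
      have "partial_deriv i ?h u = 0"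
      proof (rule DERIV_local_min[OF Dh d(1)], intro allI impI)
        fix t assume "\<bar>u i - t\<bar> < d"
        from bd[OF this] show "?h (u(i := u i)) \<le> ?h (u(i := t))" using g(4) by simp
      qed
      moreover have "partial_deriv i ?h u - partial_deriv i ?k u = 0"
      proof (rule DERIV_local_min[OF DERIV_diff[OF Dh Dk] d(1)], intro allI impI)
        fix t assume "\<bar>u i - t\<bar> < d"
        from bd[OF this] show "?h (u(i := u i)) - ?k (u(i := u i)) \<le> ?h (u(i := t)) - ?k (u(i := t))"
          using g(4) by simp
      qed
      ultimately show "partial_deriv i ?k u = 0" by simp
    qed
  next
    assume crit: "\<forall>i<n. partial_deriv i ?k u = 0"
    obtain C d where d: "0 < d" "cube n u d \<subseteq> U" "\<forall>y\<in>cube n u d. \<bar>?k y - ?k u\<bar> \<le> C * (\<Sum>i<n. \<bar>y i - u i\<bar>)\<^sup>2"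
      using quadratic_bound_at_critical_point[OF c.open_U k u] crit by blast
    define a where "a x = (\<Sum>i<n. (x i - u i)\<^sup>2)" for x
    have a0: "0 \<le> a x" for x unfolding a_def by (intro sum_nonneg) auto
    obtain O' where O': "eopen n O'" "u \<in> O'" "O' \<subseteq> U"
      "\<forall>g\<in>\<Gamma>. g \<notin> c.stab u \<longrightarrow> (\<exists>P. eopen n P \<and> g u \<in> P \<and> P \<inter> O' = {})"
      using c.isolating_neighbourhood[OF u] by blast
    obtain b where b: "smooth_on n U b" "0 < b u" "\<forall>x\<in>U. 0 \<le> b x" "\<forall>x\<in>U. x \<notin> O' \<longrightarrow> b x = 0"
      "\<forall>a. smooth_on n U a \<longrightarrow> (\<exists>f\<in>F. (\<forall>x\<in>U. f (\<phi> x) = (\<Sum>g\<in>\<Gamma>. a (g x) * b (g x))) \<and> (\<forall>y. y \<notin> \<phi> ` O' \<longrightarrow> f y = 0))"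
      using invariant_bump[OF c u O'(1,2,3)] by blast
    \<comment> \<open>Cauchy-Schwarz bounds the square of the l1 norm by n times \<open>a x\<close>,
      and b \<ge> b u / 2 near u costs the factor 2 / b u.\<close>
    define M where "M = \<bar>C\<bar> * n * 2 / b u"
    have M0: "0 \<le> M" using b(2) by (simp add: M_def)
    have "smooth_on n U (\<lambda>x. M * a x)"
      unfolding smooth_on_def a_def power2_eq_square
      by (intro allI Ck_on_mult[OF c.open_U] Ck_on_diff[OF c.open_U] Ck_on_coord[OF c.open_U] Ck_on_const[OF c.open_U] Ck_on_sum[OF c.open_U])
    then obtain h where h: "h \<in> F" "\<forall>x\<in>U. h (\<phi> x) = (\<Sum>g\<in>\<Gamma>. M * a (g x) * b (g x))" using b(5) by blast
    \<comment> \<open>The dominating function must vanish at u: a group element fixing u makes the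
      factor a zero, any other one the factor b.\<close>
    have "M * a (g u) * b (g u) = 0" if g: "g \<in> \<Gamma>" for g
    proof (cases "g \<in> c.stab u")
      case True
      then show ?thesis by (simp add: c.stab_iff a_def)
    next
      case False
      then have "g u \<notin> O'" using O'(4) g by blast
      then show ?thesis using b(4) c.mem[OF g u] by simp
    qed
    then have "(\<Sum>g\<in>\<Gamma>. M * a (g u) * b (g u)) = 0" by (intro sum.neutral ballI)
    then have hu: "h (\<phi> u) = 0" using bspec[OF h(2) u] by simp
    have "0 < b u / 2" using b(2) by simp
    then obtain d2 where d2: "d2 > 0" "\<forall>y\<in>cube n u d2. y \<in> U \<and> \<bar>b y - b u\<bar> < b u / 2"
      using smooth_on_continuous[OF b(1)] u unfolding continuous_map_cube_iff[OF c.open_U] by blast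
    define N where "N = \<phi> ` (cube n u d \<inter> cube n u d2)"
    have "openin X N" unfolding N_def using d(2) openin_cube by (intro c.open_phi openin_Int) auto
    moreover have "\<phi> u \<in> N" using cube_self[OF uR] d(1) d2(1) by (auto simp: N_def)
    moreover have "\<bar>f y - f (\<phi> u)\<bar> \<le> h y" if yN: "y \<in> N" for y
    proof -
      obtain x where x: "x \<in> cube n u d" "x \<in> cube n u d2" "y = \<phi> x" using yN unfolding N_def by blast
      have xU: "x \<in> U" using x(1) d(2) by blast
      have one: "c.gid \<in> \<Gamma>" using c.G.one_closed by simp
      have bx: "b u / 2 \<le> b x" using bspec[OF d2(2) x(2)] by linarith
      have "\<bar>f y - f (\<phi> u)\<bar> \<le> C * (\<Sum>i<n. \<bar>x i - u i\<bar>)\<^sup>2" using d(3) x by blast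
      also have "\<dots> \<le> \<bar>C\<bar> * (\<Sum>i<n. \<bar>x i - u i\<bar>)\<^sup>2" by (intro mult_right_mono) auto
      also have "\<dots> \<le> \<bar>C\<bar> * (a x * n)"
        using sum_squared_le_sum_of_squares[of "\<lambda>i. \<bar>x i - u i\<bar>" "{..<n}"]
        by (intro mult_left_mono) (simp_all add: a_def)
      also have "\<dots> = M * a x * (b u / 2)" using b(2) by (simp add: M_def)
      also have "\<dots> \<le> M * a x * b x" using bx M0 a0 by (intro mult_left_mono mult_nonneg_nonneg) auto
      also have "\<dots> = M * a (c.gid x) * b (c.gid x)" using c.one_apply[OF xU] by simp
      also have "\<dots> \<le> (\<Sum>g\<in>\<Gamma>. M * a (g x) * b (g x))"
        using one M0 a0 b(3) c.mem[OF _ xU] by (intro member_le_sum c.finite mult_nonneg_nonneg) auto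
      also have "\<dots> = h y" using h(2) xU x(3) by simp
      finally show ?thesis .
    qed
    ultimately show "critical_at X F f (\<phi> u)" unfolding critical_at_def using h(1) hu by blast
  qed
qed

lemma differential_in_inv_cov:
  assumes c: "(U, \<Gamma>, \<phi>) \<in> A" and u: "u \<in> U" and f: "f \<in> F"
  shows "(\<lambda>i. partial_deriv i (\<lambda>x. f (\<phi> x)) u) \<in> orbi_chart.inv_cov n U \<Gamma> u"
proof -
  interpret c: orbi_chart n X U \<Gamma> \<phi> by (rule orbi_chart[OF c])
  show ?thesis
    by (rule c.invariant_function_differential[OF u smooth_phi[OF c f]]) (simp add: c.phi_inv)
qed

text \<open>Average the product of a linear function a with differential \<alpha> / m and a bump b.
  Since \<alpha> is invariant, each element of the stabiliser contributes b u times \<alpha> / m to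
  the differential at u; the others contribute nothing near u.\<close>

lemma cotangent_lift:
  assumes c: "(U, \<Gamma>, \<phi>) \<in> A" and u: "u \<in> U" and \<alpha>: "\<alpha> \<in> orbi_chart.inv_cov n U \<Gamma> u"
  shows "\<exists>f\<in>F. \<forall>i<n. partial_deriv i (\<lambda>x. f (\<phi> x)) u = \<alpha> i"
proof -
  interpret c: orbi_chart n X U \<Gamma> \<phi> by (rule orbi_chart[OF c])
  obtain O' where O': "eopen n O'" "u \<in> O'" "O' \<subseteq> U"
    "\<forall>g\<in>\<Gamma>. g \<notin> c.stab u \<longrightarrow> (\<exists>P. eopen n P \<and> g u \<in> P \<and> P \<inter> O' = {})"
    using c.isolating_neighbourhood[OF u] by blast
  obtain b where b: "smooth_on n U b" "0 < b u" "\<forall>x\<in>U. x \<notin> O' \<longrightarrow> b x = 0"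
    "\<forall>a. smooth_on n U a \<longrightarrow> (\<exists>f\<in>F. (\<forall>x\<in>U. f (\<phi> x) = (\<Sum>g\<in>\<Gamma>. a (g x) * b (g x))) \<and> (\<forall>y. y \<notin> \<phi> ` O' \<longrightarrow> f y = 0))"
    using invariant_bump[OF c u O'(1,2,3)] by blast
  \<comment> \<open>The normalisation: one contribution b u from each element of the
    stabiliser.\<close>
  define m where "m = real (card (c.stab u)) * b u"
  have fin: "finite (c.stab u)" by (rule finite_subset[OF c.stab_subset c.finite])
  have "c.gid \<in> c.stab u" using c.G.one_closed by (simp add: c.stab_iff c.one_apply[OF u])
  then have m: "m \<noteq> 0" using b(2) fin by (auto simp: m_def card_eq_0_iff)
  define a where "a x = (\<Sum>i<n. \<alpha> i / m * (x i - u i))" for x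
  have a: "smooth_on n U a"
    unfolding smooth_on_def a_def
    by (intro allI Ck_on_mult[OF c.open_U] Ck_on_diff[OF c.open_U] Ck_on_coord[OF c.open_U] Ck_on_const[OF c.open_U] Ck_on_sum[OF c.open_U])
  obtain f where f: "f \<in> F" "\<forall>x\<in>U. f (\<phi> x) = (\<Sum>g\<in>\<Gamma>. a (g x) * b (g x))" using b(4) a by blast
  have da: "partial_deriv j a x = \<alpha> j / m" if j: "j < n" for j x
  proof -
    have "((\<lambda>t. a (x(j := t))) has_field_derivative (\<Sum>i<n. \<alpha> i / m * (if i = j then 1 else 0))) (at (x j))"
      unfolding a_def
    proof (rule DERIV_sum)
      fix i
      show "((\<lambda>t. \<alpha> i / m * ((x(j := t)) i - u i)) has_field_derivative \<alpha> i / m * (if i = j then 1 else 0)) (at (x j))"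
        by (cases "i = j") (auto intro!: derivative_eq_intros simp: m)
    qed
    then have "partial_deriv j a x = (\<Sum>i<n. \<alpha> i / m * (if i = j then 1 else 0))"
      unfolding partial_deriv_def by (rule DERIV_imp_deriv)
    also have "\<dots> = \<alpha> j / m" using j by (simp add: if_distrib cong: if_cong)
    finally show ?thesis .
  qed
  have "partial_deriv i (\<lambda>x. f (\<phi> x)) u = \<alpha> i" if i: "i < n" for i
  proof -
    \<comment> \<open>The i-th basis vector, so that the chain rule for \<open>jac\<close> and the
      invariance of \<alpha> give the i-th partial derivative.\<close>
    define e where "e = (\<lambda>k. if k = i then 1 else 0 :: real)"
    have eR: "e \<in> Rn n" using i by (simp add: e_def topspace_Euclidean_space)
    have summand: "((\<lambda>s. a (g (u(i := s))) * b (g (u(i := s)))) has_field_derivative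
        (if g \<in> c.stab u then \<alpha> i / m * b u else 0)) (at (u i))" if g: "g \<in> \<Gamma>" for g
    proof (cases "g \<in> c.stab u")
      case True
      then have gu: "g u = u" by (simp add: c.stab_iff)
      have "smooth_on n U (\<lambda>x. a (g x))" "smooth_on n U (\<lambda>x. b (g x))"
        using smooth_on_compose[OF c.open_U c.open_U c.smooth_g[OF g]] a b(1) by blast+
      from DERIV_mult[OF partial_deriv_has'[OF smooth_onD[OF this(1)] u i] partial_deriv_has'[OF smooth_onD[OF this(2)] u i]]
      have D: "((\<lambda>s. a (g (u(i := s))) * b (g (u(i := s)))) has_field_derivative
          partial_deriv i (\<lambda>x. a (g x)) u * b u + partial_deriv i (\<lambda>x. b (g x)) u * a u) (at (u i))"
        unfolding fun_upd_triv gu .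
      have "partial_deriv i (\<lambda>x. a (g x)) u = (\<Sum>k<n. partial_deriv k (\<lambda>x. a (g x)) u * e k)"
        using i by (simp add: e_def if_distrib cong: if_cong)
      also have "\<dots> = (\<Sum>k<n. partial_deriv k a (g u) * jac n g u e k)"
        by (rule partial_deriv_jac[OF c.open_U c.open_U c.smooth_g[OF g] smooth_onD[OF a] u])
      also have "\<dots> = (\<Sum>k<n. \<alpha> k * jac n g u e k) / m"
        using da by (simp add: sum_divide_distrib)
      also have "\<dots> = (\<Sum>k<n. \<alpha> k * e k) / m"
        using \<alpha> True eR unfolding c.inv_cov_def by simp
      also have "(\<Sum>k<n. \<alpha> k * e k) = \<alpha> i"
        using i by (simp add: e_def if_distrib cong: if_cong)
      finally have "partial_deriv i (\<lambda>x. a (g x)) u = \<alpha> i / m" .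
      moreover have "a u = 0" by (simp add: a_def)
      ultimately show ?thesis using D True by simp
    next
      case False
      then obtain P where P: "eopen n P" "g u \<in> P" "P \<inter> O' = {}" using O'(4) g by blast
      have "\<forall>\<^sub>F s in nhds (u i). u(i := s) \<in> {x \<in> U. g x \<in> P}"
        by (rule eventually_upd_in[OF c.open_preimage_g[OF g P(1)] _ i]) (use u P in simp)
      then have "\<forall>\<^sub>F s in nhds (u i). a (g (u(i := s))) * b (g (u(i := s))) = 0"
      proof eventually_elim
        case (elim s)
        then have "g (u(i := s)) \<in> U" "g (u(i := s)) \<notin> O'" using c.mem[OF g] P(3) by auto
        then show ?case using b(3) by simp
      qed
      then have "((\<lambda>s. a (g (u(i := s))) * b (g (u(i := s)))) has_field_derivative 0) (at (u i))
          \<longleftrightarrow> ((\<lambda>s. 0) has_field_derivative 0) (at (u i))"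
        by (intro DERIV_cong_ev refl)
      then show ?thesis using False by simp
    qed
    have "((\<lambda>s. \<Sum>g\<in>\<Gamma>. a (g (u(i := s))) * b (g (u(i := s)))) has_field_derivative
        (\<Sum>g\<in>\<Gamma>. if g \<in> c.stab u then \<alpha> i / m * b u else 0)) (at (u i))"
      by (rule DERIV_sum[OF summand])
    also have "(\<Sum>g\<in>\<Gamma>. if g \<in> c.stab u then \<alpha> i / m * b u else 0) = (\<Sum>g\<in>c.stab u. \<alpha> i / m * b u)"
      using c.finite c.stab_subset[of u] by (simp add: sum.If_cases Int_absorb1)
    also have "\<dots> = \<alpha> i" using m by (simp add: m_def)
    finally have "partial_deriv i (\<lambda>x. \<Sum>g\<in>\<Gamma>. a (g x) * b (g x)) u = \<alpha> i"
      unfolding partial_deriv_def by (rule DERIV_imp_deriv)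
    moreover have "partial_deriv i (\<lambda>x. f (\<phi> x)) u = partial_deriv i (\<lambda>x. \<Sum>g\<in>\<Gamma>. a (g x) * b (g x)) u"
      by (rule partial_deriv_cong(1)[OF c.open_U u i]) (use f(2) in blast)
    ultimately show ?thesis by simp
  qed
  then show ?thesis using f(1) by blast
qed

lemma partial_deriv_lincomb:
  assumes c: "(U, \<Gamma>, \<phi>) \<in> A" and u: "u \<in> U" and fs: "\<And>j. j < k \<Longrightarrow> fs j \<in> F" and i: "i < n"
  shows "partial_deriv i (\<lambda>x. \<Sum>j<k. c j * fs j (\<phi> x)) u = (\<Sum>j<k. c j * partial_deriv i (\<lambda>x. fs j (\<phi> x)) u)"
proof -
  have "((\<lambda>s. \<Sum>j<k. c j * fs j (\<phi> (u(i := s)))) has_field_derivative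
      (\<Sum>j<k. c j * partial_deriv i (\<lambda>x. fs j (\<phi> x)) u)) (at (u i))"
  proof (rule DERIV_sum, rule DERIV_cmult)
    fix j assume "j \<in> {..<k}"
    then have "fs j \<in> F" using fs by simp
    from partial_deriv_has'[OF smooth_onD[OF smooth_phi[OF c this]] u i]
    show "((\<lambda>s. fs j (\<phi> (u(i := s)))) has_field_derivative partial_deriv i (\<lambda>x. fs j (\<phi> x)) u) (at (u i))" .
  qed
  then show ?thesis unfolding partial_deriv_def[of i "\<lambda>x. \<Sum>j<k. c j * fs j (\<phi> x)"] by (rule DERIV_imp_deriv)
qed

text \<open>Taking differentials at u has the critical functions as kernel, lands in the invariant
  covectors, and by \<open>cotangent_lift\<close> reaches each of them up to coefficients from index
  n on. Independence modulo critical functions is thus independence of covectors.\<close>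

lemma indep_at_iff:
  assumes c: "(U, \<Gamma>, \<phi>) \<in> A" and u: "u \<in> U"
  shows "indep_at X F (\<phi> u) k \<longleftrightarrow> indep_cov n (orbi_chart.inv_cov n U \<Gamma> u) k"
proof
  assume "indep_at X F (\<phi> u) k"
  then obtain fs where fs: "\<forall>i<k. fs i \<in> F"
    "\<forall>c. critical_at X F (\<lambda>y. \<Sum>i<k. c i * fs i y) (\<phi> u) \<longrightarrow> (\<forall>i<k. c i = (0::real))"
    unfolding indep_at_def by blast
  define \<alpha> where "\<alpha> j = (\<lambda>i. partial_deriv i (\<lambda>x. fs j (\<phi> x)) u)" for j
  have "\<forall>i<k. \<alpha> i \<in> orbi_chart.inv_cov n U \<Gamma> u"
    unfolding \<alpha>_def using differential_in_inv_cov[OF c u] fs(1) by blast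
  moreover have "\<forall>i<k. a i = 0" if a: "\<forall>j<n. (\<Sum>i<k. a i * \<alpha> i j) = 0" for a
  proof -
    have "partial_deriv i (\<lambda>x. \<Sum>j<k. a j * fs j (\<phi> x)) u = 0" if i: "i < n" for i
      using partial_deriv_lincomb[OF c u _ i, of k fs a] fs(1) a i by (simp add: \<alpha>_def)
    moreover have "(\<lambda>y. \<Sum>i<k. a i * fs i y) \<in> F" using smooth_functions_lincomb fs(1) by blast
    ultimately have "critical_at X F (\<lambda>y. \<Sum>i<k. a i * fs i y) (\<phi> u)"
      using critical_at_iff[OF c u] by blast
    then show ?thesis using fs(2) by blast
  qed
  ultimately show "indep_cov n (orbi_chart.inv_cov n U \<Gamma> u) k" unfolding indep_cov_def by blast
next
  assume "indep_cov n (orbi_chart.inv_cov n U \<Gamma> u) k"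
  then obtain \<alpha> where \<alpha>: "\<forall>i<k. \<alpha> i \<in> orbi_chart.inv_cov n U \<Gamma> u"
    "\<forall>c. (\<forall>j<n. (\<Sum>i<k. c i * \<alpha> i j) = 0) \<longrightarrow> (\<forall>i<k. c i = (0::real))"
    unfolding indep_cov_def by blast
  have "\<forall>j\<in>{..<k}. \<exists>f. f \<in> F \<and> (\<forall>i<n. partial_deriv i (\<lambda>x. f (\<phi> x)) u = \<alpha> j i)"
    using cotangent_lift[OF c u] \<alpha>(1) by (meson lessThan_iff)
  then obtain fs where fs: "\<forall>j\<in>{..<k}. fs j \<in> F \<and> (\<forall>i<n. partial_deriv i (\<lambda>x. fs j (\<phi> x)) u = \<alpha> j i)"
    by (elim bchoice[THEN exE])
  have "\<forall>i<k. a i = 0" if a: "critical_at X F (\<lambda>y. \<Sum>i<k. a i * fs i y) (\<phi> u)" for a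
  proof -
    have "(\<lambda>y. \<Sum>i<k. a i * fs i y) \<in> F" using smooth_functions_lincomb fs by blast
    then have p: "\<forall>i<n. partial_deriv i (\<lambda>x. \<Sum>j<k. a j * fs j (\<phi> x)) u = 0"
      using critical_at_iff[OF c u] a by blast
    have "(\<Sum>j<k. a j * \<alpha> j i) = 0" if i: "i < n" for i
      using partial_deriv_lincomb[OF c u _ i, of k fs a] fs p i by simp
    then show ?thesis using \<alpha>(2) by blast
  qed
  then show "indep_at X F (\<phi> u) k" unfolding indep_at_def using fs by blast
qed

lemma stratum_dim_eq:
  assumes "(U, \<Gamma>, \<phi>) \<in> A" "u \<in> U"
  shows "stratum_dim X F (\<phi> u) = cov_rank n (orbi_chart.inv_cov n U \<Gamma> u)"
  unfolding stratum_dim_def cov_rank_def indep_at_iff[OF assms] ..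

end

section \<open>Linearisation of a chart at a point\<close>

lemma jac_scale: "jac n F x (\<lambda>i. c * v i) j = c * jac n F x v j"
  by (simp add: jac_def sum_distrib_left mult_ac)

lemma jac_add: "jac n F x (\<lambda>i. v i + w i) j = jac n F x v j + jac n F x w j"
  by (simp add: jac_def sum.distrib distrib_left)

lemma jac_sum: "jac n F x (\<lambda>i. \<Sum>s\<in>S. f s i) j = (\<Sum>s\<in>S. jac n F x (f s) j)"
  unfolding jac_def sum_distrib_left by (rule sum.swap)

lemma jac_zero: "jac n F x (\<lambda>_. 0) = (\<lambda>_. 0)"
  by (simp add: jac_def)

lemma jac_cov: "(\<Sum>i<n. \<beta> i * jac n F x v i) = (\<Sum>j<n. (\<Sum>i<n. \<beta> i * partial_deriv j (\<lambda>y. F y i) x) * v j)"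
  unfolding jac_def sum_distrib_left sum_distrib_right by (subst sum.swap) (simp add: mult.assoc)

context orbi_chart
begin

lemma jac_one:
  assumes "u \<in> U" "v \<in> Rn n" shows "jac n gid u v = v"
proof (rule Rn_eqI[of _ n])
  have one: "gid \<in> \<Gamma>" using G.one_closed by simp
  show "jac n gid u v \<in> Rn n" by (rule jac_in_Rn[OF open_U U_Rn[OF mem[OF one]] assms(1)])
  show "v \<in> Rn n" by fact
  fix j assume j: "j < n"
  have "partial_deriv i (\<lambda>y. gid y j) u = (if i = j then 1 else 0)" if i: "i < n" for i
  proof -
    have "((\<lambda>s. (u(i := s)) j) has_field_derivative (if i = j then 1 else 0)) (at (u i))"
      by (cases "i = j") auto
    then have "partial_deriv i (\<lambda>y. y j) u = (if i = j then 1 else 0)"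
      unfolding partial_deriv_def by (rule DERIV_imp_deriv)
    moreover have "partial_deriv i (\<lambda>y. gid y j) u = partial_deriv i (\<lambda>y. y j) u"
      by (rule partial_deriv_cong(1)[OF open_U assms(1) i]) (simp add: one_apply)
    ultimately show ?thesis by simp
  qed
  then have "jac n gid u v j = (\<Sum>i<n. (if i = j then 1 else 0) * v i)"
    unfolding jac_def by (intro sum.cong) auto
  then show "jac n gid u v j = v j" using j by (simp add: if_distrib[of "\<lambda>z. z * _"] cong: if_cong)
qed

text \<open>Bochner's linearisation: averaging conjugates the stabiliser of \<open>u\<close> to its linear part at \<open>u\<close>.\<close>

definition lin :: "(nat \<Rightarrow> real) \<Rightarrow> (nat \<Rightarrow> real) \<Rightarrow> (nat \<Rightarrow> real)" where
  "lin u x = (\<lambda>j. \<Sum>g\<in>stab u. jac n (ginv g) u (\<lambda>i. g x i - u i) j)"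

lemma lin_self: "lin u u = (\<lambda>_. 0)"
  unfolding lin_def by (rule ext, rule sum.neutral) (simp add: stab_iff jac_zero)

lemma stab_one: "u \<in> U \<Longrightarrow> gid \<in> stab u"
  using G.one_closed by (simp add: stab_iff one_apply)

lemma stab_inv: "u \<in> U \<Longrightarrow> g \<in> stab u \<Longrightarrow> ginv g \<in> stab u"
  using subgroup.m_inv_closed[OF stab_subgroup] .

lemma stab_mult: "u \<in> U \<Longrightarrow> g \<in> stab u \<Longrightarrow> h \<in> stab u \<Longrightarrow> g \<cdot> h \<in> stab u"
  using subgroup.m_closed[OF stab_subgroup] .

lemma finite_stab: "finite (stab u)"
  by (rule finite_subset[OF stab_subset finite])

lemma card_stab: "u \<in> U \<Longrightarrow> 0 < card (stab u)"
  using stab_one finite_stab by (auto simp: card_gt_0_iff)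

lemma jac_stab_mult:
  assumes "u \<in> U" "g \<in> stab u" "h \<in> stab u"
  shows "jac n (g \<cdot> h) u v = jac n g u (jac n h u v)"
  using jac_mult[of g h u v] assms by (simp add: stab_iff)

lemma jac_stab_Rn: "u \<in> U \<Longrightarrow> g \<in> stab u \<Longrightarrow> jac n g u v \<in> Rn n"
  by (rule jac_in_Rn[OF open_U]) (auto simp: stab_iff intro: U_Rn mem)

lemma lin_Rn:
  assumes u: "u \<in> U" shows "lin u x \<in> Rn n"
proof -
  have "jac n (ginv g) u v j = 0" if "g \<in> stab u" "n \<le> j" for g v j
    using jac_stab_Rn[OF u stab_inv[OF u that(1)], of v] that(2) by (simp add: topspace_Euclidean_space)
  then show ?thesis by (simp add: lin_def topspace_Euclidean_space)
qed

text \<open>Substitute g \<cdot> k for g in the sum over the stabiliser, using that k \<cdot> ginv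
  (g \<cdot> k) = ginv g.\<close>

lemma lin_equivariant:
  assumes u: "u \<in> U" and k: "k \<in> stab u" and x: "x \<in> U"
  shows "lin u (k x) = jac n k u (lin u x)"
proof
  fix j
  have k': "k \<in> \<Gamma>" using k by (simp add: stab_iff)
  define f where "f g = jac n (k \<cdot> ginv g) u (\<lambda>i. g x i - u i) j" for g
  have "jac n (ginv g) u (\<lambda>i. g (k x) i - u i) j = f (g \<cdot> k)" if g: "g \<in> stab u" for g
  proof -
    have c: "g \<in> carrier G" "k \<in> carrier G" using g k' by (simp_all add: stab_iff)
    have "k \<cdot> ginv (g \<cdot> k) = (k \<cdot> ginv k) \<cdot> ginv g"
      using c by (simp only: G.inv_mult_group G.m_assoc G.inv_closed)
    also have "\<dots> = ginv g" using c by (simp del: carrier_G)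
    finally show ?thesis using g k' x by (simp add: f_def mult_apply stab_iff)
  qed
  then have "lin u (k x) j = (\<Sum>g\<in>stab u. f (g \<cdot> k))" unfolding lin_def by (intro sum.cong) auto
  also have "\<dots> = (\<Sum>g\<in>stab u. f g)" by (rule stab_sum_right_translate[OF u k])
  also have "\<dots> = (\<Sum>g\<in>stab u. jac n k u (jac n (ginv g) u (\<lambda>i. g x i - u i)) j)"
    unfolding f_def using jac_stab_mult[OF u k stab_inv[OF u]] by (intro sum.cong) auto
  also have "\<dots> = jac n k u (lin u x) j" unfolding lin_def by (rule jac_sum[symmetric])
  finally show "lin u (k x) j = jac n k u (lin u x) j" .
qed

lemma Ck_on_lin:
  assumes u: "u \<in> U" shows "Ck_on n U k (\<lambda>x. lin u x j)"
  unfolding lin_def jac_def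
proof (rule Ck_on_sum[OF open_U], rule Ck_on_sum[OF open_U], rule Ck_on_cmult[OF open_U], rule Ck_on_diff[OF open_U])
  fix g i assume "g \<in> stab u" "i \<in> {..<n}"
  then show "Ck_on n U k (\<lambda>x. g x i)" by (intro smooth_mapD(2)[OF smooth_g]) (auto simp: stab_iff)
  show "Ck_on n U k (\<lambda>x. u i)" using open_U by simp
qed

lemma jac_lin:
  assumes u: "u \<in> U" and x: "x \<in> U"
  shows "jac n (lin u) x v j = (\<Sum>g\<in>stab u. jac n (ginv g) u (jac n g x v) j)"
proof -
  have pd: "partial_deriv i (\<lambda>y. lin u y j) x
      = (\<Sum>g\<in>stab u. jac n (ginv g) u (\<lambda>l. partial_deriv i (\<lambda>y. g y l) x) j)" if i: "i < n" for i
  proof -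
    have "((\<lambda>s. lin u (x(i := s)) j) has_field_derivative
        (\<Sum>g\<in>stab u. jac n (ginv g) u (\<lambda>l. partial_deriv i (\<lambda>y. g y l) x) j)) (at (x i))"
      unfolding lin_def jac_def
    proof (rule DERIV_sum, rule DERIV_sum, rule DERIV_cmult)
      fix g l assume gl: "g \<in> stab u" "l \<in> {..<n}"
      have "((\<lambda>s. g (x(i := s)) l) has_field_derivative partial_deriv i (\<lambda>y. g y l) x) (at (x i))"
        by (rule partial_deriv_has'[OF smooth_mapD(2)[OF smooth_g] x i]) (use gl in \<open>auto simp: stab_iff\<close>)
      from DERIV_diff[OF this DERIV_const]
      show "((\<lambda>s. g (x(i := s)) l - u l) has_field_derivative partial_deriv i (\<lambda>y. g y l) x) (at (x i))"
        by simp
    qed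
    then show ?thesis unfolding partial_deriv_def[of i "\<lambda>y. lin u y j"] by (rule DERIV_imp_deriv)
  qed
  have "jac n (lin u) x v j = (\<Sum>i<n. (\<Sum>g\<in>stab u. jac n (ginv g) u (\<lambda>l. partial_deriv i (\<lambda>y. g y l) x) j) * v i)"
    unfolding jac_def[of n "lin u"] using pd by (intro sum.cong) auto
  also have "\<dots> = (\<Sum>g\<in>stab u. \<Sum>i<n. jac n (ginv g) u (\<lambda>l. v i * partial_deriv i (\<lambda>y. g y l) x) j)"
    unfolding sum_distrib_right jac_scale by (subst sum.swap) (simp add: mult.commute)
  also have "\<dots> = (\<Sum>g\<in>stab u. jac n (ginv g) u (jac n g x v) j)"
    unfolding jac_def[of n _ x] jac_sum[symmetric] by (simp add: mult.commute)
  finally show ?thesis .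
qed

text \<open>At u each summand has the identity as differential. The sum in \<open>lin\<close> is not
  divided by the order of the stabiliser, so a positive multiple of the identity results, which is
  just as good.\<close>

lemma jac_lin_self:
  assumes u: "u \<in> U" and v: "v \<in> Rn n"
  shows "jac n (lin u) u v j = real (card (stab u)) * v j"
proof -
  have "jac n (ginv g) u (jac n g u v) = v" if g: "g \<in> stab u" for g
  proof -
    have "ginv g \<cdot> g = gid" using g by (simp add: stab_iff)
    then show ?thesis using jac_stab_mult[OF u stab_inv[OF u g] g, of v] jac_one[OF u v] by simp
  qed
  then show ?thesis unfolding jac_lin[OF u u] by simp
qed

text \<open>The derivative of \<open>lin_equivariant\<close> at a point w fixed by g: the
  differential of \<open>lin u\<close> at w intertwines the isotropy action at w with the linear
  action at u.\<close>

lemma lin_equivariant_jac: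
  assumes u: "u \<in> U" and w: "w \<in> U" and g: "g \<in> stab u" "g \<in> stab w"
  shows "jac n (lin u) w (jac n g w v) = jac n g u (jac n (lin u) w v)"
proof
  fix j
  have g': "g \<in> \<Gamma>" "g w = w" using g by (simp_all add: stab_iff)
  have "smooth_map n U (Rn n) (lin u)"
    using Ck_on_lin[OF u] lin_Rn[OF u] by (simp add: smooth_map_def smooth_on_def)
  then have "jac n (lin u) w (jac n g w v) j = jac n (\<lambda>y. lin u (g y)) w v j"
    using jac_compose[OF open_U open_U smooth_g[OF g'(1)] _ order.refl w, of "lin u" v] g'(2) by simp
  also have "\<dots> = (\<Sum>i<n. (\<Sum>l<n. partial_deriv l (\<lambda>y. g y j) u * partial_deriv i (\<lambda>y. lin u y l) w) * v i)"
    unfolding jac_def[of n "\<lambda>y. lin u (g y)"]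
  proof (intro sum.cong refl arg_cong2[where f = "(*)"])
    fix i assume "i \<in> {..<n}"
    then have i: "i < n" by simp
    have "((\<lambda>s. jac n g u (lin u (w(i := s))) j) has_field_derivative
        (\<Sum>l<n. partial_deriv l (\<lambda>y. g y j) u * partial_deriv i (\<lambda>y. lin u y l) w)) (at (w i))"
      unfolding jac_def
      by (rule DERIV_sum, rule DERIV_cmult, rule partial_deriv_has'[OF Ck_on_lin[OF u] w i])
    then have *: "partial_deriv i (\<lambda>y. jac n g u (lin u y) j) w
        = (\<Sum>l<n. partial_deriv l (\<lambda>y. g y j) u * partial_deriv i (\<lambda>y. lin u y l) w)"
      unfolding partial_deriv_def[of i "\<lambda>y. jac n g u (lin u y) j"] by (rule DERIV_imp_deriv)
    have "partial_deriv i (\<lambda>y. lin u (g y) j) w = partial_deriv i (\<lambda>y. jac n g u (lin u y) j) w"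
      by (rule partial_deriv_cong(1)[OF open_U w i]) (simp add: lin_equivariant[OF u g(1)])
    also note *
    finally show "partial_deriv i (\<lambda>y. lin u (g y) j) w
        = (\<Sum>l<n. partial_deriv l (\<lambda>y. g y j) u * partial_deriv i (\<lambda>y. lin u y l) w)" .
  qed
  also have "\<dots> = jac n g u (jac n (lin u) w v) j"
    unfolding jac_def sum_distrib_left sum_distrib_right by (subst sum.swap) (simp add: mult.assoc)
  finally show "jac n (lin u) w (jac n g w v) j = jac n g u (jac n (lin u) w v) j" .
qed

text \<open>By strict differentiability, \<open>lin u\<close> differs from ?m times the identity by
  a map with small Lipschitz constant near u.\<close>

lemma lin_inj_near:
  assumes u: "u \<in> U" shows "\<exists>d>0. inj_on (lin u) (cube n u d)"
proof -
  let ?m = "real (card (stab u))"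
  have m: "0 < ?m" using card_stab[OF u] by simp
  \<comment> \<open>Summing the estimate over n coordinates multiplies e by n, and n e \<le> ?m / 2
    still leaves half of the main term. The denominator uses n + 1 to allow n = 0.\<close>
  define e where "e = ?m / (2 * (n + 1))"
  have e: "0 < e" using m by (simp add: e_def)
  have pd: "(\<Sum>i<n. partial_deriv i (\<lambda>x. lin u x j) u * v i) = ?m * v j" if "v \<in> Rn n" for v j
    using jac_lin_self[OF u that, of j] by (simp add: jac_def)
  have "\<exists>d>0. \<forall>a\<in>cube n u d. \<forall>b\<in>cube n u d. \<bar>lin u a j - lin u b j - ?m * (a j - b j)\<bar> \<le> e * (\<Sum>i<n. \<bar>a i - b i\<bar>)" for j
  proof -
    obtain d where d: "d > 0" "\<forall>a\<in>cube n u d. \<forall>b\<in>cube n u d.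
        \<bar>lin u a j - lin u b j - (\<Sum>i<n. partial_deriv i (\<lambda>x. lin u x j) u * (a i - b i))\<bar> \<le> e * (\<Sum>i<n. \<bar>a i - b i\<bar>)"
      using strict_diff[OF open_U Ck_on_lin[OF u] u e] by blast
    have "\<bar>lin u a j - lin u b j - ?m * (a j - b j)\<bar> \<le> e * (\<Sum>i<n. \<bar>a i - b i\<bar>)"
      if "a \<in> cube n u d" "b \<in> cube n u d" for a b
    proof -
      have "(\<lambda>i. a i - b i) \<in> Rn n" using that by (simp add: cube_def topspace_Euclidean_space)
      from pd[OF this, of j] show ?thesis using bspec[OF bspec[OF d(2) that(1)] that(2)] by (simp only:)
    qed
    then show ?thesis using d(1) by blast
  qed
  then have "\<forall>j. \<exists>d>0. \<forall>a\<in>cube n u d. \<forall>b\<in>cube n u d. \<bar>lin u a j - lin u b j - ?m * (a j - b j)\<bar> \<le> e * (\<Sum>i<n. \<bar>a i - b i\<bar>)" ..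
  from choice[OF this]
  obtain D where D: "\<And>j. D j > 0" "\<And>j. \<forall>a\<in>cube n u (D j). \<forall>b\<in>cube n u (D j).
      \<bar>lin u a j - lin u b j - ?m * (a j - b j)\<bar> \<le> e * (\<Sum>i<n. \<bar>a i - b i\<bar>)" by blast
  define d where "d = Min (insert 1 (D ` {..<n}))"
  have d: "d > 0" "\<And>j. j < n \<Longrightarrow> d \<le> D j" using D(1) by (auto simp: d_def)
  have "inj_on (lin u) (cube n u d)"
  proof (rule inj_onI)
    fix a b assume a: "a \<in> cube n u d" and b: "b \<in> cube n u d" and eq: "lin u a = lin u b"
    define S where "S = (\<Sum>i<n. \<bar>a i - b i\<bar>)"
    have S0: "0 \<le> S" unfolding S_def by (intro sum_nonneg) auto
    have "?m * \<bar>a j - b j\<bar> \<le> e * S" if j: "j < n" for j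
    proof -
      have "\<bar>lin u a j - lin u b j - ?m * (a j - b j)\<bar> \<le> e * (\<Sum>i<n. \<bar>a i - b i\<bar>)"
        using D(2)[of j] a b cube_mono[OF d(2)[OF j]] by blast
      then show ?thesis using eq m by (simp add: S_def abs_mult)
    qed
    then have "(\<Sum>j<n. ?m * \<bar>a j - b j\<bar>) \<le> (\<Sum>j<n. e * S)" by (intro sum_mono) auto
    moreover have "(\<Sum>j<n. ?m * \<bar>a j - b j\<bar>) = ?m * S" by (simp add: S_def sum_distrib_left)
    moreover have "(\<Sum>j<n. e * S) = real n * e * S" by simp
    ultimately have "?m * S \<le> real n * e * S" by linarith
    also have "\<dots> \<le> ?m / 2 * S"
    proof (rule mult_right_mono[OF _ S0])
      show "real n * e \<le> ?m / 2" using m by (simp add: e_def field_simps)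
    qed
    finally have "?m * S \<le> 0" by linarith
    then have "S \<le> 0" using m by (simp add: mult_le_0_iff)
    then have "S = 0" using S0 by simp
    then have "a i = b i" if "i < n" for i using that by (simp add: S_def sum_nonneg_eq_0_iff)
    then show "a = b" using a b by (intro Rn_eqI[of _ n]) (auto simp: cube_def)
  qed
  then show ?thesis using d(1) by blast
qed

end

text \<open>\<open>lin u\<close> identifies the neighbourhood W of u with B, a neighbourhood of 0 on
  which the stabiliser acts linearly, and \<zeta> is the inverse. B is the intersection of the
  translates of a cube under the linear action, hence stable and convex, so it contains the segments
  along which strata are connected.\<close>

locale linear_chart = orbi_chart n X U \<Gamma> \<phi>
  for n :: nat and X :: "'a topology" and U \<Gamma> \<phi> +
  fixes u :: "nat \<Rightarrow> real" and W :: "(nat \<Rightarrow> real) set" and B :: "(nat \<Rightarrow> real) set"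
    and \<zeta> :: "(nat \<Rightarrow> real) \<Rightarrow> (nat \<Rightarrow> real)" and r :: real
  assumes u: "u \<in> U"
    and B_eq: "B = {z \<in> Rn n. \<forall>g\<in>stab u. \<forall>i<n. \<bar>jac n g u z i\<bar> < r}"
    and W: "eopen n W" "u \<in> W" "W \<subseteq> U"
    and stab_le: "\<And>w. w \<in> W \<Longrightarrow> stab w \<subseteq> stab u"
    and W_inv: "\<And>g w. g \<in> stab u \<Longrightarrow> w \<in> W \<Longrightarrow> g w \<in> W"
    and lin_W: "\<And>w. w \<in> W \<Longrightarrow> lin u w \<in> B"
    and zeta: "\<And>z. z \<in> B \<Longrightarrow> \<zeta> z \<in> W" "\<And>z. z \<in> B \<Longrightarrow> lin u (\<zeta> z) = z" "\<And>w. w \<in> W \<Longrightarrow> \<zeta> (lin u w) = w"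
    and zeta_cont: "continuous_map (esub n B) (esub n U) \<zeta>"
    and lin_immersion: "\<And>w v. w \<in> W \<Longrightarrow> v \<in> Rn n \<Longrightarrow> (\<And>j. j < n \<Longrightarrow> jac n (lin u) w v j = 0) \<Longrightarrow> v = (\<lambda>_. 0)"

context orbi_chart
begin

text \<open>C is the largest subset of U \<inter> O' that is stable under the stabiliser; it is open
  because the stabiliser is finite.\<close>

lemma stab_core:
  assumes u: "u \<in> U" and O: "eopen n O'"
  defines "C \<equiv> {x \<in> U. \<forall>k\<in>stab u. k x \<in> O'}"
  shows "eopen n C" "u \<in> O' \<Longrightarrow> u \<in> C" "C \<subseteq> U" "C \<subseteq> O'"
    "\<And>g x. g \<in> stab u \<Longrightarrow> x \<in> C \<Longrightarrow> g x \<in> C"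
proof -
  have "C = \<Inter>(insert U ((\<lambda>k. {x \<in> U. k x \<in> O'}) ` stab u))" by (auto simp: C_def)
  moreover have "eopen n (\<Inter>(insert U ((\<lambda>k. {x \<in> U. k x \<in> O'}) ` stab u)))"
  proof (rule openin_Inter)
    fix Y assume "Y \<in> insert U ((\<lambda>k. {x \<in> U. k x \<in> O'}) ` stab u)"
    then consider "Y = U" | k where "k \<in> stab u" "Y = {x \<in> U. k x \<in> O'}" by blast
    then show "eopen n Y"
    proof cases
      case 2
      then show ?thesis using open_preimage_g[OF _ O] by (simp add: stab_iff)
    qed (simp add: open_U)
  qed (use finite_stab in auto)
  ultimately show "eopen n C" by simp
  show "u \<in> C" if "u \<in> O'" using that u by (simp add: C_def stab_iff)
  show "C \<subseteq> U" by (auto simp: C_def)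
  show "C \<subseteq> O'"
  proof
    fix x assume "x \<in> C"
    then have "x \<in> U" "gid x \<in> O'" using stab_one[OF u] by (auto simp: C_def)
    then show "x \<in> O'" by (simp add: one_apply)
  qed
  fix g x assume g: "g \<in> stab u" and x: "x \<in> C"
  have gG: "g \<in> \<Gamma>" and xU: "x \<in> U" using g x by (simp_all add: stab_iff C_def)
  have "k (g x) \<in> O'" if k: "k \<in> stab u" for k
  proof -
    have "k (g x) = (k \<cdot> g) x" using mult_apply[of k g x] k gG xU by (simp add: stab_iff)
    then show ?thesis using x stab_mult[OF u k g] by (simp add: C_def)
  qed
  then show "g x \<in> C" using mem[OF gG xU] by (simp add: C_def)
qed

text \<open>Injectivity of \<open>lin u\<close> near u and invariance of domain make its image open
  and its inverse continuous. The domain is then shrunk twice to a stable core: first to make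
  translates available on the injectivity domain, then to match the image with B.\<close>

lemma linear_chart_exists:
  assumes u: "u \<in> U" shows "\<exists>W B \<zeta> r. linear_chart n X U \<Gamma> \<phi> u W B \<zeta> r"
proof -
  have uR: "u \<in> Rn n" using U_Rn u by blast
  have linsm: "smooth_map n U (Rn n) (lin u)"
    using Ck_on_lin[OF u] lin_Rn[OF u] by (simp add: smooth_map_def smooth_on_def)
  have lincont: "continuous_map (esub n U) (Euclidean_space n) (lin u)"
    using smooth_map_continuous[OF linsm open_U openin_topspace] by simp
  obtain d1 where d1: "d1 > 0" "inj_on (lin u) (cube n u d1)" using lin_inj_near[OF u] by blast
  \<comment> \<open>The Jacobian determinant: being an immersion becomes the open condition J x
    \<noteq> 0, which holds at u.\<close>
  define J where "J x = Determinant.det (mat n n (\<lambda>(i, j). partial_deriv j (\<lambda>y. lin u y i) x))" for x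
  have "Ck_on n U 0 J"
    unfolding J_def by (rule Ck_on_det[OF open_U Ck_on_partial_deriv[OF Ck_on_lin[OF u]]])
  then have "continuous_map (esub n U) euclideanreal J" by (rule Ck_on_continuous)
  then have "openin (esub n U) {x \<in> topspace (esub n U). J x \<in> - {0}}"
    by (rule openin_continuous_map_preimage) (simp add: open_Compl)
  moreover have "{x \<in> topspace (esub n U). J x \<in> - {0}} = {x \<in> U. J x \<noteq> 0}"
    using U_Rn by auto
  ultimately have O2: "eopen n {x \<in> U. J x \<noteq> 0}"
    using open_U by (simp add: openin_open_subtopology)
  have Ju: "J u \<noteq> 0"
    unfolding J_def det_nz_iff
  proof (intro ballI impI)
    fix v assume v: "v \<in> Rn n" and z: "\<forall>j<n. (\<Sum>i<n. partial_deriv i (\<lambda>y. lin u y j) u * v i) = 0"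
    have "v j = 0" if "j < n" for j
      using jac_lin_self[OF u v, of j] z that card_stab[OF u] by (simp add: jac_def)
    then show "v = (\<lambda>_. 0)" using v by (intro Rn_eqI[of _ n]) (auto simp: topspace_Euclidean_space)
  qed
  obtain O' where O': "eopen n O'" "u \<in> O'" "O' \<subseteq> U"
      "\<forall>g\<in>\<Gamma>. g \<notin> stab u \<longrightarrow> (\<exists>P. eopen n P \<and> g u \<in> P \<and> P \<inter> O' = {})"
    using isolating_neighbourhood[OF u] by blast
  have "\<forall>g\<in>\<Gamma> - stab u. \<exists>P. eopen n P \<and> g u \<in> P \<and> P \<inter> O' = {}" using O'(4) by blast
  from bchoice[OF this]
  obtain P where P: "\<forall>g\<in>\<Gamma> - stab u. eopen n (P g) \<and> g u \<in> P g \<and> P g \<inter> O' = {}" by blast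
  \<comment> \<open>A point w of \<open>O3\<close> lies in O', while \<open>g w\<close> lies in
    \<open>P g\<close>, which misses O'; so no g outside the stabiliser of u fixes w.\<close>
  define O3 where "O3 = \<Inter>(insert O' ((\<lambda>g. {x \<in> U. g x \<in> P g}) ` (\<Gamma> - stab u)))"
  have O3: "eopen n O3"
    unfolding O3_def
  proof (rule openin_Inter)
    fix Y assume "Y \<in> insert O' ((\<lambda>g. {x \<in> U. g x \<in> P g}) ` (\<Gamma> - stab u))"
    then consider "Y = O'" | g where "g \<in> \<Gamma> - stab u" "Y = {x \<in> U. g x \<in> P g}" by blast
    then show "eopen n Y"
    proof cases
      case 2
      then show ?thesis using open_preimage_g[of g "P g"] P by blast
    qed (simp add: O')
  qed (use finite in auto)
  have uO3: "u \<in> O3" using O'(2) P u by (auto simp: O3_def)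
  have stO3: "stab w \<subseteq> stab u" if w: "w \<in> O3" for w
  proof
    fix g assume g: "g \<in> stab w"
    show "g \<in> stab u"
    proof (rule ccontr)
      assume "g \<notin> stab u"
      then have g': "g \<in> \<Gamma> - stab u" using g by (simp add: stab_iff)
      have "w \<in> O'" "g w \<in> P g" using w g' unfolding O3_def by blast+
      moreover have "g w = w" using g by (simp add: stab_iff)
      moreover have "P g \<inter> O' = {}" using bspec[OF P g'] by (elim conjE)
      ultimately show False by auto
    qed
  qed
  define W0 where "W0 = cube n u d1 \<inter> {x \<in> U. J x \<noteq> 0} \<inter> O3"
  have W0: "eopen n W0" unfolding W0_def by (intro openin_Int openin_cube O2 O3)
  have uW0: "u \<in> W0" using cube_self[OF uR d1(1)] u Ju uO3 by (simp add: W0_def)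
  define W1 where "W1 = {x \<in> U. \<forall>k\<in>stab u. k x \<in> W0}"
  note W1 = stab_core[OF u W0, folded W1_def]
  have inj: "inj_on (lin u) W1" by (rule inj_on_subset[OF d1(2)]) (use W1(4) in \<open>auto simp: W0_def\<close>)
  have topW1: "topspace (esub n W1) = W1" using W1(3) U_Rn by auto
  have cW1: "continuous_map (esub n W1) (Euclidean_space n) (lin u)"
    by (rule continuous_map_from_subtopology_mono[OF lincont W1(3)])
  define D where "D = lin u ` W1"
  have D: "eopen n D"
    unfolding D_def by (rule invariance_of_domain_Euclidean_space[OF W1(1) cW1 inj])
  have topD: "topspace (esub n D) = D" using openin_subset[OF D] by auto
  have "embedding_map (esub n W1) (Euclidean_space n) (lin u)"
    by (rule invariance_of_domain_Euclidean_space_embedding_map[OF W1(1) cW1 inj])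
  then have "homeomorphic_map (esub n W1) (esub n D) (lin u)"
    unfolding embedding_map_def topW1 D_def .
  then obtain \<zeta> where z: "homeomorphic_maps (esub n W1) (esub n D) (lin u) \<zeta>"
    unfolding homeomorphic_map_maps by blast
  have zc: "continuous_map (esub n D) (esub n W1) \<zeta>"
    and zl: "\<And>x. x \<in> W1 \<Longrightarrow> \<zeta> (lin u x) = x" and lz: "\<And>y. y \<in> D \<Longrightarrow> lin u (\<zeta> y) = y"
    using z topW1 topD unfolding homeomorphic_maps_def by auto
  have zW1: "\<zeta> y \<in> W1" if "y \<in> D" for y using that zl by (auto simp: D_def)
  have zero: "(\<lambda>_. 0) \<in> D" using lin_self[of u] W1(2)[OF uW0] unfolding D_def by force
  then obtain r where r: "r > 0" "cube n (\<lambda>_. 0) r \<subseteq> D" using D unfolding openin_Rn_iff by blast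
  define W2 where "W2 = {x \<in> W1. lin u x \<in> cube n (\<lambda>_. 0) r}"
  have W2: "eopen n W2"
  proof -
    have "openin (esub n W1) {x \<in> topspace (esub n W1). lin u x \<in> cube n (\<lambda>_. 0) r}"
      by (rule openin_continuous_map_preimage[OF cW1 openin_cube])
    then show ?thesis using W1(1) by (simp add: openin_open_subtopology topW1 W2_def del: topspace_subtopology)
  qed
  have uW2: "u \<in> W2" using W1(2)[OF uW0] r(1) by (simp add: W2_def lin_self cube_def topspace_Euclidean_space)
  \<comment> \<open>By equivariance, requiring \<open>lin u (k x)\<close> to lie in the cube for
    every k in the stabiliser is the same as requiring \<open>lin u x\<close> to lie in B.\<close>
  define W where "W = {x \<in> U. \<forall>k\<in>stab u. k x \<in> W2}"
  note W = stab_core[OF u W2, folded W_def]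
  have WW1: "W \<subseteq> W1" using W(4) by (auto simp: W2_def)
  have W1W0: "W1 \<subseteq> W0" by (rule W1(4))
  define B where "B = {z \<in> Rn n. \<forall>g\<in>stab u. \<forall>i<n. \<bar>jac n g u z i\<bar> < r}"
  have BD: "z \<in> D" if z: "z \<in> B" for z
  proof -
    have zR: "z \<in> Rn n" using z by (simp add: B_def)
    have "\<forall>i<n. \<bar>jac n gid u z i\<bar> < r" using z stab_one[OF u] unfolding B_def by blast
    then have "z \<in> cube n (\<lambda>_. 0) r" unfolding jac_one[OF u zR] using zR by (simp add: cube_def)
    then show ?thesis using r(2) by blast
  qed
  have lin_gx: "lin u (g x) = jac n g u (lin u x)" if "g \<in> stab u" "x \<in> U" for g x
    by (rule lin_equivariant[OF u that])
  have "linear_chart n X U \<Gamma> \<phi> u W B \<zeta> r"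
  proof (intro linear_chart.intro linear_chart_axioms.intro)
    show "orbi_chart n X U \<Gamma> \<phi>" by unfold_locales
    show "stab w \<subseteq> stab u" if "w \<in> W" for w
    proof (rule stO3)
      show "w \<in> O3" using that WW1 W1W0 unfolding W0_def by blast
    qed
    show "g w \<in> W" if "g \<in> stab u" "w \<in> W" for g w by (rule W(5)[OF that])
    show "lin u w \<in> B" if w: "w \<in> W" for w
    proof -
      have "\<bar>jac n g u (lin u w) i\<bar> < r" if g: "g \<in> stab u" and i: "i < n" for g i
      proof -
        have "g w \<in> W2" using w g by (simp add: W_def)
        then show ?thesis using i lin_gx[OF g] w W(3) by (auto simp: W2_def cube_def)
      qed
      then show ?thesis using lin_Rn[OF u] by (simp add: B_def)
    qed
    show "\<zeta> z \<in> W" if z: "z \<in> B" for z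
    proof -
      have zD: "z \<in> D" by (rule BD[OF z])
      have zU: "\<zeta> z \<in> U" using zW1[OF zD] W1(3) by blast
      have "g (\<zeta> z) \<in> W2" if g: "g \<in> stab u" for g
      proof -
        have "lin u (g (\<zeta> z)) = jac n g u z" using lin_gx[OF g zU] lz[OF zD] by simp
        moreover have "jac n g u z \<in> cube n (\<lambda>_. 0) r"
          using z g jac_stab_Rn[OF u g] by (simp add: cube_def B_def)
        ultimately show ?thesis using W1(5)[OF g zW1[OF zD]] by (simp add: W2_def)
      qed
      then show ?thesis using zU by (simp add: W_def)
    qed
    show "lin u (\<zeta> z) = z" if "z \<in> B" for z using lz BD that by blast
    show "\<zeta> (lin u w) = w" if "w \<in> W" for w using zl WW1 that by blast
    show "continuous_map (esub n B) (esub n U) \<zeta>"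
    proof -
      have "continuous_map (esub n B) (esub n W1) \<zeta>"
        by (rule continuous_map_from_subtopology_mono[OF zc]) (use BD in blast)
      then show ?thesis using W1(3) by (auto simp: continuous_map_in_subtopology)
    qed
    show "v = (\<lambda>_. 0)" if w: "w \<in> W" and v: "v \<in> Rn n" and zero: "\<And>j. j < n \<Longrightarrow> jac n (lin u) w v j = 0" for w v
    proof -
      have "J w \<noteq> 0" using w WW1 W1W0 by (auto simp: W0_def)
      then show ?thesis unfolding J_def det_nz_iff using v zero by (simp add: jac_def)
    qed
  qed (fact u B_def W(1) W(2)[OF uW2] W(3))+
  then show ?thesis by blast
qed

end

section \<open>Ranks of invariant covectors in the linear model\<close>

context linear_chart
begin

text \<open>All covectors are taken at u, with H acting by its linear part at u. For varying points
  of W the spaces \<open>inv_cov\<close> become comparable in this form.\<close>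

definition lin_cov :: "((nat \<Rightarrow> real) \<Rightarrow> (nat \<Rightarrow> real)) set \<Rightarrow> (nat \<Rightarrow> real) set" where
  "lin_cov H = {\<beta>. \<forall>g\<in>H. \<forall>v\<in>Rn n. (\<Sum>i<n. \<beta> i * jac n g u v i) = (\<Sum>i<n. \<beta> i * v i)}"

lemma B_Rn: "z \<in> B \<Longrightarrow> z \<in> Rn n"
  by (simp add: B_eq)

text \<open>By equivariance and injectivity of \<open>lin u\<close> on W, fixing w is the same as
  fixing its linear coordinate.\<close>

lemma stab_W_iff:
  assumes w: "w \<in> W" shows "g \<in> stab w \<longleftrightarrow> g \<in> stab u \<and> jac n g u (lin u w) = lin u w"
proof
  assume g: "g \<in> stab w"
  then have gu: "g \<in> stab u" using stab_le[OF w] by blast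
  then show "g \<in> stab u \<and> jac n g u (lin u w) = lin u w"
    using lin_equivariant[OF u gu, of w] w W(3) g by (auto simp: stab_iff)
next
  assume g: "g \<in> stab u \<and> jac n g u (lin u w) = lin u w"
  then have "lin u (g w) = lin u w" using lin_equivariant[OF u, of g w] w W(3) by auto
  then have "g w = w" using zeta(3)[OF w] zeta(3)[OF W_inv[of g w]] g w by simp
  then show "g \<in> stab w" using g by (simp add: stab_iff)
qed

text \<open>The transpose of the differential of \<open>lin u\<close> at w carries
  \<open>lin_cov (stab w)\<close> into \<open>inv_cov w\<close>, and its inverse goes back, because
  that differential intertwines the two actions.\<close>

lemma cov_rank_lin_cov:
  assumes w: "w \<in> W" shows "cov_rank n (inv_cov w) = cov_rank n (lin_cov (stab w))"
proof (rule antisym)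
  have wU: "w \<in> U" using w W(3) by blast
  let ?K = "\<lambda>i j. partial_deriv j (\<lambda>y. lin u y i) w" and ?L = "\<lambda>i j. jac_inv n (lin u) w i j"
  have JR: "jac n (lin u) w v \<in> Rn n" for v by (rule jac_in_Rn[OF open_U lin_Rn[OF u] wU])
  have LK: "(\<Sum>k<n. ?L i k * ?K k j) = (if i = j then 1 else 0)" "(\<Sum>k<n. ?K i k * ?L k j) = (if i = j then 1 else 0)"
    if "i < n" "j < n" for i j
    using jac_inv[OF lin_immersion[OF w] that] by simp_all
  have delta: "(\<Sum>i<n. a i * (if i = j then 1 else 0)) = (a j :: real)" "(\<Sum>i<n. (if j = i then 1 else 0) * a i) = (a j :: real)"
    if "j < n" for j a
    using that by (simp_all add: if_distrib[of "\<lambda>z. z * _"] if_distrib[of "\<lambda>z. _ * z"] cong: if_cong)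
  have eqv: "jac n (lin u) w (jac n g w v) = jac n g u (jac n (lin u) w v)" if "g \<in> stab w" for g v
    using lin_equivariant_jac[OF u wU] stab_le[OF w] that by blast
  show "cov_rank n (lin_cov (stab w)) \<le> cov_rank n (inv_cov w)"
  proof (rule cov_rank_le_linear[where K = ?K])
    fix \<beta> assume \<beta>: "\<beta> \<in> lin_cov (stab w)"
    show "(\<lambda>j. \<Sum>i<n. \<beta> i * ?K i j) \<in> inv_cov w"
      unfolding inv_cov_def
    proof (intro CollectI ballI)
      fix g v assume g: "g \<in> stab w" and v: "v \<in> Rn n"
      show "(\<Sum>j<n. (\<Sum>i<n. \<beta> i * ?K i j) * jac n g w v j) = (\<Sum>j<n. (\<Sum>i<n. \<beta> i * ?K i j) * v j)"
        unfolding jac_cov[symmetric] eqv[OF g] using \<beta> g JR unfolding lin_cov_def by blast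
    qed
  next
    fix \<beta> assume z: "\<forall>j<n. (\<Sum>i<n. \<beta> i * ?K i j) = 0"
    show "\<forall>l<n. \<beta> l = 0"
    proof (intro allI impI)
      fix l assume l: "l < n"
      have "\<beta> l = (\<Sum>i<n. \<beta> i * (\<Sum>j<n. ?K i j * ?L j l))"
        using LK(2)[OF _ l] delta(1)[OF l, of \<beta>] by simp
      also have "\<dots> = (\<Sum>j<n. (\<Sum>i<n. \<beta> i * ?K i j) * ?L j l)"
        unfolding sum_distrib_left sum_distrib_right by (subst sum.swap) (simp add: mult.assoc)
      also have "\<dots> = 0" using z by simp
      finally show "\<beta> l = 0" .
    qed
  qed
  show "cov_rank n (inv_cov w) \<le> cov_rank n (lin_cov (stab w))"
  proof (rule cov_rank_le_linear[where K = ?L])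
    fix \<alpha> assume \<alpha>: "\<alpha> \<in> inv_cov w"
    let ?\<gamma> = "\<lambda>j. \<Sum>i<n. \<alpha> i * ?L i j"
    have \<gamma>J: "(\<Sum>j<n. ?\<gamma> j * jac n (lin u) w x j) = (\<Sum>i<n. \<alpha> i * x i)" for x
    proof -
      have "(\<Sum>j<n. ?\<gamma> j * jac n (lin u) w x j) = (\<Sum>k<n. (\<Sum>j<n. ?\<gamma> j * ?K j k) * x k)"
        by (rule jac_cov)
      also have "\<dots> = (\<Sum>k<n. \<alpha> k * x k)"
      proof (intro sum.cong refl)
        fix k assume "k \<in> {..<n}"
        then have k: "k < n" by simp
        have "(\<Sum>j<n. ?\<gamma> j * ?K j k) = (\<Sum>i<n. \<alpha> i * (\<Sum>j<n. ?L i j * ?K j k))"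
          unfolding sum_distrib_left sum_distrib_right by (subst sum.swap) (simp add: mult.assoc)
        also have "\<dots> = \<alpha> k"
          using LK(1)[OF _ k] delta(1)[OF k, of \<alpha>] by simp
        finally show "(\<Sum>j<n. ?\<gamma> j * ?K j k) * x k = \<alpha> k * x k" by simp
      qed
      finally show ?thesis .
    qed
    show "?\<gamma> \<in> lin_cov (stab w)"
      unfolding lin_cov_def
    proof (intro CollectI ballI)
      fix g v assume g: "g \<in> stab w" and v: "v \<in> Rn n"
      \<comment> \<open>The preimage of v under the differential of \<open>lin u\<close> at w,
        padded by 0 to lie in \<open>Rn n\<close>.\<close>
      define v' where "v' i = (if i < n then \<Sum>j<n. ?L i j * v j else 0)" for i
      have v'R: "v' \<in> Rn n" by (simp add: v'_def topspace_Euclidean_space)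
      have "jac n (lin u) w v' = v"
      proof (rule Rn_eqI[OF JR v])
        fix j assume j: "j < n"
        have "jac n (lin u) w v' j = (\<Sum>i<n. ?K j i * (\<Sum>k<n. ?L i k * v k))"
          by (simp add: jac_def v'_def)
        also have "\<dots> = (\<Sum>k<n. (\<Sum>i<n. ?K j i * ?L i k) * v k)"
          unfolding sum_distrib_left sum_distrib_right by (subst sum.swap) (simp add: mult.assoc)
        also have "\<dots> = v j" using LK(2)[OF j] delta(2)[OF j, of v] by simp
        finally show "jac n (lin u) w v' j = v j" .
      qed
      then have "(\<Sum>j<n. ?\<gamma> j * jac n g u v j) = (\<Sum>i<n. \<alpha> i * jac n g w v' i)"
        using eqv[OF g, of v'] \<gamma>J[of "jac n g w v'"] by simp
      also have "\<dots> = (\<Sum>i<n. \<alpha> i * v' i)" using \<alpha> g v'R unfolding inv_cov_def by blast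
      also have "\<dots> = (\<Sum>j<n. ?\<gamma> j * v j)" using \<gamma>J[of v'] \<open>jac n (lin u) w v' = v\<close> by simp
      finally show "(\<Sum>j<n. ?\<gamma> j * jac n g u v j) = (\<Sum>j<n. ?\<gamma> j * v j)" .
    qed
  next
    fix \<beta> assume z: "\<forall>j<n. (\<Sum>i<n. \<beta> i * ?L i j) = 0"
    show "\<forall>l<n. \<beta> l = 0"
    proof (intro allI impI)
      fix l assume l: "l < n"
      have "\<beta> l = (\<Sum>i<n. \<beta> i * (\<Sum>j<n. ?L i j * ?K j l))"
        using LK(1)[OF _ l] delta(1)[OF l, of \<beta>] by simp
      also have "\<dots> = (\<Sum>j<n. (\<Sum>i<n. \<beta> i * ?L i j) * ?K j l)"
        unfolding sum_distrib_left sum_distrib_right by (subst sum.swap) (simp add: mult.assoc)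
      also have "\<dots> = 0" using z by simp
      finally show "\<beta> l = 0" .
    qed
  qed
qed

text \<open>The projection onto the vectors fixed by the stabiliser of u.\<close>

definition fix_proj :: "(nat \<Rightarrow> real) \<Rightarrow> (nat \<Rightarrow> real)" where
  "fix_proj z = (\<lambda>j. (1 / card (stab u)) * (\<Sum>g\<in>stab u. jac n g u z j))"

lemma fix_proj_fixed:
  assumes k: "k \<in> stab u" shows "jac n k u (fix_proj z) = fix_proj z"
proof
  fix j
  have "jac n k u (fix_proj z) j = (1 / card (stab u)) * (\<Sum>g\<in>stab u. jac n k u (jac n g u z) j)"
    unfolding fix_proj_def jac_scale jac_sum ..
  also have "(\<Sum>g\<in>stab u. jac n k u (jac n g u z) j) = (\<Sum>g\<in>stab u. jac n (k \<cdot> g) u z j)"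
    using jac_stab_mult[OF u k] by simp
  also have "\<dots> = (\<Sum>g\<in>stab u. jac n g u z j)"
  proof (rule sum.reindex_bij_betw[of "\<lambda>g. k \<cdot> g"])
    have c: "g \<in> carrier G" if "g \<in> stab u" for g using that by (simp add: stab_iff)
    show "bij_betw (\<lambda>g. k \<cdot> g) (stab u) (stab u)"
    proof (rule bij_betwI[where g = "\<lambda>g. ginv k \<cdot> g"])
      show "(\<lambda>g. k \<cdot> g) \<in> stab u \<rightarrow> stab u" "(\<lambda>g. ginv k \<cdot> g) \<in> stab u \<rightarrow> stab u"
        using stab_mult[OF u k] stab_mult[OF u stab_inv[OF u k]] by blast+
      show "ginv k \<cdot> (k \<cdot> g) = g" "k \<cdot> (ginv k \<cdot> g) = g" if "g \<in> stab u" for g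
        using c[OF that] c[OF k] by (simp_all add: G.m_assoc[symmetric] del: carrier_G)
    qed
  qed
  finally show "jac n k u (fix_proj z) j = fix_proj z j" by (simp add: fix_proj_def)
qed

lemma fix_proj_Rn: "fix_proj z \<in> Rn n"
  using jac_stab_Rn[OF u] by (simp add: fix_proj_def topspace_Euclidean_space)

text \<open>An average of numbers of modulus below r has modulus below r; since
  \<open>fix_proj z\<close> is fixed, the conditions for all g reduce to this one.\<close>

lemma fix_proj_B:
  assumes z: "z \<in> B" shows "fix_proj z \<in> B"
proof -
  have "\<bar>fix_proj z i\<bar> < r" if i: "i < n" for i
  proof -
    have m: "0 < real (card (stab u))" using card_stab[OF u] by simp
    have "\<bar>\<Sum>g\<in>stab u. jac n g u z i\<bar> \<le> (\<Sum>g\<in>stab u. \<bar>jac n g u z i\<bar>)" by (rule sum_abs)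
    also have "\<dots> < (\<Sum>g\<in>stab u. r)"
      using z i stab_one[OF u] finite_stab by (intro sum_strict_mono) (auto simp: B_eq)
    finally have "\<bar>\<Sum>g\<in>stab u. jac n g u z i\<bar> < card (stab u) * r" by simp
    moreover have "\<bar>fix_proj z i\<bar> = \<bar>\<Sum>g\<in>stab u. jac n g u z i\<bar> / card (stab u)"
      by (simp add: fix_proj_def)
    ultimately show ?thesis using m by (simp add: pos_divide_less_eq mult.commute)
  qed
  then show ?thesis using fix_proj_fixed fix_proj_Rn by (simp add: B_eq)
qed

lemma B_segment:
  assumes "y \<in> B" "z \<in> B" "0 \<le> t" "t \<le> 1" shows "(\<lambda>i. (1 - t) * y i + t * z i) \<in> B"
proof -
  have "\<bar>jac n g u (\<lambda>i. (1 - t) * y i + t * z i) i\<bar> < r" if g: "g \<in> stab u" and i: "i < n" for g i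
  proof -
    have "\<bar>jac n g u y i\<bar> < r" "\<bar>jac n g u z i\<bar> < r"
      using assms(1,2) g i by (simp_all add: B_eq)
    then have "jac n g u y i \<in> {-r<..<r}" "jac n g u z i \<in> {-r<..<r}" by auto
    then have "(1 - t) *\<^sub>R jac n g u y i + t *\<^sub>R jac n g u z i \<in> {-r<..<r}"
      using assms(3,4) by (intro convexD[OF convex_real_interval(8)]) auto
    then show ?thesis by (simp add: jac_add jac_scale abs_less_iff)
  qed
  then show ?thesis using assms B_Rn[of y] B_Rn[of z] by (simp add: B_eq topspace_Euclidean_space)
qed

text \<open>A smaller stabiliser leaves more covectors invariant. The strictness comes from z =
  \<open>lin u w\<close>, which is fixed by \<open>stab w\<close> but not by all of
  \<open>stab u\<close>.\<close>

lemma cov_rank_less: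
  assumes w: "w \<in> W" and ne: "stab w \<noteq> stab u"
  shows "cov_rank n (lin_cov (stab u)) < cov_rank n (lin_cov (stab w))"
proof -
  have wU: "w \<in> U" using w W(3) by blast
  define z where "z = lin u w"
  have zR: "z \<in> Rn n" using lin_Rn[OF u] by (simp add: z_def)
  obtain g0 where g0: "g0 \<in> stab u" "g0 \<notin> stab w" using stab_le[OF w] ne by blast
  have "fix_proj z \<noteq> z"
    using fix_proj_fixed[OF g0(1), of z] g0 stab_W_iff[OF w, of g0] by (auto simp: z_def)
  then obtain l where l: "l < n" "fix_proj z l \<noteq> z l"
    using Rn_eqI[OF fix_proj_Rn zR] by blast
  \<comment> \<open>The l-th coordinate covector, averaged over \<open>stab w\<close> up to a
    factor, where l is a coordinate in which z and \<open>fix_proj z\<close> differ.\<close>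
  define \<beta> where "\<beta> i = (\<Sum>g\<in>stab w. partial_deriv i (\<lambda>y. g y l) u)" for i
  have \<beta>: "(\<Sum>i<n. \<beta> i * v i) = (\<Sum>g\<in>stab w. jac n g u v l)" for v
    unfolding \<beta>_def jac_def sum_distrib_right by (rule sum.swap)
  have \<beta>1: "\<beta> \<in> lin_cov (stab w)"
    unfolding lin_cov_def
  proof (intro CollectI ballI)
    fix k v assume k: "k \<in> stab w"
    have "(\<Sum>i<n. \<beta> i * jac n k u v i) = (\<Sum>g\<in>stab w. jac n (g \<cdot> k) u v l)"
      unfolding \<beta>
    proof (rule sum.cong[OF refl])
      fix g assume "g \<in> stab w"
      then have "g \<in> stab u" "k \<in> stab u" using stab_le[OF w] k by blast+
      then show "jac n g u (jac n k u v) l = jac n (g \<cdot> k) u v l" by (simp only: jac_stab_mult[OF u])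
    qed
    also have "\<dots> = (\<Sum>g\<in>stab w. jac n g u v l)"
      by (rule stab_sum_right_translate[OF wU k])
    finally show "(\<Sum>i<n. \<beta> i * jac n k u v i) = (\<Sum>i<n. \<beta> i * v i)" unfolding \<beta> .
  qed
  \<comment> \<open>A covector invariant under \<open>stab u\<close> takes the same value on z and
    on its average. Both vectors are fixed by \<open>stab w\<close>, so the values of \<beta> are
    the order of \<open>stab w\<close> times their l-th coordinates, which differ.\<close>
  have \<beta>2: "\<beta> \<notin> lin_cov (stab u)"
  proof
    assume \<beta>': "\<beta> \<in> lin_cov (stab u)"
    let ?m = "real (card (stab u))"
    have m: "?m > 0" using card_stab[OF u] by simp
    have "?m * (\<Sum>i<n. \<beta> i * fix_proj z i) = (\<Sum>i<n. \<beta> i * (\<Sum>g\<in>stab u. jac n g u z i))"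
      using m by (simp add: fix_proj_def sum_distrib_left)
    also have "\<dots> = (\<Sum>g\<in>stab u. \<Sum>i<n. \<beta> i * jac n g u z i)"
      unfolding sum_distrib_left by (rule sum.swap)
    also have "\<dots> = (\<Sum>g\<in>stab u. \<Sum>i<n. \<beta> i * z i)"
    proof (rule sum.cong[OF refl])
      fix g assume "g \<in> stab u"
      then show "(\<Sum>i<n. \<beta> i * jac n g u z i) = (\<Sum>i<n. \<beta> i * z i)"
        using \<beta>' zR unfolding lin_cov_def by blast
    qed
    finally have "?m * (\<Sum>i<n. \<beta> i * fix_proj z i) = ?m * (\<Sum>i<n. \<beta> i * z i)" unfolding sum_constant .
    moreover have "?m \<noteq> 0" using m by linarith
    ultimately have "(\<Sum>i<n. \<beta> i * fix_proj z i) = (\<Sum>i<n. \<beta> i * z i)"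
      using mult_left_cancel by blast
    then have "(\<Sum>g\<in>stab w. jac n g u (fix_proj z) l) = (\<Sum>g\<in>stab w. jac n g u z l)" unfolding \<beta> .
    moreover have "(\<Sum>g\<in>stab w. jac n g u (fix_proj z) l) = (\<Sum>g\<in>stab w. fix_proj z l)"
    proof (rule sum.cong[OF refl])
      fix g assume "g \<in> stab w"
      then have "g \<in> stab u" using stab_le[OF w] by blast
      then show "jac n g u (fix_proj z) l = fix_proj z l" by (simp only: fix_proj_fixed)
    qed
    moreover have "(\<Sum>g\<in>stab w. jac n g u z l) = (\<Sum>g\<in>stab w. z l)"
    proof (rule sum.cong[OF refl])
      fix g assume "g \<in> stab w"
      then show "jac n g u z l = z l" using stab_W_iff[OF w, of g] by (simp add: z_def)
    qed
    ultimately have "fix_proj z l = z l" using card_stab[OF wU] by simp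
    then show False using l by simp
  qed
  have sub: "lin_cov (stab u) \<subseteq> lin_cov (stab w)" using stab_le[OF w] unfolding lin_cov_def by blast
  show ?thesis
  proof (rule cov_rank_strict_mono[OF sub \<beta>1 \<beta>2])
    fix k :: nat and \<alpha> c v
    assume \<alpha>: "\<forall>i<k. \<alpha> i \<in> lin_cov (stab u)" and v: "\<forall>j<n. v j = (\<Sum>i<k. c i * \<alpha> i j)"
    have vx: "(\<Sum>j<n. v j * x j) = (\<Sum>i<k. c i * (\<Sum>j<n. \<alpha> i j * x j))" for x
    proof -
      have "(\<Sum>j<n. v j * x j) = (\<Sum>j<n. (\<Sum>i<k. c i * \<alpha> i j) * x j)" using v by simp
      also have "\<dots> = (\<Sum>i<k. c i * (\<Sum>j<n. \<alpha> i j * x j))"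
        unfolding sum_distrib_left sum_distrib_right by (subst sum.swap) (simp add: mult.assoc)
      finally show ?thesis .
    qed
    show "v \<in> lin_cov (stab u)"
      unfolding lin_cov_def
    proof (intro CollectI ballI)
      fix g x assume g: "g \<in> stab u" and x: "x \<in> Rn n"
      show "(\<Sum>i<n. v i * jac n g u x i) = (\<Sum>i<n. v i * x i)"
        unfolding vx
      proof (rule sum.cong[OF refl])
        fix i assume "i \<in> {..<k}"
        then have "\<alpha> i \<in> lin_cov (stab u)" using \<alpha> by simp
        then have "(\<Sum>j<n. \<alpha> i j * jac n g u x j) = (\<Sum>j<n. \<alpha> i j * x j)"
          using g x unfolding lin_cov_def by blast
        then show "c i * (\<Sum>j<n. \<alpha> i j * jac n g u x j) = c i * (\<Sum>j<n. \<alpha> i j * x j)" by (rule arg_cong)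
      qed
    qed
  qed
qed

lemma continuous_path:
  assumes "y \<in> B" "z \<in> B"
  shows "continuous_map (top_of_set {0..1}) X (\<lambda>t. \<phi> (\<zeta> (\<lambda>i. (1 - t) * y i + t * z i)))"
proof -
  have "continuous_map (top_of_set {0..1}) (esub n B) (\<lambda>t i. (1 - t) * y i + t * z i)"
  proof (rule continuous_map_intoI)
    show "B \<subseteq> Rn n" using B_Rn by blast
    show "(\<lambda>i. (1 - t) * y i + t * z i) \<in> B" if "t \<in> topspace (top_of_set {0..1})" for t
      using B_segment[OF assms, of t] that by simp
    show "continuous_map (top_of_set {0..1}) euclideanreal (\<lambda>t. (1 - t) * y j + t * z j)" for j
      by (simp add: continuous_intros)
  qed
  from continuous_map_compose[OF continuous_map_compose[OF this zeta_cont] continuous_phi]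
  show ?thesis by (simp add: o_def)
qed

lemma connected_path:
  assumes "y \<in> B" "z \<in> B" "connected T" "T \<subseteq> {0..1}"
  shows "connectedin X ((\<lambda>t. \<phi> (\<zeta> (\<lambda>i. (1 - t) * y i + t * z i))) ` T)"
  by (rule connectedin_continuous_map_image[OF continuous_path[OF assms(1,2)]])
     (use assms(3,4) in \<open>simp add: connectedin_subtopology\<close>)

end

section \<open>Connected components of level sets\<close>

text \<open>Combines both halves in one condition on neighbourhoods, the form in which the local
  structure of level sets and strata becomes available.\<close>

lemma clopen_subtopologyI:
  assumes RS: "R \<subseteq> S" and S: "S \<subseteq> topspace X"
    and N: "\<And>y. y \<in> S \<Longrightarrow> \<exists>N. openin X N \<and> y \<in> N \<and> (y \<in> R \<longrightarrow> N \<inter> S \<subseteq> R) \<and> (y \<notin> R \<longrightarrow> N \<inter> R = {})"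
  shows "openin (subtopology X S) R" "closedin (subtopology X S) R"
proof -
  show "openin (subtopology X S) R"
  proof (subst openin_subopen, intro ballI)
    fix y assume y: "y \<in> R"
    then obtain N where "openin X N" "y \<in> N" "N \<inter> S \<subseteq> R" using N RS by blast
    then have "openin (subtopology X S) (N \<inter> S)" "y \<in> N \<inter> S" "N \<inter> S \<subseteq> R"
      using y RS by (auto simp: openin_subtopology)
    then show "\<exists>T. openin (subtopology X S) T \<and> y \<in> T \<and> T \<subseteq> R" by blast
  qed
  have "openin (subtopology X S) (S - R)"
  proof (subst openin_subopen, intro ballI)
    fix y assume y: "y \<in> S - R"
    then obtain N where "openin X N" "y \<in> N" "N \<inter> R = {}" using N by blast
    then have "openin (subtopology X S) (N \<inter> S)" "y \<in> N \<inter> S" "N \<inter> S \<subseteq> S - R"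
      using y by (auto simp: openin_subtopology)
    then show "\<exists>T. openin (subtopology X S) T \<and> y \<in> T \<and> T \<subseteq> S - R" by blast
  qed
  moreover have "topspace (subtopology X S) = S" using S by auto
  ultimately show "closedin (subtopology X S) R" using RS by (simp add: closedin_def)
qed

text \<open>A connected set cannot leave an open and closed P. Two different ambient sets thus have
  the same component at x as soon as they share such a part around x.\<close>

lemma component_clopen_subtopology:
  assumes "openin T P" "closedin T P" "x \<in> P"
  shows "connected_component_of_set (subtopology T P) x = connected_component_of_set T x"
proof
  show "connected_component_of_set (subtopology T P) x \<subseteq> connected_component_of_set T x"
    using connectedin_connected_component_of[of "subtopology T P" x] assms openin_subset[OF assms(1)]
    by (intro connected_component_of_maximal) (auto simp: connectedin_subtopology connected_component_of_refl)
  have xT: "x \<in> connected_component_of_set T x"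
    using assms openin_subset[OF assms(1)] by (auto simp: connected_component_of_refl)
  have "connected_component_of_set T x \<subseteq> P \<or> disjnt (connected_component_of_set T x) P"
    by (rule connectedin_clopen_cases[OF connectedin_connected_component_of assms(2,1)])
  then have "connected_component_of_set T x \<subseteq> P" using xT assms(3) by (auto simp: disjnt_iff)
  then show "connected_component_of_set T x \<subseteq> connected_component_of_set (subtopology T P) x"
    using xT connectedin_connected_component_of[of T x]
    by (intro connected_component_of_maximal) (auto simp: connectedin_subtopology)
qed

lemma connected_components_subtopology:
  assumes "S \<subseteq> topspace X"
  shows "connected_components_of (subtopology X S) = (\<lambda>x. connected_component_of_set (subtopology X S) x) ` S"
  unfolding connected_components_of_def topspace_subtopology_subset[OF assms] ..

lemma component_mem: "x \<in> S \<Longrightarrow> S \<subseteq> topspace X \<Longrightarrow> x \<in> connected_component_of_set (subtopology X S) x"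
  by (auto simp: connected_component_of_refl topspace_subtopology_subset)

lemma component_subset: "connected_component_of_set (subtopology X S) x \<subseteq> S"
  using connected_component_of_subset_topspace[of "subtopology X S" x] by (auto simp: topspace_subtopology)

lemma component_connected: "connectedin X (connected_component_of_set (subtopology X S) x)"
  using connectedin_connected_component_of[of "subtopology X S" x] by (simp add: connectedin_subtopology)

lemma component_maximal:
  "connectedin X C \<Longrightarrow> C \<subseteq> S \<Longrightarrow> x \<in> C \<Longrightarrow> C \<subseteq> connected_component_of_set (subtopology X S) x"
  by (rule connected_component_of_maximal) (simp_all add: connectedin_subtopology)

lemma component_eq:
  assumes "y \<in> connected_component_of_set (subtopology X S) x"
  shows "connected_component_of_set (subtopology X S) y = connected_component_of_set (subtopology X S) x"
  using assms connected_component_of_equiv[of "subtopology X S" x y] by auto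

text \<open>
  Besides local connectedness of the level sets, the assumption \<open>local\<close> says that a nearby level
  set reaches the level set of \<open>x\<close> along connected sets.  A stratum that contains points of both
  would therefore contain a component of its chart trace that is not a stratum of the chart.
\<close>

locale stratified_charts =
  fixes X :: "'a topology" and d :: "'a \<Rightarrow> nat" and A :: "'c set" and img :: "'c \<Rightarrow> 'a set" and st :: "'c \<Rightarrow> 'a set set"
    and D :: "nat \<Rightarrow> 'a set"
  assumes D_eq: "D k = {x \<in> topspace X. d x = k}"
    and img: "c \<in> A \<Longrightarrow> openin X (img c)" and cover: "(\<Union>c\<in>A. img c) = topspace X"
    and st: "c \<in> A \<Longrightarrow> st c = (\<Union>k. connected_components_of (subtopology X (D k \<inter> img c)))"
    and local: "c \<in> A \<Longrightarrow> x \<in> img c \<Longrightarrow> \<exists>N. openin X N \<and> x \<in> N \<and> N \<subseteq> img c \<and> connectedin X (N \<inter> D (d x)) \<and>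
      (\<forall>y\<in>N. d y \<noteq> d x \<longrightarrow> (\<exists>T z. connectedin X T \<and> connectedin X (insert z T) \<and> y \<in> T \<and> T \<subseteq> D (d y) \<inter> img c \<and> z \<in> N \<inter> D (d x)))"
begin

abbreviation "K x \<equiv> connected_component_of_set (subtopology X (D (d x))) x"
abbreviation "C c x \<equiv> connected_component_of_set (subtopology X (D (d x) \<inter> img c)) x"

lemma D_top: "D k \<subseteq> topspace X" and img_top: "c \<in> A \<Longrightarrow> img c \<subseteq> topspace X"
  using D_eq openin_subset[OF img] by auto

lemma D_iff: "x \<in> D k \<longleftrightarrow> x \<in> topspace X \<and> d x = k"
  by (simp add: D_eq)

text \<open>The level set is connected within a small N around y, so this piece lies wholly in the
  component of y.\<close>

lemma K_clopen_nbhd: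
  assumes y: "y \<in> D (d x)"
  shows "\<exists>N. openin X N \<and> y \<in> N \<and> (y \<in> K x \<longrightarrow> N \<inter> D (d x) \<subseteq> K x) \<and> (y \<notin> K x \<longrightarrow> N \<inter> K x = {})"
proof -
  have dy: "d y = d x" "y \<in> topspace X" using y by (simp_all add: D_iff)
  then obtain c where c: "c \<in> A" "y \<in> img c" using cover by blast
  then obtain N where N: "openin X N" "y \<in> N" "connectedin X (N \<inter> D (d x))" using local[OF c] dy by auto
  have "N \<inter> D (d x) \<subseteq> K y"
    using component_maximal[OF N(3), of "D (d x)" y] N(2) y dy by auto
  then have 1: "N \<inter> D (d x) \<subseteq> connected_component_of_set (subtopology X (D (d x))) y" using dy by simp
  have "N \<inter> D (d x) \<subseteq> K x" if "y \<in> K x" using 1 component_eq[OF that] by simp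
  moreover have "N \<inter> K x = {}" if "y \<notin> K x"
  proof (rule ccontr)
    assume "N \<inter> K x \<noteq> {}"
    then obtain z where z: "z \<in> N" "z \<in> K x" by blast
    then have "z \<in> connected_component_of_set (subtopology X (D (d x))) y" using 1 component_subset[of X "D (d x)" x] by blast
    then have "K x = connected_component_of_set (subtopology X (D (d x))) y"
      using component_eq[OF z(2)] component_eq[of z X "D (d x)" y] by simp
    then show False using that component_mem[OF y D_top] by simp
  qed
  ultimately show ?thesis using N by blast
qed

text \<open>The trace of K x on a chart is open and closed in the trace of the level set, so both
  have the same component at x.\<close>

lemma C_eq:
  assumes c: "c \<in> A" and x: "x \<in> img c"
  shows "C c x = connected_component_of_set (subtopology X (K x \<inter> img c)) x"
proof -
  have xD: "x \<in> D (d x)" using img_top[OF c] x by (auto simp: D_iff)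
  let ?S = "D (d x) \<inter> img c"
  have sub: "K x \<inter> img c \<subseteq> ?S" using component_subset[of X "D (d x)" x] by blast
  have top: "?S \<subseteq> topspace X" using D_top by auto
  have nb: "\<exists>N. openin X N \<and> y \<in> N \<and> (y \<in> K x \<inter> img c \<longrightarrow> N \<inter> ?S \<subseteq> K x \<inter> img c) \<and>
      (y \<notin> K x \<inter> img c \<longrightarrow> N \<inter> (K x \<inter> img c) = {})" if y: "y \<in> ?S" for y
  proof -
    have "y \<in> D (d x)" using y by blast
    from K_clopen_nbhd[OF this] show ?thesis using y by blast
  qed
  have o: "openin (subtopology X ?S) (K x \<inter> img c)" by (rule clopen_subtopologyI(1)[OF sub top nb])
  have cl: "closedin (subtopology X ?S) (K x \<inter> img c)" by (rule clopen_subtopologyI(2)[OF sub top nb])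
  from component_clopen_subtopology[OF o cl, of x]
  have "connected_component_of_set (subtopology (subtopology X ?S) (K x \<inter> img c)) x = C c x"
    using component_mem[OF xD D_top] x by simp
  moreover have "subtopology (subtopology X ?S) (K x \<inter> img c) = subtopology X (K x \<inter> img c)"
    using sub by (simp add: subtopology_subtopology Int_absorb1)
  ultimately show ?thesis by simp
qed

lemma st_eq:
  assumes c: "c \<in> A" shows "st c = C c ` img c"
proof -
  have "connected_components_of (subtopology X (D k \<inter> img c)) =
      (\<lambda>x. connected_component_of_set (subtopology X (D k \<inter> img c)) x) ` (D k \<inter> img c)" for k
    using D_top by (intro connected_components_subtopology) auto
  also have "\<dots> k = C c ` (D k \<inter> img c)" for k
    by (intro image_cong) (auto simp: D_iff)
  finally have "st c = (\<Union>k. C c ` (D k \<inter> img c))" unfolding st[OF c] by simp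
  also have "\<dots> = C c ` (\<Union>k. D k \<inter> img c)" by (rule image_UN[symmetric])
  also have "(\<Union>k. D k \<inter> img c) = img c" using img_top[OF c] by (auto simp: D_iff)
  finally show ?thesis .
qed

lemma components_eq: "(\<Union>k. connected_components_of (subtopology X (D k))) = K ` topspace X"
proof -
  have "connected_components_of (subtopology X (D k)) =
      (\<lambda>x. connected_component_of_set (subtopology X (D k)) x) ` (D k)" for k
    using D_top by (intro connected_components_subtopology) auto
  also have "\<dots> k = K ` (D k)" for k
    by (intro image_cong) (auto simp: D_iff)
  finally have "(\<Union>k. connected_components_of (subtopology X (D k))) = (\<Union>k. K ` (D k))" by simp
  also have "\<dots> = K ` (\<Union>k. D k)" by (rule image_UN[symmetric])
  also have "(\<Union>k. D k) = topspace X" by (auto simp: D_iff)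
  finally show ?thesis .
qed

definition is_stratification :: "'a set set \<Rightarrow> bool" where
  "is_stratification S \<longleftrightarrow> partition_on (topspace X) S \<and> (\<forall>M\<in>S. connectedin X M) \<and>
     (\<forall>c\<in>A. st c = (\<Union>M\<in>S. connected_components_of (subtopology X (M \<inter> img c))))"

lemma K_mem: "x \<in> topspace X \<Longrightarrow> x \<in> K x"
  by (rule component_mem[OF _ D_top]) (simp add: D_iff)

lemma K_sub: "y \<in> K x \<Longrightarrow> y \<in> topspace X \<and> d y = d x"
  using component_subset[of X "D (d x)" x] by (auto simp: D_iff)

lemma K_eq: "y \<in> K x \<Longrightarrow> K y = K x"
  using component_eq[of y X "D (d x)" x] K_sub[of y x] by simp

lemma is_stratification_components: "is_stratification (K ` topspace X)"
  unfolding is_stratification_def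
proof (intro conjI ballI)
  show "partition_on (topspace X) (K ` topspace X)"
    unfolding partition_on_def
  proof (intro conjI)
    show "\<Union> (K ` topspace X) = topspace X" using K_mem K_sub by blast
    show "disjoint (K ` topspace X)"
    proof (rule disjointI)
      fix M M' assume "M \<in> K ` topspace X" "M' \<in> K ` topspace X" "M \<noteq> M'"
      then obtain x y where xy: "M = K x" "M' = K y" "K x \<noteq> K y" by blast
      show "M \<inter> M' = {}" unfolding xy(1,2)
      proof (rule ccontr)
        assume "K x \<inter> K y \<noteq> {}"
        then obtain z where "z \<in> K x" "z \<in> K y" by blast
        then show False using K_eq[of z x] K_eq[of z y] xy(3) by simp
      qed
    qed
    show "{} \<notin> K ` topspace X" using K_mem by blast
  qed
  show "connectedin X M" if M: "M \<in> K ` topspace X" for M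
  proof -
    obtain x where "M = K x" using M by (rule imageE)
    then show ?thesis by (simp only: component_connected)
  qed
  fix c assume c: "c \<in> A"
  have M: "connected_components_of (subtopology X (K x \<inter> img c)) = C c ` (K x \<inter> img c)" for x
  proof -
    have "connected_components_of (subtopology X (K x \<inter> img c)) =
        (\<lambda>y. connected_component_of_set (subtopology X (K x \<inter> img c)) y) ` (K x \<inter> img c)"
      using img_top[OF c] by (intro connected_components_subtopology) blast
    also have "\<dots> = C c ` (K x \<inter> img c)"
    proof (rule image_cong[OF refl])
      fix y assume y: "y \<in> K x \<inter> img c"
      then show "connected_component_of_set (subtopology X (K x \<inter> img c)) y = C c y"
        using C_eq[OF c, of y] K_eq[of y x] by simp
    qed
    finally show ?thesis .
  qed
  have "(\<Union>M\<in>K ` topspace X. connected_components_of (subtopology X (M \<inter> img c))) = (\<Union>x\<in>topspace X. C c ` (K x \<inter> img c))"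
    using M by simp
  also have "\<dots> = C c ` img c" using K_mem img_top[OF c] by blast
  finally show "st c = (\<Union>M\<in>K ` topspace X. connected_components_of (subtopology X (M \<inter> img c)))"
    unfolding st_eq[OF c] by simp
qed

text \<open>Compatibility with charts shows that, near each of its points, a member of S coincides
  with a level set. Two connectedness arguments then make it a full component of a level
  set.\<close>

lemma is_stratification_unique:
  assumes S: "is_stratification S" shows "S = K ` topspace X"
proof -
  have part: "partition_on (topspace X) S" and conn: "\<And>M. M \<in> S \<Longrightarrow> connectedin X M"
    and stS: "\<And>c. c \<in> A \<Longrightarrow> st c = (\<Union>M\<in>S. connected_components_of (subtopology X (M \<inter> img c)))"
    using S unfolding is_stratification_def by blast+
  have un: "\<Union>S = topspace X" and ne: "{} \<notin> S" and dis: "disjoint S"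
    using part unfolding partition_on_def by blast+
  have same: "M = M'" if "M \<in> S" "M' \<in> S" "x \<in> M" "x \<in> M'" for M M' x
    using disjointD[OF dis that(1,2)] that(3,4) by blast
  have top: "M \<subseteq> topspace X" if "M \<in> S" for M using that un by blast
  \<comment> \<open>The chart stratum of x is a component of the trace of some member of S, and
    disjointness forces this member to be M.\<close>
  have claim1: "connected_component_of_set (subtopology X (M \<inter> img c)) x = C c x"
    if M: "M \<in> S" and x: "x \<in> M" and c: "c \<in> A" "x \<in> img c" for M x c
  proof -
    have "C c x \<in> st c" unfolding st_eq[OF c(1)] by (rule imageI[OF c(2)])
    then obtain M' where M': "M' \<in> S" "C c x \<in> connected_components_of (subtopology X (M' \<inter> img c))"
      unfolding stS[OF c(1)] by blast
    have sub: "M' \<inter> img c \<subseteq> topspace X" using top[OF M'(1)] by blast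
    obtain y where y: "C c x = connected_component_of_set (subtopology X (M' \<inter> img c)) y" "y \<in> M' \<inter> img c"
      using M'(2)[unfolded connected_components_subtopology[OF sub]] by (rule imageE)
    have "x \<in> D (d x) \<inter> img c" using c img_top by (auto simp: D_iff)
    then have xC: "x \<in> C c x" using D_top by (intro component_mem) auto
    then have "x \<in> M'" using component_subset[of X "M' \<inter> img c" y] y(1) by blast
    then have "M' = M" using same[OF M'(1) M _ x] by blast
    then show ?thesis using y(1) component_eq[of x X "M \<inter> img c" y] xC by simp
  qed
  \<comment> \<open>If M contained a point y of another level in N, the connected set T through y
    would lie in M. So would z, and \<open>insert z T\<close> would put z into the chart stratum of
    y, although z has the level of x.\<close>
  have claim2: "\<exists>N. openin X N \<and> x \<in> N \<and> N \<inter> M \<subseteq> D (d x) \<and> N \<inter> D (d x) \<subseteq> M" if M: "M \<in> S" and x: "x \<in> M" for M x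
  proof -
    have xt: "x \<in> topspace X" using top[OF M] x by blast
    then obtain c where c: "c \<in> A" "x \<in> img c" using cover by blast
    obtain N where N: "openin X N" "x \<in> N" "N \<subseteq> img c" "connectedin X (N \<inter> D (d x))"
      "\<forall>y\<in>N. d y \<noteq> d x \<longrightarrow> (\<exists>T z. connectedin X T \<and> connectedin X (insert z T) \<and> y \<in> T \<and> T \<subseteq> D (d y) \<inter> img c \<and> z \<in> N \<inter> D (d x))"
      using local[OF c] by blast
    have "N \<inter> D (d x) \<subseteq> C c x"
      using N xt by (intro component_maximal) (auto simp: D_iff)
    then have NM: "N \<inter> D (d x) \<subseteq> M \<inter> img c"
      unfolding claim1[OF M x c, symmetric] using component_subset[of X "M \<inter> img c" x] by blast
    have "d y = d x" if y: "y \<in> N" "y \<in> M" for y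
    proof (rule ccontr)
      assume ne: "d y \<noteq> d x"
      have yc: "y \<in> img c" using y N(3) by blast
      obtain T z where T: "connectedin X T" "connectedin X (insert z T)" "y \<in> T" "T \<subseteq> D (d y) \<inter> img c" "z \<in> N \<inter> D (d x)"
        using N(5) y(1) ne by blast
      have "T \<subseteq> C c y" by (rule component_maximal[OF T(1,4,3)])
      then have "T \<subseteq> M \<inter> img c"
        unfolding claim1[OF M y(2) c(1) yc, symmetric] using component_subset[of X "M \<inter> img c" y] by blast
      moreover have "z \<in> M \<inter> img c" using NM T(5) by blast
      ultimately have "insert z T \<subseteq> connected_component_of_set (subtopology X (M \<inter> img c)) y"
        using T(3) by (intro component_maximal[OF T(2)]) auto
      then have "z \<in> C c y" unfolding claim1[OF M y(2) c(1) yc] by blast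
      then have "z \<in> D (d y)" using component_subset[of X "D (d y) \<inter> img c" y] by blast
      then show False using T(5) ne by (auto simp: D_iff)
    qed
    then have "N \<inter> M \<subseteq> D (d x)" using top[OF M] by (auto simp: D_iff)
    then show ?thesis using N(1,2) NM by blast
  qed
  \<comment> \<open>M is connected, and by the previous claim each level set is open and closed in
    it.\<close>
  have claim3: "M \<subseteq> D (d x)" if M: "M \<in> S" and x: "x \<in> M" for M x
  proof -
    have xt: "x \<in> topspace X" using top[OF M] x by blast
    have nb: "\<exists>N. openin X N \<and> y \<in> N \<and> (y \<in> M \<inter> D (d x) \<longrightarrow> N \<inter> M \<subseteq> M \<inter> D (d x)) \<and>
        (y \<notin> M \<inter> D (d x) \<longrightarrow> N \<inter> (M \<inter> D (d x)) = {})" if y: "y \<in> M" for y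
    proof -
      obtain N where N: "openin X N" "y \<in> N" "N \<inter> M \<subseteq> D (d y)" using claim2[OF M y] by blast
      have "y \<in> topspace X" using top[OF M] y by blast
      then have "y \<in> M \<inter> D (d x) \<longleftrightarrow> d y = d x" using y by (auto simp: D_iff)
      moreover have "N \<inter> D (d x) \<inter> M = {}" if "d y \<noteq> d x" using N(3) that by (auto simp: D_iff)
      ultimately show ?thesis using N by (intro exI[of _ N]) auto
    qed
    have o: "openin (subtopology X M) (M \<inter> D (d x))"
      by (rule clopen_subtopologyI(1)[OF Int_lower1 top[OF M] nb])
    have cl: "closedin (subtopology X M) (M \<inter> D (d x))"
      by (rule clopen_subtopologyI(2)[OF Int_lower1 top[OF M] nb])
    have "connectedin (subtopology X M) M" using conn[OF M] by (simp add: connectedin_subtopology)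
    then have "M \<subseteq> M \<inter> D (d x) \<or> disjnt M (M \<inter> D (d x))" by (rule connectedin_clopen_cases[OF _ cl o])
    then show ?thesis using x xt by (auto simp: disjnt_iff D_iff)
  qed
  \<comment> \<open>M lies in the component K x and is open and closed in it.\<close>
  have claim4: "M = K x" if M: "M \<in> S" and x: "x \<in> M" for M x
  proof
    show MK: "M \<subseteq> K x" by (rule component_maximal[OF conn[OF M] claim3[OF M x] x])
    have nb: "\<exists>N. openin X N \<and> y \<in> N \<and> (y \<in> M \<longrightarrow> N \<inter> K x \<subseteq> M) \<and> (y \<notin> M \<longrightarrow> N \<inter> M = {})" if y: "y \<in> K x" for y
    proof -
      have yt: "y \<in> topspace X" "d y = d x" using K_sub[OF y] by auto
      then obtain M' where M': "M' \<in> S" "y \<in> M'" using un by blast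
      obtain N where N: "openin X N" "y \<in> N" "N \<inter> D (d y) \<subseteq> M'" using claim2[OF M'] by blast
      have "N \<inter> K x \<subseteq> M'" using N(3) component_subset[of X "D (d x)" x] yt(2) by auto
      moreover have "M' = M" if "y \<in> M" by (rule same[OF M'(1) M M'(2) that])
      moreover have "N \<inter> M = {}" if "y \<notin> M"
      proof -
        have "M' \<inter> M = {}" using disjointD[OF dis M'(1) M] M'(2) that by blast
        moreover have "N \<inter> M \<subseteq> M'" using N(3) claim3[OF M x] yt(2) by auto
        ultimately show ?thesis by blast
      qed
      ultimately show ?thesis using N(1,2) by blast
    qed
    have Kt: "K x \<subseteq> topspace X" using K_sub by blast
    have o: "openin (subtopology X (K x)) M" by (rule clopen_subtopologyI(1)[OF MK Kt nb])
    have cl: "closedin (subtopology X (K x)) M" by (rule clopen_subtopologyI(2)[OF MK Kt nb])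
    have "connectedin (subtopology X (K x)) (K x)"
      using component_connected[of X "D (d x)" x] by (simp add: connectedin_subtopology)
    then have "K x \<subseteq> M \<or> disjnt (K x) M" by (rule connectedin_clopen_cases[OF _ cl o])
    then show "K x \<subseteq> M" using x MK by (auto simp: disjnt_iff)
  qed
  show ?thesis
  proof
    show "S \<subseteq> K ` topspace X"
    proof
      fix M assume M: "M \<in> S"
      then obtain x where x: "x \<in> M" using ne by (metis all_not_in_conv)
      have "x \<in> topspace X" using top[OF M] x by blast
      then show "M \<in> K ` topspace X" unfolding claim4[OF M x] by blast
    qed
    show "K ` topspace X \<subseteq> S"
    proof
      fix M assume "M \<in> K ` topspace X"
      then obtain x where x: "x \<in> topspace X" "M = K x" by blast
      then obtain M' where M': "M' \<in> S" "x \<in> M'" using un by blast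
      then show "M \<in> S" using claim4[OF M'] x by simp
    qed
  qed
qed

lemma the_stratification:
  "(THE S. partition_on (topspace X) S \<and> (\<forall>M\<in>S. connectedin X M) \<and>
     (\<forall>c\<in>A. st c = (\<Union>M\<in>S. connected_components_of (subtopology X (M \<inter> img c)))))
   = (\<Union>k. connected_components_of (subtopology X (D k)))"
  unfolding components_eq is_stratification_def[symmetric]
  using is_stratification_components is_stratification_unique by (rule the_equality)

end

section \<open>Invariance of the stratification\<close>

context linear_chart
begin

lemma stab_zeta_iff: "z \<in> B \<Longrightarrow> g \<in> stab (\<zeta> z) \<longleftrightarrow> g \<in> stab u \<and> jac n g u z = z"
  using stab_W_iff[OF zeta(1), of z g] zeta(2)[of z] by simp

lemma zero_B: "(\<lambda>_. 0) \<in> B" and zeta_zero: "\<zeta> (\<lambda>_. 0) = u"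
  using lin_W[OF W(2)] zeta(3)[OF W(2)] by (simp_all add: lin_self)

text \<open>The vectors fixed by the stabiliser of u form a subspace, so the whole segment from 0 to
  such a vector z is fixed.\<close>

lemma stab_ray:
  assumes z: "z \<in> B" and t: "0 \<le> t" "t \<le> 1" and fixed: "\<And>g. g \<in> stab u \<Longrightarrow> jac n g u z = z"
  shows "stab (\<zeta> (\<lambda>i. (1 - t) * 0 + t * z i)) = stab u"
proof -
  have "(\<lambda>i. (1 - t) * 0 + t * z i) \<in> B" by (rule B_segment[OF zero_B z t])
  note iff = stab_zeta_iff[OF this]
  have "jac n g u (\<lambda>i. (1 - t) * 0 + t * z i) = (\<lambda>i. (1 - t) * 0 + t * z i)" if g: "g \<in> stab u" for g
    by (rule ext) (simp add: jac_scale fixed[OF g])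
  then show ?thesis using iff by blast
qed

text \<open>Moving from z towards its projection adds fixed vectors and rescales z by t > 0, so the
  stabiliser is unchanged until t = 0 is reached.\<close>

lemma stab_segment:
  assumes z: "z \<in> B" and t: "0 < t" "t \<le> 1"
  shows "stab (\<zeta> (\<lambda>i. (1 - t) * fix_proj z i + t * z i)) = stab (\<zeta> z)"
proof -
  let ?y = "\<lambda>i. (1 - t) * fix_proj z i + t * z i"
  have y: "?y \<in> B" using B_segment[OF fix_proj_B[OF z] z, of t] t by simp
  have "jac n g u ?y = ?y \<longleftrightarrow> jac n g u z = z" if g: "g \<in> stab u" for g
  proof -
    have "jac n g u ?y = (\<lambda>i. (1 - t) * fix_proj z i + t * jac n g u z i)"
      using fix_proj_fixed[OF g, of z] by (intro ext) (simp add: jac_add jac_scale)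
    then show ?thesis using t(1) by (simp add: fun_eq_iff)
  qed
  then show ?thesis using stab_zeta_iff[OF y] stab_zeta_iff[OF z] by blast
qed

end

section \<open>Level sets of the stratum dimension, locally and in charts\<close>

context orbifold_space
begin

abbreviation "d \<equiv> stratum_dim X F"

definition level :: "nat \<Rightarrow> 'a set" where
  "level k = {x \<in> topspace X. d x = k}"

text \<open>N is the image of a linear chart at u. There, having the dimension of u, having its
  orbit type and having its stabiliser coincide. Such points are joined to \<phi> u by rays, while
  any other point is joined to one of them by a segment that keeps its own stabiliser up to the
  end.\<close>

lemma local_structure:
  assumes c: "(U, \<Gamma>, \<phi>) \<in> A" and u: "u \<in> U"
  shows "\<exists>N. openin X N \<and> \<phi> u \<in> N \<and> N \<subseteq> \<phi> ` U \<and>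
    N \<inter> level (d (\<phi> u)) = N \<inter> \<phi> ` orbit_type_set U \<Gamma> (chart_stabilizer U \<Gamma> u) \<and>
    connectedin X (N \<inter> level (d (\<phi> u))) \<and>
    (\<forall>y\<in>N. d y \<noteq> d (\<phi> u) \<longrightarrow> (\<exists>T z. connectedin X T \<and> connectedin X (insert z T) \<and> y \<in> T \<and>
       T \<subseteq> level (d y) \<inter> \<phi> ` U \<and> z \<in> N \<inter> level (d (\<phi> u))))"
proof -
  interpret c: orbi_chart n X U \<Gamma> \<phi> by (rule orbi_chart[OF c])
  obtain W B \<zeta> r where "linear_chart n X U \<Gamma> \<phi> u W B \<zeta> r" using c.linear_chart_exists[OF u] by blast
  then interpret L: linear_chart n X U \<Gamma> \<phi> u W B \<zeta> r .
  have WU: "w \<in> U" if "w \<in> W" for w using that L.W(3) by blast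
  have dW: "d (\<phi> w) = cov_rank n (L.lin_cov (c.stab w))" if w: "w \<in> W" for w
    using stratum_dim_eq[OF c WU[OF w]] L.cov_rank_lin_cov[OF w] by simp
  \<comment> \<open>In W all stabilisers lie in that of u, and a proper subgroup strictly raises the
    dimension.\<close>
  have deq: "d (\<phi> w) = d (\<phi> u) \<longleftrightarrow> c.stab w = c.stab u" if w: "w \<in> W" for w
    using dW[OF w] dW[OF L.W(2)] L.cov_rank_less[OF w] by (cases "c.stab w = c.stab u") auto
  have type: "w \<in> orbit_type_set U \<Gamma> (c.stab u) \<longleftrightarrow> c.stab w = c.stab u" if w: "w \<in> W" for w
    using c.orbit_type_stab_subset[of w u] L.stab_le[OF w] c.orbit_type_self[OF WU[OF w]] by auto
  define N where "N = \<phi> ` W"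
  define S where "S = \<phi> ` {w \<in> W. c.stab w = c.stab u}"
  have N: "openin X N" "\<phi> u \<in> N" "N \<subseteq> \<phi> ` U"
    using c.open_phi[OF L.W(1,3)] L.W(2,3) by (auto simp: N_def)
  have NS: "N \<inter> level (d (\<phi> u)) = S"
  proof (intro subset_antisym subsetI)
    fix y assume "y \<in> N \<inter> level (d (\<phi> u))"
    then obtain w where "w \<in> W" "y = \<phi> w" "d (\<phi> w) = d (\<phi> u)" by (auto simp: N_def level_def)
    then show "y \<in> S" using deq by (auto simp: S_def)
  next
    fix y assume "y \<in> S"
    then obtain w where "w \<in> W" "y = \<phi> w" "c.stab w = c.stab u" by (auto simp: S_def)
    then show "y \<in> N \<inter> level (d (\<phi> u))" using deq c.phi_mem[OF WU] by (auto simp: N_def level_def)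
  qed
  have NT: "N \<inter> \<phi> ` orbit_type_set U \<Gamma> (c.stab u) = S"
  proof (intro subset_antisym subsetI)
    fix y assume "y \<in> N \<inter> \<phi> ` orbit_type_set U \<Gamma> (c.stab u)"
    then obtain w w' where w: "w \<in> W" "y = \<phi> w" "w' \<in> orbit_type_set U \<Gamma> (c.stab u)" "y = \<phi> w'"
      by (auto simp: N_def)
    have "w' \<in> U" using w(3) by (simp add: c.orbit_type_iff)
    moreover have "\<phi> w' = \<phi> w" using w(2,4) by simp
    ultimately obtain g where "g \<in> \<Gamma>" "w = g w'" using c.phi_eq_iff[of w' w] WU[OF w(1)] by blast
    then have "w \<in> orbit_type_set U \<Gamma> (c.stab u)" using c.orbit_type_invariant[OF c.stab_subset w(3)] by blast
    then show "y \<in> S" using type[OF w(1)] w by (auto simp: S_def)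
  next
    fix y assume "y \<in> S"
    then show "y \<in> N \<inter> \<phi> ` orbit_type_set U \<Gamma> (c.stab u)" using type by (auto simp: S_def N_def)
  qed
  have conn: "connectedin X S"
  proof -
    \<comment> \<open>The image of the segment from 0 to the linear coordinate of w. All these sets
      share the point \<phi> u.\<close>
    define R where "R w = (\<lambda>t. \<phi> (\<zeta> (\<lambda>i. (1 - t) * 0 + t * c.lin u w i))) ` {0..1}" for w
    have R: "connectedin X (R w)" "\<phi> u \<in> R w" "\<phi> w \<in> R w" "R w \<subseteq> S"
      if w: "w \<in> W" "c.stab w = c.stab u" for w
    proof -
      have z: "c.lin u w \<in> B" by (rule L.lin_W[OF w(1)])
      show "connectedin X (R w)" unfolding R_def by (rule L.connected_path[OF L.zero_B z]) auto
      have "\<phi> u = \<phi> (\<zeta> (\<lambda>i. (1 - 0) * 0 + 0 * c.lin u w i))" by (simp add: L.zeta_zero)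
      then show "\<phi> u \<in> R w" unfolding R_def by (rule image_eqI) simp
      have "\<phi> w = \<phi> (\<zeta> (\<lambda>i. (1 - 1) * 0 + 1 * c.lin u w i))" by (simp add: L.zeta(3)[OF w(1)])
      then show "\<phi> w \<in> R w" unfolding R_def by (rule image_eqI) simp
      show "R w \<subseteq> S"
      proof
        fix y assume "y \<in> R w"
        then obtain t where t: "0 \<le> t" "t \<le> 1" "y = \<phi> (\<zeta> (\<lambda>i. (1 - t) * 0 + t * c.lin u w i))"
          unfolding R_def by auto
        have "c.stab (\<zeta> (\<lambda>i. (1 - t) * 0 + t * c.lin u w i)) = c.stab u"
          by (rule L.stab_ray[OF z t(1,2)]) (use L.stab_W_iff[OF w(1)] w(2) in blast)
        moreover have "\<zeta> (\<lambda>i. (1 - t) * 0 + t * c.lin u w i) \<in> W"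
          by (rule L.zeta(1)[OF L.B_segment[OF L.zero_B z t(1,2)]])
        ultimately show "y \<in> S" unfolding S_def t(3) by blast
      qed
    qed
    have uS: "u \<in> {w \<in> W. c.stab w = c.stab u}" using L.W(2) by simp
    have "S = \<Union>(R ` {w \<in> W. c.stab w = c.stab u})"
    proof (intro subset_antisym subsetI)
      fix y assume "y \<in> S"
      then obtain w where w: "w \<in> W" "c.stab w = c.stab u" "y = \<phi> w" by (auto simp: S_def)
      then show "y \<in> \<Union>(R ` {w \<in> W. c.stab w = c.stab u})" using R(3)[OF w(1,2)] by blast
    next
      fix y assume "y \<in> \<Union>(R ` {w \<in> W. c.stab w = c.stab u})"
      then show "y \<in> S" using R(4) by blast
    qed
    moreover have "connectedin X (\<Union>(R ` {w \<in> W. c.stab w = c.stab u}))"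
    proof (rule connectedin_Union)
      show "connectedin X Q" if "Q \<in> R ` {w \<in> W. c.stab w = c.stab u}" for Q using that R(1) by blast
      have "\<phi> u \<in> \<Inter> (R ` {w \<in> W. c.stab w = c.stab u})" using R(2) by blast
      then show "\<Inter> (R ` {w \<in> W. c.stab w = c.stab u}) \<noteq> {}" by blast
    qed
    ultimately show ?thesis by simp
  qed
  have cone: "\<exists>T z. connectedin X T \<and> connectedin X (insert z T) \<and> y \<in> T \<and>
       T \<subseteq> level (d y) \<inter> \<phi> ` U \<and> z \<in> S" if y: "y \<in> N" for y
  proof -
    obtain w where w: "w \<in> W" "y = \<phi> w" using y by (auto simp: N_def)
    define z where "z = c.lin u w"
    have z: "z \<in> B" unfolding z_def by (rule L.lin_W[OF w(1)])
    have zw: "\<zeta> z = w" unfolding z_def by (rule L.zeta(3)[OF w(1)])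
    let ?p = "\<lambda>t i. (1 - t) * L.fix_proj z i + t * z i"
    \<comment> \<open>The parameter t = 0 is left out: at the projection the stabiliser becomes that
      of u, whereas for t > 0 it is that of w. The point at t = 0 serves as z.\<close>
    define T where "T = (\<lambda>t. \<phi> (\<zeta> (?p t))) ` {0<..1}"
    have Pz: "L.fix_proj z \<in> B" by (rule L.fix_proj_B[OF z])
    have 1: "connectedin X T" unfolding T_def by (rule L.connected_path[OF Pz z]) auto
    have "connectedin X ((\<lambda>t. \<phi> (\<zeta> (?p t))) ` {0..1})" by (rule L.connected_path[OF Pz z]) auto
    moreover have "{0..1::real} = insert 0 {0<..1}" by auto
    ultimately have 2: "connectedin X (insert (\<phi> (\<zeta> (?p 0))) T)" unfolding T_def by simp
    have "y = \<phi> (\<zeta> (?p 1))" using zw w(2) by simp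
    then have 3: "y \<in> T" unfolding T_def by (rule image_eqI) simp
    have 4: "T \<subseteq> level (d y) \<inter> \<phi> ` U"
    proof
      fix x assume "x \<in> T"
      then obtain t where t: "0 < t" "t \<le> 1" "x = \<phi> (\<zeta> (?p t))" unfolding T_def by auto
      have pW: "\<zeta> (?p t) \<in> W" using L.zeta(1)[OF L.B_segment[OF Pz z, of t]] t by simp
      have "c.stab (\<zeta> (?p t)) = c.stab w" using L.stab_segment[OF z t(1,2)] zw by simp
      then have "d x = d y" using dW[OF pW] dW[OF w(1)] t(3) w(2) by simp
      then show "x \<in> level (d y) \<inter> \<phi> ` U" using c.phi_mem[OF WU[OF pW]] WU[OF pW] t(3) by (auto simp: level_def)
    qed
    have "\<zeta> (L.fix_proj z) \<in> W" by (rule L.zeta(1)[OF Pz])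
    moreover have "c.stab (\<zeta> (L.fix_proj z)) = c.stab u"
      using L.stab_zeta_iff[OF Pz] L.fix_proj_fixed by blast
    ultimately have "\<phi> (\<zeta> (?p 0)) \<in> S" by (auto simp: S_def)
    then show ?thesis using 1 2 3 4 by blast
  qed
  have NST: "N \<inter> level (d (\<phi> u)) = N \<inter> \<phi> ` orbit_type_set U \<Gamma> (c.stab u)" using NS NT by simp
  have conn': "connectedin X (N \<inter> level (d (\<phi> u)))" using NS conn by simp
  have cone': "\<forall>y\<in>N. d y \<noteq> d (\<phi> u) \<longrightarrow> (\<exists>T z. connectedin X T \<and> connectedin X (insert z T) \<and> y \<in> T \<and>
       T \<subseteq> level (d y) \<inter> \<phi> ` U \<and> z \<in> N \<inter> level (d (\<phi> u)))"
    unfolding NS by (intro ballI impI cone)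
  show ?thesis
    by (rule exI[of _ N]) (intro conjI N NST conn' cone')
qed

lemma level_top: "level k \<subseteq> topspace X"
  by (auto simp: level_def)

text \<open>An orbit type may contain points of several dimensions, and a level set points of
  several orbit types. Their intersection R is open and closed in both, so the components at x
  agree.\<close>

lemma component_orbit_type:
  assumes c: "(U, \<Gamma>, \<phi>) \<in> A" and H: "H \<subseteq> \<Gamma>" and x: "x \<in> \<phi> ` orbit_type_set U \<Gamma> H"
  shows "connected_component_of_set (subtopology X (\<phi> ` orbit_type_set U \<Gamma> H)) x =
    connected_component_of_set (subtopology X (level (d x) \<inter> \<phi> ` U)) x"
proof -
  interpret c: orbi_chart n X U \<Gamma> \<phi> by (rule orbi_chart[OF c])
  let ?T = "\<phi> ` orbit_type_set U \<Gamma> H" and ?L = "level (d x) \<inter> \<phi> ` U"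
  have TU: "orbit_type_set U \<Gamma> H \<subseteq> U" by (auto simp: c.orbit_type_iff)
  have UX: "\<phi> ` U \<subseteq> topspace X" using c.phi_mem by blast
  have sat: "v \<in> orbit_type_set U \<Gamma> H" if v: "v \<in> U" "\<phi> v \<in> ?T" for v
  proof -
    obtain w where w: "w \<in> orbit_type_set U \<Gamma> H" "\<phi> w = \<phi> v" using v(2) by auto
    then obtain g where "g \<in> \<Gamma>" "v = g w" using c.phi_eq_iff[of w v] v(1) TU by blast
    then show ?thesis using c.orbit_type_invariant[OF H w(1)] by blast
  qed
  \<comment> \<open>Orbit types are equal or disjoint, so near y the level set of y either coincides
    with the given type or misses it.\<close>
  have nbhd: "\<exists>N. openin X N \<and> y \<in> N \<and> (y \<in> ?T \<longrightarrow> N \<inter> level (d y) = N \<inter> ?T) \<and> (y \<notin> ?T \<longrightarrow> N \<inter> level (d y) \<inter> ?T = {})"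
    if y: "y \<in> \<phi> ` U" for y
  proof -
    obtain v where v: "v \<in> U" "y = \<phi> v" using y by (rule imageE)
    obtain N where N: "openin X N" "y \<in> N" "N \<inter> level (d y) = N \<inter> \<phi> ` orbit_type_set U \<Gamma> (c.stab v)"
      using local_structure[OF c v(1)] unfolding v(2) by blast
    have "N \<inter> level (d y) = N \<inter> ?T" if yT: "y \<in> ?T"
    proof -
      have "v \<in> orbit_type_set U \<Gamma> H" using sat[OF v(1)] yT unfolding v(2) by blast
      from c.orbit_type_eq[OF H this] show ?thesis using N(3) by (simp only:)
    qed
    moreover have "N \<inter> level (d y) \<inter> ?T = {}" if "y \<notin> ?T"
    proof (rule ccontr)
      assume "N \<inter> level (d y) \<inter> ?T \<noteq> {}"
      then obtain x' where x': "x' \<in> \<phi> ` orbit_type_set U \<Gamma> (c.stab v)" "x' \<in> ?T" using N(3) by blast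
      obtain w where w: "w \<in> orbit_type_set U \<Gamma> (c.stab v)" "x' = \<phi> w" using x'(1) by blast
      have "w \<in> U" using w(1) by (simp add: c.orbit_type_iff)
      then have wH: "w \<in> orbit_type_set U \<Gamma> H" using x'(2) unfolding w(2) by (rule sat)
      have "orbit_type_set U \<Gamma> H = orbit_type_set U \<Gamma> (c.stab v)"
        by (rule trans[OF c.orbit_type_eq[OF H wH] c.orbit_type_eq[OF c.stab_subset w(1), symmetric]])
      then have "v \<in> orbit_type_set U \<Gamma> H" using c.orbit_type_self[OF v(1)] by simp
      then show False using \<open>y \<notin> ?T\<close> v(2) by blast
    qed
    ultimately show ?thesis using N(1,2) by blast
  qed
  define R where "R = ?T \<inter> level (d x)"
  have xR: "x \<in> R" using x TU UX by (auto simp: R_def level_def)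
  have RT: "R \<subseteq> ?T" and TX: "?T \<subseteq> topspace X" and RL: "R \<subseteq> ?L" and LX: "?L \<subseteq> topspace X"
    using TU UX by (auto simp: R_def)
  have lev: "y \<in> level k \<longleftrightarrow> d y = k" if "y \<in> \<phi> ` U" for y k using that UX by (auto simp: level_def)
  have nT: "\<exists>N. openin X N \<and> y \<in> N \<and> (y \<in> R \<longrightarrow> N \<inter> ?T \<subseteq> R) \<and> (y \<notin> R \<longrightarrow> N \<inter> R = {})" if y: "y \<in> ?T" for y
  proof -
    have yU: "y \<in> \<phi> ` U" using y TU by blast
    obtain N where N: "openin X N" "y \<in> N" "N \<inter> level (d y) = N \<inter> ?T" using nbhd[OF yU] y by blast
    have "N \<inter> ?T \<subseteq> R" if "y \<in> R" using that N(3) lev[OF yU, of "d x"] by (auto simp: R_def)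
    moreover have "N \<inter> R = {}" if "y \<notin> R"
    proof (rule ccontr)
      assume "N \<inter> R \<noteq> {}"
      then obtain y' where "y' \<in> N" "y' \<in> ?T" "y' \<in> level (d x)" by (auto simp: R_def)
      moreover from this have "y' \<in> level (d y)" using N(3) by blast
      ultimately have "d y = d x" by (simp add: level_def)
      then show False using \<open>y \<notin> R\<close> y lev[OF yU] by (simp add: R_def)
    qed
    ultimately show ?thesis using N(1,2) by blast
  qed
  have nL: "\<exists>N. openin X N \<and> y \<in> N \<and> (y \<in> R \<longrightarrow> N \<inter> ?L \<subseteq> R) \<and> (y \<notin> R \<longrightarrow> N \<inter> R = {})" if y: "y \<in> ?L" for y
  proof -
    have yU: "y \<in> \<phi> ` U" and dy: "d y = d x" using y by (auto simp: level_def)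
    obtain N where N: "openin X N" "y \<in> N" "y \<in> ?T \<longrightarrow> N \<inter> level (d y) = N \<inter> ?T" "y \<notin> ?T \<longrightarrow> N \<inter> level (d y) \<inter> ?T = {}"
      using nbhd[OF yU] by blast
    have "N \<inter> ?L \<subseteq> R" if "y \<in> R" using that N(3) dy by (auto simp: R_def)
    moreover have "N \<inter> R = {}" if "y \<notin> R" using that N(4) dy y by (auto simp: R_def)
    ultimately show ?thesis using N(1,2) by blast
  qed
  have "connected_component_of_set (subtopology (subtopology X ?T) R) x = connected_component_of_set (subtopology X ?T) x"
    by (rule component_clopen_subtopology[OF clopen_subtopologyI(1)[OF RT TX nT] clopen_subtopologyI(2)[OF RT TX nT] xR])
  moreover have "connected_component_of_set (subtopology (subtopology X ?L) R) x = connected_component_of_set (subtopology X ?L) x"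
    by (rule component_clopen_subtopology[OF clopen_subtopologyI(1)[OF RL LX nL] clopen_subtopologyI(2)[OF RL LX nL] xR])
  moreover have "subtopology (subtopology X ?T) R = subtopology X R" "subtopology (subtopology X ?L) R = subtopology X R"
    using RT RL by (simp_all add: subtopology_subtopology Int_absorb1)
  ultimately show ?thesis by simp
qed

text \<open>Every u has the orbit type of its own stabiliser, so the types of all subgroups H cover
  the chart, and both sides collect the same components.\<close>

lemma chart_strata_eq:
  assumes c: "c \<in> A"
  shows "chart_strata X c = (\<Union>k. connected_components_of (subtopology X (level k \<inter> chart_image c)))"
proof -
  obtain U \<Gamma> \<phi> where cU: "c = (U, \<Gamma>, \<phi>)" by (cases c)
  have c': "(U, \<Gamma>, \<phi>) \<in> A" using c cU by simp
  interpret c: orbi_chart n X U \<Gamma> \<phi> by (rule orbi_chart[OF c'])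
  define C where "C x = connected_component_of_set (subtopology X (level (d x) \<inter> \<phi> ` U)) x" for x
  have UX: "\<phi> ` U \<subseteq> topspace X" using c.phi_mem by blast
  have "connected_components_of (subtopology X (\<phi> ` orbit_type_set U \<Gamma> H)) = C ` (\<phi> ` orbit_type_set U \<Gamma> H)"
    if H: "subgroup H c.G" for H
  proof -
    have H': "H \<subseteq> \<Gamma>" using subgroup.subset[OF H] by simp
    have "\<phi> ` orbit_type_set U \<Gamma> H \<subseteq> topspace X" using UX by (auto simp: c.orbit_type_iff)
    then show ?thesis
      unfolding C_def connected_components_subtopology
      by (subst connected_components_subtopology, assumption)
         (rule image_cong[OF refl component_orbit_type[OF c' H']])
  qed
  then have "chart_strata X c = (\<Union>H\<in>{H. subgroup H c.G}. C ` (\<phi> ` orbit_type_set U \<Gamma> H))"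
    unfolding chart_strata_def cU prod.case by (intro SUP_cong) auto
  also have "\<dots> = C ` (\<Union>H\<in>{H. subgroup H c.G}. \<phi> ` orbit_type_set U \<Gamma> H)" by (rule image_UN[symmetric])
  also have "(\<Union>H\<in>{H. subgroup H c.G}. \<phi> ` orbit_type_set U \<Gamma> H) = \<phi> ` U"
  proof (intro subset_antisym subsetI)
    fix y assume "y \<in> \<phi> ` U"
    then obtain u where u: "u \<in> U" "y = \<phi> u" by blast
    have "y \<in> \<phi> ` orbit_type_set U \<Gamma> (c.stab u)" using c.orbit_type_self[OF u(1)] u(2) by blast
    then show "y \<in> (\<Union>H\<in>{H. subgroup H c.G}. \<phi> ` orbit_type_set U \<Gamma> H)" using c.stab_subgroup[OF u(1)] by blast
  qed (auto simp: c.orbit_type_iff)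
  also have "C ` (\<phi> ` U) = (\<Union>k. connected_components_of (subtopology X (level k \<inter> \<phi> ` U)))"
  proof -
    have "connected_components_of (subtopology X (level k \<inter> \<phi> ` U)) = C ` (level k \<inter> \<phi> ` U)" for k
    proof -
      have "level k \<inter> \<phi> ` U \<subseteq> topspace X" using level_top by blast
      from connected_components_subtopology[OF this] show ?thesis
        by (simp only:) (rule image_cong[OF refl], simp add: C_def level_def)
    qed
    then have "(\<Union>k. connected_components_of (subtopology X (level k \<inter> \<phi> ` U))) = (\<Union>k. C ` (level k \<inter> \<phi> ` U))" by simp
    also have "\<dots> = C ` (\<Union>k. level k \<inter> \<phi> ` U)" by (rule image_UN[symmetric])
    also have "(\<Union>k. level k \<inter> \<phi> ` U) = \<phi> ` U" using UX by (auto simp: level_def)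
    finally show ?thesis by simp
  qed
  finally show ?thesis by (simp add: chart_image_def cU)
qed

lemma stratification_eq:
  "orbifold_stratification X A = (\<Union>k. connected_components_of (subtopology X (level k)))"
proof -
  have "stratified_charts X d A chart_image (chart_strata X) level"
  proof
    show "level k = {x \<in> topspace X. d x = k}" for k by (rule level_def)
    show "openin X (chart_image c)" if cA: "c \<in> A" for c
    proof -
      obtain U \<Gamma> \<phi> where cU: "c = (U, \<Gamma>, \<phi>)" by (cases c)
      interpret c: orbi_chart n X U \<Gamma> \<phi> using orbi_chart cA cU by blast
      show ?thesis using c.open_image by (simp add: chart_image_def cU)
    qed
    show "(\<Union>c\<in>A. chart_image c) = topspace X" using atlas unfolding orbifold_atlas_def by (elim conjE)
    show "chart_strata X c = (\<Union>k. connected_components_of (subtopology X (level k \<inter> chart_image c)))" if "c \<in> A" for c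
      by (rule chart_strata_eq[OF that])
    show "\<exists>N. openin X N \<and> x \<in> N \<and> N \<subseteq> chart_image c \<and> connectedin X (N \<inter> level (d x)) \<and>
      (\<forall>y\<in>N. d y \<noteq> d x \<longrightarrow> (\<exists>T z. connectedin X T \<and> connectedin X (insert z T) \<and> y \<in> T \<and>
        T \<subseteq> level (d y) \<inter> chart_image c \<and> z \<in> N \<inter> level (d x)))"
      if cA: "c \<in> A" and x: "x \<in> chart_image c" for c x
    proof -
      obtain U \<Gamma> \<phi> where cU: "c = (U, \<Gamma>, \<phi>)" by (cases c)
      have img: "chart_image c = \<phi> ` U" by (simp add: chart_image_def cU)
      have c': "(U, \<Gamma>, \<phi>) \<in> A" using cA cU by simp
      obtain u where u: "u \<in> U" "x = \<phi> u" using x unfolding img by blast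
      show ?thesis using local_structure[OF c' u(1)] unfolding img u(2) by blast
    qed
  qed
  then interpret stratified_charts X d A chart_image "chart_strata X" level .
  show ?thesis unfolding orbifold_stratification_def by (rule the_stratification)
qed

end

text \<open>Around each point of an open T in Y, the nonvanishing set of a separating function lies
  in T. Its preimage is the nonvanishing set of a smooth function on X, which is open.\<close>

lemma functionally_smooth_continuous:
  assumes X: "orbifold_space n X A" and Y: "orbifold_space m Y B" and f: "f \<in> topspace X \<rightarrow> topspace Y"
    and fs: "functionally_smooth (orbifold_smooth_functions n A) (orbifold_smooth_functions m B) f"
  shows "continuous_map X Y f"
proof -
  interpret X: orbifold_space n X A by fact
  interpret Y: orbifold_space m Y B by fact
  show ?thesis
    unfolding continuous_map_def
  proof (intro conjI allI impI)
    fix T assume T: "openin Y T"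
    show "openin X {x \<in> topspace X. f x \<in> T}"
    proof (subst openin_subopen, intro ballI)
      fix x assume x: "x \<in> {x \<in> topspace X. f x \<in> T}"
      then obtain g where g: "g \<in> Y.F" "g (f x) \<noteq> 0" "\<forall>y. y \<notin> T \<longrightarrow> g y = 0"
        using Y.separating_function[OF T, of "f x"] by blast
      have "g \<circ> f \<in> X.F" using fs g(1) by (simp add: functionally_smooth_def)
      then have "continuous_map X euclideanreal (g \<circ> f)" by (rule X.smooth_function_continuous)
      then have "openin X {x \<in> topspace X. (g \<circ> f) x \<in> - {0}}"
        by (rule openin_continuous_map_preimage) (simp add: open_Compl)
      moreover have "x \<in> {x \<in> topspace X. (g \<circ> f) x \<in> - {0}}" using x g(2) by simp
      moreover have "{x \<in> topspace X. (g \<circ> f) x \<in> - {0}} \<subseteq> {x \<in> topspace X. f x \<in> T}" using g(3) by auto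
      ultimately show "\<exists>S. openin X S \<and> x \<in> S \<and> S \<subseteq> {x \<in> topspace X. f x \<in> T}" by blast
    qed
  qed (fact f)
qed

text \<open>A dominating function and its neighbourhood are carried from X to Y by composing with h,
  so independence of the gs passes to their pullbacks.\<close>

lemma indep_at_transfer:
  assumes hm: "homeomorphic_maps X Y f h"
    and fs: "functionally_smooth F G f" and hs: "functionally_smooth G F h"
    and x: "x \<in> topspace X" and ind: "indep_at Y G (f x) k"
  shows "indep_at X F x k"
proof -
  have hc: "continuous_map Y X h" and hf: "\<And>x. x \<in> topspace X \<Longrightarrow> h (f x) = x"
    and fh: "\<And>y. y \<in> topspace Y \<Longrightarrow> f (h y) = y"
    using hm by (auto simp: homeomorphic_maps_def)
  have fx: "f x \<in> topspace Y" using hm x by (auto simp: homeomorphic_maps_def continuous_map_def)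
  obtain gs where gs: "\<forall>i<k. gs i \<in> G"
    "\<forall>c. critical_at Y G (\<lambda>y. \<Sum>i<k. c i * gs i y) (f x) \<longrightarrow> (\<forall>i<k. c i = (0::real))"
    using ind unfolding indep_at_def by blast
  have "\<forall>i<k. gs i \<circ> f \<in> F" using gs(1) fs by (simp add: functionally_smooth_def)
  moreover have "\<forall>i<k. c i = 0" if c: "critical_at X F (\<lambda>y. \<Sum>i<k. c i * (gs i \<circ> f) y) x" for c
  proof -
    obtain g N where g: "g \<in> F" "openin X N" "x \<in> N" "g x = 0"
      "\<forall>y\<in>N. \<bar>(\<Sum>i<k. c i * (gs i \<circ> f) y) - (\<Sum>i<k. c i * (gs i \<circ> f) x)\<bar> \<le> g y"
      using c unfolding critical_at_def by blast
    define N' where "N' = {y \<in> topspace Y. h y \<in> N}"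
    have "g \<circ> h \<in> G" using hs g(1) by (simp add: functionally_smooth_def)
    moreover have "openin Y N'" unfolding N'_def by (rule openin_continuous_map_preimage[OF hc g(2)])
    moreover have "f x \<in> N'" using fx hf[OF x] g(3) by (simp add: N'_def)
    moreover have "(g \<circ> h) (f x) = 0" using hf[OF x] g(4) by simp
    moreover have "\<bar>(\<Sum>i<k. c i * gs i y) - (\<Sum>i<k. c i * gs i (f x))\<bar> \<le> (g \<circ> h) y" if y: "y \<in> N'" for y
    proof -
      have "h y \<in> N" "f (h y) = y" using y fh by (auto simp: N'_def)
      then show ?thesis using bspec[OF g(5), of "h y"] by simp
    qed
    ultimately have "critical_at Y G (\<lambda>y. \<Sum>i<k. c i * gs i y) (f x)" unfolding critical_at_def by blast
    then show ?thesis using gs(2) by blast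
  qed
  ultimately show ?thesis unfolding indep_at_def by (intro exI[of _ "\<lambda>i. gs i \<circ> f"]) blast
qed

lemma stratum_dim_transfer:
  assumes hm: "homeomorphic_maps X Y f h"
    and fs: "functionally_smooth F G f" and hs: "functionally_smooth G F h"
    and x: "x \<in> topspace X"
  shows "stratum_dim Y G (f x) = stratum_dim X F x"
proof -
  have hm': "homeomorphic_maps Y X h f" using hm homeomorphic_maps_sym by blast
  have "continuous_map X Y f" "\<forall>x\<in>topspace X. h (f x) = x"
    using hm unfolding homeomorphic_maps_def by blast+
  then have fx: "f x \<in> topspace Y" "h (f x) = x" using x unfolding continuous_map_def by blast+
  have "indep_at Y G (f x) k \<longleftrightarrow> indep_at X F x k" for k
    using indep_at_transfer[OF hm fs hs x, of k] indep_at_transfer[OF hm' hs fs fx(1), of k] unfolding fx(2) by blast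
  then have "indep_at Y G (f x) = indep_at X F x" by (intro ext)
  then show ?thesis unfolding stratum_dim_def by (rule arg_cong)
qed

theorem corollary4p15:
  fixes X :: "'a topology" and Y :: "'b topology"
    and n m :: nat
    and A :: "'a orbi_chart set" and B :: "'b orbi_chart set"
    and \<phi> :: "'a \<Rightarrow> 'b"
  assumes "orbifold n X A" and "orbifold m Y B"
    and "bij_betw \<phi> (topspace X) (topspace Y)"
    and "functionally_smooth (orbifold_smooth_functions n A) (orbifold_smooth_functions m B) \<phi>"
    and "functionally_smooth (orbifold_smooth_functions m B) (orbifold_smooth_functions n A)
           (inv_into (topspace X) \<phi>)"
  shows "\<forall>M\<in>orbifold_stratification X A. \<phi> ` M \<in> orbifold_stratification Y B"
proof
  interpret X: orbifold_space n X A by unfold_locales (fact assms(1))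
  interpret Y: orbifold_space m Y B by unfold_locales (fact assms(2))
  let ?\<psi> = "inv_into (topspace X) \<phi>"
  have c: "continuous_map X Y \<phi>"
    by (rule functionally_smooth_continuous[OF X.orbifold_space_axioms Y.orbifold_space_axioms _ assms(4)])
       (use assms(3) in \<open>auto simp: bij_betw_def\<close>)
  have c': "continuous_map Y X ?\<psi>"
    by (rule functionally_smooth_continuous[OF Y.orbifold_space_axioms X.orbifold_space_axioms _ assms(5)])
       (use assms(3) in \<open>auto simp: bij_betw_def inv_into_into\<close>)
  have hm: "homeomorphic_maps X Y \<phi> ?\<psi>"
    unfolding homeomorphic_maps_def
    using c c' bij_betw_inv_into_left[OF assms(3)] bij_betw_inv_into_right[OF assms(3)] by blast
  fix M assume "M \<in> orbifold_stratification X A"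
  then obtain k where k: "M \<in> connected_components_of (subtopology X (X.level k))"
    unfolding X.stratification_eq by blast
  have "\<phi> ` (topspace X \<inter> X.level k) = topspace Y \<inter> Y.level k"
  proof (intro subset_antisym subsetI)
    fix y assume "y \<in> \<phi> ` (topspace X \<inter> X.level k)"
    then obtain x where x: "x \<in> topspace X" "X.d x = k" "y = \<phi> x" by (auto simp: X.level_def)
    have "y \<in> topspace Y" using c x(1,3) by (auto simp: continuous_map_def)
    then show "y \<in> topspace Y \<inter> Y.level k"
      using stratum_dim_transfer[OF hm assms(4,5) x(1)] x(2,3) by (simp add: Y.level_def)
  next
    fix y assume "y \<in> topspace Y \<inter> Y.level k"
    then have y: "y \<in> topspace Y" "Y.d y = k" unfolding Y.level_def by blast+
    have "topspace Y = \<phi> ` topspace X" using assms(3) by (simp add: bij_betw_def)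
    then obtain x where x: "x \<in> topspace X" "y = \<phi> x" using y(1) by blast
    have "x \<in> X.level k" using stratum_dim_transfer[OF hm assms(4,5) x(1)] x y(2) by (simp add: X.level_def)
    then show "y \<in> \<phi> ` (topspace X \<inter> X.level k)" using x by blast
  qed
  then have "homeomorphic_map (subtopology X (X.level k)) (subtopology Y (Y.level k)) \<phi>"
    using homeomorphic_maps_imp_map[OF hm] by (intro homeomorphic_map_subtopologies)
  from homeomorphic_map_connected_components_of[OF this]
  have "\<phi> ` M \<in> connected_components_of (subtopology Y (Y.level k))" using k by blast
  then show "\<phi> ` M \<in> orbifold_stratification Y B" unfolding Y.stratification_eq by blast
qed

end
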